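(* Let $K$ be a field of characteristic $0$, $d\ge2$, and let $\beta=(\beta_1,\beta_2)\in K^2$ with $\beta_2=0$, $\beta_1\ne0$. In $G_d(\mathfrak V_\beta)$ the consequences of degree $n+1$ of the following polynomials of degree $n$ are equivalent to the polynomials listed (with $\gamma_1,\gamma_2\in K$): (i) for $w_{(1)}=x_1$: $w_{(2)}^{(1)}=y_1z_1$, $w_{(1^2)}^{(0)}=y_1z_2-y_2z_1$; (ii) for $w_{(2)}^{(1)}=y_1z_1$: $w_{(3)}^{(2)}=y_1^2z_1$, $w_{(3)}^{(1)}=y_1z_1^2$, $w_{(2,1)}^{(0)}$; (iii) for $w_{(1^2)}^{(0)}=y_1z_2-y_2z_1$: $w_{(3)}^{(2)}-w_{(3)}^{(1)}=y_1z_1(y_1-z_1)$, $w_{(2,1)}^{(0)}$; (iv) for $w_{(n)}=\gamma_1w_{(n)}^{(2)}+\gamma_2w_{(n)}^{(1)}$, $n\ge3$, $(\gamma_1+\gamma_2)\gamma_2\ne0$: $w_{(n+1)}^{(2)}$, $w_{(n+1)}^{(1)}$, $w_{(n,1)}^{(0)}$; (v) for $w_{(n)}=w_{(n)}^{(2)}-w_{(n)}^{(1)}$, $n\ge3$: $w_{(n+1)}^{(2)}-w_{(n+1)}^{(1)}$, $w_{(n,1)}^{(0)}$; (vi) for $w_{(n)}=w_{(n)}^{(2)}$, $n\ge3$: $w_{(n+1)}^{(2)}$; (vii) for $w_{(n-1,1)}^{(0)}$, $n\ge3$: $w_{(n+1)}^{(2)}-w_{(n+1)}^{(1)}$, $w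_{(n,1)}^{(0)}$.
   Context: A bicommutative algebra is a nonassociative $K$-algebra satisfying $(x_1x_2)x_3=(x_1x_3)x_2$ and $x_1(x_2x_3)=x_2(x_1x_3)$; $\mathfrak B$ is the variety of all of them. The free bicommutative algebra $F_d(\mathfrak B)$ on $x_1,\dots,x_d$ is identified (via $x_i\mapsto x_i$) with the algebra $G_d$ having as basis $x_1,\dots,x_d$ together with all monomials $Y^aZ^b=y_1^{a_1}\cdots y_d^{a_d}z_1^{b_1}\cdots z_d^{b_d}$ in the polynomial algebra $K[y_1,\dots,y_d,z_1,\dots,z_d]$ with $|a|\ge1$ and $|b|\ge1$, and multiplication $x_ix_j=y_iz_j$, $x_i(Y^aZ^b)=y_iY^aZ^b$, $(Y^aZ^b)x_i=Y^aZ^bz_i$, $(Y^aZ^b)(Y^cZ^e)=Y^{a+c}Z^{b+e}$. The group $GL_d(K)$ acts on $G_d$ by automorphisms extending its linear action on the span of $x_1,\dots,x_d$. Put $w_{(1)}=x_1$, $w_{(n)}^{(j)}=y_1^jz_1^{n-j}$ ($1\le j\le n-1$), and $w_{(\lambda_1,\lambda_2)}^{(j)}=y_1^j(y_1z_2-y_2z_1)^{\lambda_2}z_1^{\lambda_1-\lambda_2-j}$ for $\lambda_2>0$, $0\le j\le\lambda_1-\lambda_2$; $(1^2)=(1,1)$. $\mathfrak V_\beta$, $\beta\neq(0,0)$, is the variety of bicommutative algebras defined by the identity $\beta_1x(xy-yx)+\beta_2(xy-yx)x=0$, and $G_d(\mathfrak V_\beta)\cong F_d(\mathfrak V_\beta)$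 is the factor algebra of $G_d$ modulo the T-ideal (ideal closed under all endomorphisms) generated by $(\beta_1y_1+\beta_2z_1)(y_1z_2-y_2z_1)$; elements of $G_d$ denote also their images. For a homogeneous $f$ of degree $n$ in $G_d(\mathfrak V_\beta)$, its consequences of degree $n+1$ are the elements of the degree $n+1$ homogeneous component of the T-ideal of $G_d(\mathfrak V_\beta)$ generated by $f$. They are "equivalent to" a list of polynomials if this component equals the $GL_d(K)$-submodule generated by the images of the polynomials in the list. *)

theory Defs
  imports Complex_Main "HOL-Library.Poly_Mapping" "HOL-Library.Product_Plus"
begin

section \<open>Nonassociative algebras, T-ideals, factor algebras\<close>

record ('k, 'a) nalg =
  carr :: "'a set"
  nzero :: 'a
  nadd :: "'a \<Rightarrow> 'a \<Rightarrow> 'a"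
  nscale :: "'k \<Rightarrow> 'a \<Rightarrow> 'a"
  nmult :: "'a \<Rightarrow> 'a \<Rightarrow> 'a"

definition is_subspace :: "('k, 'a) nalg \<Rightarrow> 'a set \<Rightarrow> bool" where
  "is_subspace A S \<longleftrightarrow> S \<subseteq> carr A \<and> nzero A \<in> S \<and>
     (\<forall>u\<in>S. \<forall>v\<in>S. nadd A u v \<in> S) \<and> (\<forall>c. \<forall>v\<in>S. nscale A c v \<in> S)"

definition is_ideal :: "('k, 'a) nalg \<Rightarrow> 'a set \<Rightarrow> bool" where
  "is_ideal A I \<longleftrightarrow> is_subspace A I \<and>
     (\<forall>u\<in>I. \<forall>v\<in>carr A. nmult A u v \<in> I \<and> nmult A v u \<in> I)"

definition is_endo :: "('k, 'a) nalg \<Rightarrow> ('a \<Rightarrow> 'a) \<Rightarrow> bool" where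
  "is_endo A \<phi> \<longleftrightarrow> \<phi> ` carr A \<subseteq> carr A \<and>
     (\<forall>u\<in>carr A. \<forall>v\<in>carr A. \<phi> (nadd A u v) = nadd A (\<phi> u) (\<phi> v)) \<and>
     (\<forall>c. \<forall>v\<in>carr A. \<phi> (nscale A c v) = nscale A c (\<phi> v)) \<and>
     (\<forall>u\<in>carr A. \<forall>v\<in>carr A. \<phi> (nmult A u v) = nmult A (\<phi> u) (\<phi> v))"

definition is_auto :: "('k, 'a) nalg \<Rightarrow> ('a \<Rightarrow> 'a) \<Rightarrow> bool" where
  "is_auto A \<phi> \<longleftrightarrow> is_endo A \<phi> \<and> bij_betw \<phi> (carr A) (carr A)"

definition is_T_ideal :: "('k, 'a) nalg \<Rightarrow> 'a set \<Rightarrow> bool" where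
  "is_T_ideal A I \<longleftrightarrow> is_ideal A I \<and> (\<forall>\<phi>. is_endo A \<phi> \<longrightarrow> \<phi> ` I \<subseteq> I)"

definition T_ideal_gen :: "('k, 'a) nalg \<Rightarrow> 'a set \<Rightarrow> 'a set" where
  "T_ideal_gen A S = \<Inter>{I. is_T_ideal A I \<and> S \<subseteq> I}"

definition coset :: "('k, 'a) nalg \<Rightarrow> 'a set \<Rightarrow> 'a \<Rightarrow> 'a set" where
  "coset A I v = nadd A v ` I"

definition factor_alg :: "('k, 'a) nalg \<Rightarrow> 'a set \<Rightarrow> ('k, 'a set) nalg" where
  "factor_alg A I =
     \<lparr> carr = coset A I ` carr A,
       nzero = coset A I (nzero A),
       nadd = (\<lambda>U V. \<Union>u\<in>U. \<Union>v\<in>V. coset A I (nadd A u v)),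
       nscale = (\<lambda>c U. \<Union>u\<in>U. coset A I (nscale A c u)),
       nmult = (\<lambda>U V. \<Union>u\<in>U. \<Union>v\<in>V. coset A I (nmult A u v)) \<rparr>"


section \<open>The algebra G_d\<close>

text \<open>
  A polynomial in \<open>K[y\<^sub>1,y\<^sub>2,\<dots>,z\<^sub>1,z\<^sub>2,\<dots>]\<close> is a finitely supported function on pairs of
  exponent vectors, \<open>(a, b)\<close> standing for \<open>Y\<^sup>a Z\<^sup>b\<close>. An element of \<open>G\<^sub>d\<close> is a pair \<open>(l, p)\<close>
  standing for \<open>\<Sum>\<^sub>i l\<^sub>i x\<^sub>i + p\<close>. Variables are indexed by \<open>1, \<dots>, d\<close>.
\<close>

type_synonym expo = "nat \<Rightarrow>\<^sub>0 nat"
type_synonym 'k yzpoly = "(expo \<times> expo) \<Rightarrow>\<^sub>0 'k"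
type_synonym 'k gelem = "(nat \<Rightarrow>\<^sub>0 'k) \<times> 'k yzpoly"

definition yv :: "nat \<Rightarrow> 'k::field yzpoly" where
  "yv i = Poly_Mapping.single (Poly_Mapping.single i 1, 0) 1"

definition zv :: "nat \<Rightarrow> 'k::field yzpoly" where
  "zv i = Poly_Mapping.single (0, Poly_Mapping.single i 1) 1"

definition const :: "'k \<Rightarrow> 'k::field yzpoly" where
  "const c = Poly_Mapping.single 0 c"

definition gx :: "nat \<Rightarrow> 'k::field gelem" where
  "gx i = (Poly_Mapping.single i 1, 0)"

definition gpoly :: "'k yzpoly \<Rightarrow> 'k::field gelem" where
  "gpoly p = (0, p)"

definition expo_deg :: "expo \<Rightarrow> nat" where
  "expo_deg a = (\<Sum>i\<in>Poly_Mapping.keys a. Poly_Mapping.lookup a i)"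

definition yform :: "(nat \<Rightarrow>\<^sub>0 'k) \<Rightarrow> 'k::field yzpoly" where
  "yform l = (\<Sum>i\<in>Poly_Mapping.keys l. const (Poly_Mapping.lookup l i) * yv i)"

definition zform :: "(nat \<Rightarrow>\<^sub>0 'k) \<Rightarrow> 'k::field yzpoly" where
  "zform l = (\<Sum>i\<in>Poly_Mapping.keys l. const (Poly_Mapping.lookup l i) * zv i)"

definition gscale :: "'k \<Rightarrow> 'k gelem \<Rightarrow> 'k::field gelem" where
  "gscale c u = (Poly_Mapping.map ((*) c) (fst u), Poly_Mapping.map ((*) c) (snd u))"

text \<open>
  The bilinear extension of the multiplication table of \<open>G\<^sub>d\<close>: a left factor \<open>x\<^sub>i\<close> acts as
  \<open>y\<^sub>i\<close>, a right factor \<open>x\<^sub>j\<close> acts as \<open>z\<^sub>j\<close>; see \<open>gmult_table\<close> below.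
\<close>

definition gmult :: "'k gelem \<Rightarrow> 'k gelem \<Rightarrow> 'k::field gelem" where
  "gmult u v = (0, (yform (fst u) + snd u) * (zform (fst v) + snd v))"

lemma gmult_table:
  "gmult (gx i) (gx j) = gpoly (yv i * zv j)"
  "gmult (gx i) (gpoly p) = gpoly (yv i * p)"
  "gmult (gpoly p) (gx j) = gpoly (p * zv j)"
  "gmult (gpoly p) (gpoly q) = gpoly (p * q)"
  by (simp_all add: gmult_def gx_def gpoly_def yform_def zform_def const_def
      zero_prod_def[symmetric])

definition G :: "nat \<Rightarrow> ('k::field, 'k gelem) nalg" where
  "G d = \<lparr> carr = {(l, p). Poly_Mapping.keys l \<subseteq> {1..d} \<and>
              (\<forall>(a, b)\<in>Poly_Mapping.keys p. Poly_Mapping.keys a \<subseteq> {1..d} \<and> Poly_Mapping.keys b \<subseteq> {1..d} \<and>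
                 expo_deg a \<ge> 1 \<and> expo_deg b \<ge> 1)},
           nzero = 0, nadd = (+), nscale = gscale, nmult = gmult \<rparr>"

definition G_comp :: "nat \<Rightarrow> nat \<Rightarrow> 'k::field gelem set" where
  "G_comp d n = {(l, p) \<in> carr (G d). (l \<noteq> 0 \<longrightarrow> n = 1) \<and>
     (\<forall>(a, b)\<in>Poly_Mapping.keys p. expo_deg a + expo_deg b = n)}"


section \<open>The action of the general linear group\<close>

definition GL :: "nat \<Rightarrow> (nat \<Rightarrow> nat \<Rightarrow> 'k::field) set" where
  "GL d = {A. \<exists>B. \<forall>i\<in>{1..d}. \<forall>j\<in>{1..d}.
     (\<Sum>k=1..d. A i k * B k j) = (if i = j then 1 else 0) \<and>
     (\<Sum>k=1..d. B i k * A k j) = (if i = j then 1 else 0)}"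

definition GL_autos :: "nat \<Rightarrow> ('k gelem \<Rightarrow> 'k::field gelem) set" where
  "GL_autos d = {\<phi>. is_auto (G d) \<phi> \<and>
     (\<exists>A\<in>GL d. \<forall>j\<in>{1..d}. \<phi> (gx j) = (\<Sum>i=1..d. gscale (A i j) (gx i)))}"


section \<open>The relatively free algebra of the variety, and consequences\<close>

definition V_ideal :: "nat \<Rightarrow> 'k \<times> 'k \<Rightarrow> 'k::field gelem set" where
  "V_ideal d \<beta> = T_ideal_gen (G d)
     {gpoly ((const (fst \<beta>) * yv 1 + const (snd \<beta>) * zv 1) * (yv 1 * zv 2 - yv 2 * zv 1))}"

definition GV :: "nat \<Rightarrow> 'k \<times> 'k \<Rightarrow> ('k::field, 'k gelem set) nalg" where
  "GV d \<beta> = factor_alg (G d) (V_ideal d \<beta>)"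

definition img :: "nat \<Rightarrow> 'k \<times> 'k \<Rightarrow> 'k gelem \<Rightarrow> 'k::field gelem set" where
  "img d \<beta> = coset (G d) (V_ideal d \<beta>)"

definition consequences :: "nat \<Rightarrow> 'k \<times> 'k \<Rightarrow> nat \<Rightarrow> 'k gelem \<Rightarrow> 'k::field gelem set set" where
  "consequences d \<beta> m f = T_ideal_gen (GV d \<beta>) {img d \<beta> f} \<inter> img d \<beta> ` G_comp d m"

text \<open>
  \<open>V_ideal d \<beta>\<close> is stable under the automorphisms in \<open>GL_autos d\<close>, so these act on cosets
  by taking images.
\<close>

definition GL_submodule_gen ::
    "nat \<Rightarrow> 'k \<times> 'k \<Rightarrow> 'k gelem set set \<Rightarrow> 'k::field gelem set set" where
  "GL_submodule_gen d \<beta> S =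
     \<Inter>{M. is_subspace (GV d \<beta>) M \<and> (\<forall>\<phi>\<in>GL_autos d. \<forall>U\<in>M. \<phi> ` U \<in> M) \<and> S \<subseteq> M}"

definition conseq_equiv :: "nat \<Rightarrow> 'k \<times> 'k \<Rightarrow> nat \<Rightarrow> 'k gelem \<Rightarrow> 'k::field gelem set \<Rightarrow> bool" where
  "conseq_equiv d \<beta> n f fs \<longleftrightarrow>
     f \<in> G_comp d n \<and>
     consequences d \<beta> (n + 1) f = GL_submodule_gen d \<beta> (img d \<beta> ` fs)"

definition w1 :: "nat \<Rightarrow> nat \<Rightarrow> 'k::field gelem" where
  "w1 n j = gpoly (yv 1 ^ j * zv 1 ^ (n - j))"

definition w2 :: "nat \<Rightarrow> nat \<Rightarrow> nat \<Rightarrow> 'k::field gelem" where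
  "w2 m k j = gpoly (yv 1 ^ j * (yv 1 * zv 2 - yv 2 * zv 1) ^ k * zv 1 ^ (m - k - j))"

end

theory Submission
  imports Defs "HOL-Computational_Algebra.Polynomial"
begin

text \<open>
  Modulo the T-ideal of the identity, a monomial \<open>Y\<^sup>a Z\<^sup>b\<close> with \<open>|a| \<ge> 2\<close> depends only on its
  content \<open>a + b\<close>: polarizing \<open>y\<^sub>1 (y\<^sub>1 z\<^sub>2 - y\<^sub>2 z\<^sub>1)\<close> gives \<open>y\<^sub>k y\<^sub>i z\<^sub>j = y\<^sub>k y\<^sub>j z\<^sub>i\<close> (here
  \<open>3 \<noteq> 0\<close> is used), and substituting a product for \<open>x\<^sub>2\<close> gives \<open>y\<^sub>i y\<^sub>j z\<^sub>k y\<^sub>l = y\<^sub>i y\<^sub>j z\<^sub>k z\<^sub>l\<close>.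

  The consequences are bounded from above by two T-ideals containing the identity: the kernel of
  \<open>y\<^sub>i, z\<^sub>i \<mapsto> t\<^sub>i\<close>, which is T-closed because \<open>x\<^sub>i\<close> acts in the same way from both sides after this
  substitution, and the span of the monomials with \<open>|a| \<ge> 2\<close>.

  A subspace stable under all transvections \<open>x\<^sub>k \<mapsto> x\<^sub>k + s x\<^sub>i\<close> is stable under the derivations
  \<open>x\<^sub>k \<mapsto> x\<^sub>i\<close>, the coefficients of \<open>s\<close>. Applied to the polynomials of the lists, these derivations
  produce the whole homogeneous component of the bounding T-ideal.
\<close>

text \<open>The identity relates only monomials of y-degree at least 2, and monomials y_i Z^b remain
  independent modulo it. So a homogeneous component has a low part |a| = 1, where content decides
  only once the bracket y_1 z_2 - y_2 z_1 times a power of z_1 is available, and a high part |a| >=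
  2, where it always decides. This explains the shapes of the lists. For gamma_1 w^(2) + gamma_2
  w^(1), gamma_1 + gamma_2 is the coefficient of t_1^n after merging and gamma_2 that of the low
  part: if both are nonzero, the whole next component follows; if the first vanishes, all
  consequences stay in the kernel of merging; if the second vanishes, they stay in the high part.
  The proof is a squeeze inside G_d: each T-ideal containing the identity and f contains the list,
  and each GL-stable subspace containing the T-ideal of the identity and the list contains the next
  component of the bounding T-ideal. In the second half multiplication is forbidden, because such a
  subspace need not be an ideal; only derivations and the relations of the identity remain.\<close>

declare One_nat_def [simp del]

section \<open>Exponent vectors\<close>

abbreviation ex :: "nat \<Rightarrow> expo" where
  "ex i \<equiv> Poly_Mapping.single i 1"

lemma expo_deg_superset:
  assumes "finite A" "Poly_Mapping.keys a \<subseteq> A"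
  shows "expo_deg a = (\<Sum>i\<in>A. Poly_Mapping.lookup a i)"
  unfolding expo_deg_def using assms
  by (intro sum.mono_neutral_left) (auto simp: in_keys_iff)

lemma expo_deg_zero [simp]: "expo_deg 0 = 0"
  by (simp add: expo_deg_def)

lemma expo_deg_single [simp]: "expo_deg (Poly_Mapping.single i n) = n"
  by (simp add: expo_deg_def)

lemma expo_deg_add [simp]: "expo_deg (a + b) = expo_deg a + expo_deg b"
proof -
  let ?A = "Poly_Mapping.keys a \<union> Poly_Mapping.keys b"
  have "expo_deg (a + b) = (\<Sum>i\<in>?A. Poly_Mapping.lookup (a + b) i)"
    by (intro expo_deg_superset) (auto simp: keys_add)
  also have "\<dots> = (\<Sum>i\<in>?A. Poly_Mapping.lookup a i) + (\<Sum>i\<in>?A. Poly_Mapping.lookup b i)"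
    by (simp add: lookup_add sum.distrib)
  also have "\<dots> = expo_deg a + expo_deg b"
    by (simp add: expo_deg_superset[of ?A a] expo_deg_superset[of ?A b])
  finally show ?thesis .
qed

lemma keys_expo_add: "Poly_Mapping.keys (a + b :: expo) = Poly_Mapping.keys a \<union> Poly_Mapping.keys b"
  by (auto simp: in_keys_iff lookup_add)

lemma expo_split_key:
  assumes "i \<in> Poly_Mapping.keys (a :: expo)"
  obtains a' where "a = ex i + a'"
proof
  show "a = ex i + (a - ex i)"
    using assms by (intro poly_mapping_eqI) (auto simp: lookup_add lookup_minus lookup_single in_keys_iff when_def)
qed

lemma expo_deg_pos_split:
  assumes "expo_deg a \<ge> 1"
  obtains i a' where "a = ex i + a'" "i \<in> Poly_Mapping.keys a"
proof -
  from assms obtain i where "i \<in> Poly_Mapping.keys a"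
    by (metis all_not_in_conv expo_deg_def not_one_le_zero sum.empty)
  with expo_split_key that show ?thesis by metis
qed

lemma expo_deg_pos_ex: "expo_deg a \<ge> 1 \<Longrightarrow> \<exists>i a'. a = ex i + a'"
  by (metis expo_deg_pos_split)

lemma expo_deg_eq_0_iff: "expo_deg a = 0 \<longleftrightarrow> a = 0"
proof
  assume "expo_deg a = 0"
  then show "a = 0"
    by (intro poly_mapping_eqI) (auto simp: expo_deg_def in_keys_iff)
qed simp

lemma expo_deg_eq_1E:
  assumes "expo_deg a = 1"
  obtains i where "a = ex i"
proof -
  from assms obtain i a' where a: "a = ex i + a'"
    by (metis expo_deg_pos_split order_refl)
  with assms have "a' = 0" by (simp add: expo_deg_eq_0_iff)
  with a that show ?thesis by simp
qed

lemma expo_induct [case_names zero add]: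
  assumes "P 0" and "\<And>i a. P a \<Longrightarrow> P (ex i + a)"
  shows "P (a :: expo)"
proof (induction "expo_deg a" arbitrary: a)
  case 0
  then show ?case using assms(1) by (simp add: expo_deg_eq_0_iff)
next
  case (Suc n)
  then obtain i a' where "a = ex i + a'"
    by (metis expo_deg_pos_split le_add1 plus_1_eq_Suc)
  with Suc assms(2) show ?case by simp
qed

section \<open>Linear extension and substitution\<close>

lemma poly_mapping_single_induct [case_names zero single add]:
  fixes p :: "'m \<Rightarrow>\<^sub>0 'k::comm_monoid_add"
  assumes "P 0" "\<And>m c. P (Poly_Mapping.single m c)" "\<And>p q. P p \<Longrightarrow> P q \<Longrightarrow> P (p + q)"
  shows "P p"
proof (induction p rule: update_induct)
  case const
  show ?case by fact
next
  case (update f a b)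
  have "Poly_Mapping.update a b f = f + Poly_Mapping.single a b"
    using update(1) by (intro poly_mapping_eqI)
      (auto simp: lookup_update lookup_add lookup_single when_def in_keys_iff)
  with update assms show ?case by metis
qed

lemma poly_mapping_sum_single:
  "(\<Sum>m\<in>Poly_Mapping.keys p. Poly_Mapping.single m (Poly_Mapping.lookup p m)) = p"
  by (intro poly_mapping_eqI)
    (auto simp: lookup_sum lookup_single when_def sum.delta' in_keys_iff)

text \<open>One notion covers the embedding \<open>const\<close>, substitutions, evaluation and the
  constant-term map, so that equations between them reduce to generators by
  \<open>hom_eqI\<close>.\<close>

locale unital_hom =
  fixes h :: "'a::comm_semiring_1 \<Rightarrow> 'b::comm_semiring_1"
  assumes zero: "h 0 = 0" and one: "h 1 = 1"
    and add: "h (x + y) = h x + h y" and mult: "h (x * y) = h x * h y"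
begin

lemma sum: "h (sum f A) = (\<Sum>i\<in>A. h (f i))"
  by (induction A rule: infinite_finite_induct) (auto simp: zero add)

lemma power: "h (x ^ n) = h x ^ n"
  by (induction n) (auto simp: one mult)

end

lemma unital_hom_diff:
  fixes h :: "'a::comm_ring_1 \<Rightarrow> 'b::comm_ring_1"
  assumes "unital_hom h"
  shows "h (x - y) = h x - h y"
proof -
  have "h (x - y) + h y = h x"
    using unital_hom.add[OF assms, of "x - y" y] by simp
  then show ?thesis by (simp add: eq_diff_eq)
qed

lemma unital_hom_comp: "unital_hom g \<Longrightarrow> unital_hom h \<Longrightarrow> unital_hom (\<lambda>x. g (h x))"
  by (simp add: unital_hom_def)

lemma const_hom: "unital_hom (const :: 'k::field \<Rightarrow> _)"
  by unfold_locales (simp_all add: const_def single_add mult_single)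

lemma const_0 [simp]: "const 0 = 0" and const_1 [simp]: "const 1 = 1"
  by (simp_all add: const_def)

lemmas const_add = unital_hom.add[OF const_hom]
lemmas const_mult = unital_hom.mult[OF const_hom]
lemmas const_diff = unital_hom_diff[OF const_hom]
lemma const_uminus: "const (- c) = - const c"
  using const_diff[of 0 c] by simp

lemmas const_power = unital_hom.power[OF const_hom]

lemma const_numeral [simp]: "const (numeral n) = numeral n"
  by (simp add: const_def)

lemma const_of_nat [simp]: "const (of_nat n) = of_nat n"
  by (simp add: const_def)

lemma const_inverse_cancel: "c \<noteq> 0 \<Longrightarrow> const (inverse c) * (const c * p) = p"
  by (simp flip: mult.assoc const_mult)

text \<open>Multiplicative \<open>\<chi>\<close> give substitutions, but others occur as well:
  variables for the forms \<open>yform\<close> and \<open>zform\<close>, and chosen representatives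
  of monomials in \<open>kernel_generated\<close>.\<close>

definition lin_ext :: "('k::zero \<Rightarrow> 's::comm_ring_1) \<Rightarrow> ('m \<Rightarrow> 's) \<Rightarrow> ('m \<Rightarrow>\<^sub>0 'k) \<Rightarrow> 's" where
  "lin_ext \<kappa> \<chi> p = (\<Sum>m\<in>Poly_Mapping.keys p. \<kappa> (Poly_Mapping.lookup p m) * \<chi> m)"

lemma lin_ext_zero [simp]: "lin_ext \<kappa> \<chi> 0 = 0"
  by (simp add: lin_ext_def)

lemma lin_ext_single: "\<kappa> 0 = 0 \<Longrightarrow> lin_ext \<kappa> \<chi> (Poly_Mapping.single m c) = \<kappa> c * \<chi> m"
  by (simp add: lin_ext_def)

lemma lin_ext_add:
  assumes "unital_hom \<kappa>"
  shows "lin_ext \<kappa> \<chi> (p + q) = lin_ext \<kappa> \<chi> p + lin_ext \<kappa> \<chi> q"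
  unfolding lin_ext_def
  by (rule setsum_keys_plus_distrib) (simp_all add: assms unital_hom.zero unital_hom.add distrib_right)

lemma lin_ext_hom:
  fixes \<chi> :: "'m::comm_monoid_add \<Rightarrow> 's::comm_ring_1" and \<kappa> :: "'k::field \<Rightarrow> 's"
  assumes \<kappa>: "unital_hom \<kappa>" and \<chi>: "\<chi> 0 = 1" "\<And>m n. \<chi> (m + n) = \<chi> m * \<chi> n"
  shows "unital_hom (lin_ext \<kappa> \<chi>)"
proof
  have single: "lin_ext \<kappa> \<chi> (Poly_Mapping.single m c) = \<kappa> c * \<chi> m" for m c
    by (simp add: lin_ext_single \<kappa> unital_hom.zero)
  show "lin_ext \<kappa> \<chi> 1 = 1"
    using single[of 0 1] \<chi> by (simp add: unital_hom.one[OF \<kappa>])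
  show "lin_ext \<kappa> \<chi> (p * q) = lin_ext \<kappa> \<chi> p * lin_ext \<kappa> \<chi> q" for p q
  proof (induction p rule: poly_mapping_single_induct)
    case (single m c)
    show ?case
    proof (induction q rule: poly_mapping_single_induct)
      case (single n c')
      show ?case
        by (simp add: mult_single \<open>\<And>m c. lin_ext \<kappa> \<chi> (Poly_Mapping.single m c) = \<kappa> c * \<chi> m\<close>
            \<chi> unital_hom.mult[OF \<kappa>] mult_ac)
    qed (simp_all add: distrib_left lin_ext_add[OF \<kappa>])
  qed (simp_all add: distrib_right lin_ext_add[OF \<kappa>])
qed (simp_all add: lin_ext_add[OF \<kappa>])

definition mexp :: "(nat \<Rightarrow> 's::comm_ring_1) \<Rightarrow> expo \<Rightarrow> 's" where
  "mexp f a = (\<Prod>i\<in>Poly_Mapping.keys a. f i ^ Poly_Mapping.lookup a i)"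

lemma mexp_superset:
  assumes "finite A" "Poly_Mapping.keys a \<subseteq> A"
  shows "mexp f a = (\<Prod>i\<in>A. f i ^ Poly_Mapping.lookup a i)"
  unfolding mexp_def using assms
  by (intro prod.mono_neutral_left) (auto simp: in_keys_iff)

lemma mexp_zero [simp]: "mexp f 0 = 1"
  by (simp add: mexp_def)

lemma mexp_single [simp]: "mexp f (Poly_Mapping.single i n) = f i ^ n"
  by (cases "n = 0") (simp_all add: mexp_def)

lemma mexp_add: "mexp f (a + b) = mexp f a * mexp f b"
proof -
  let ?A = "Poly_Mapping.keys a \<union> Poly_Mapping.keys b"
  have "mexp f (a + b) = (\<Prod>i\<in>?A. f i ^ Poly_Mapping.lookup (a + b) i)"
    by (intro mexp_superset) (auto simp: keys_add)
  also have "\<dots> = (\<Prod>i\<in>?A. f i ^ Poly_Mapping.lookup a i) * (\<Prod>i\<in>?A. f i ^ Poly_Mapping.lookup b i)"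
    by (simp add: lookup_add power_add prod.distrib)
  also have "\<dots> = mexp f a * mexp f b"
    by (simp add: mexp_superset[of ?A a] mexp_superset[of ?A b])
  finally show ?thesis .
qed

text \<open>The target ring stays open because two are used: the polynomials themselves, and
  univariate polynomials over them in the parameter of a transvection.\<close>

definition subst ::
    "('k::field \<Rightarrow> 's::comm_ring_1) \<Rightarrow> (nat \<Rightarrow> 's) \<Rightarrow> (nat \<Rightarrow> 's) \<Rightarrow> 'k yzpoly \<Rightarrow> 's" where
  "subst \<kappa> f g = lin_ext \<kappa> (\<lambda>(a, b). mexp f a * mexp g b)"

definition mon :: "expo \<Rightarrow> expo \<Rightarrow> 'k::field yzpoly" where
  "mon a b = Poly_Mapping.single (a, b) 1"

lemma single_eq_const_mon: "Poly_Mapping.single (a, b) c = const c * mon a b"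
  by (simp add: const_def mon_def mult_single)

lemma mon_mult: "mon a b * mon a' b' = mon (a + a') (b + b')"
  by (simp add: mon_def mult_single)

lemma yv_eq_mon: "yv i = mon (ex i) 0" and zv_eq_mon: "zv i = mon 0 (ex i)"
  by (simp_all add: yv_def zv_def mon_def)

lemma mon_0_0 [simp]: "mon 0 0 = 1"
  by (simp add: mon_def flip: zero_prod_def)

lemma mon_eq_mexp: "(mon a b :: 'k::field yzpoly) = mexp yv a * mexp zv b"
proof -
  have "mexp yv a = (mon a 0 :: 'k yzpoly)" for a
    by (induction a rule: expo_induct) (simp_all add: mexp_add yv_eq_mon mon_mult)
  moreover have "mexp zv b = (mon 0 b :: 'k yzpoly)" for b
    by (induction b rule: expo_induct) (simp_all add: mexp_add zv_eq_mon mon_mult)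
  moreover have "mon a b = (mon a 0 * mon 0 b :: 'k yzpoly)"
    by (simp add: mon_mult)
  ultimately show ?thesis by simp
qed

lemma keys_mon [simp]: "Poly_Mapping.keys (mon a b :: 'k::field yzpoly) = {(a, b)}"
  by (simp add: mon_def)

lemma sum_const_mon:
  "(\<Sum>m\<in>Poly_Mapping.keys p. const (Poly_Mapping.lookup p m) * mon (fst m) (snd m)) = p"
  using poly_mapping_sum_single[of p] by (simp flip: single_eq_const_mon)

lemma yzpoly_induct [case_names const yv zv add mult]:
  fixes p :: "'k::field yzpoly"
  assumes "\<And>c. P (const c)" "\<And>i. P (yv i)" "\<And>i. P (zv i)"
    "\<And>p q. P p \<Longrightarrow> P q \<Longrightarrow> P (p + q)" "\<And>p q. P p \<Longrightarrow> P q \<Longrightarrow> P (p * q)"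
  shows "P p"
proof (induction p rule: poly_mapping_single_induct)
  case zero
  then show ?case using assms(1)[of 0] by simp
next
  case (single m c)
  obtain a b where m: "m = (a, b)" by fastforce
  have mexp: "(\<And>i. P (f i)) \<Longrightarrow> P (mexp f a)" for f a
    using assms(1)[of 1] by (induction a rule: expo_induct) (auto simp: mexp_add intro: assms(5))
  show ?case
    unfolding m single_eq_const_mon mon_eq_mexp by (intro assms mexp)
next
  case (add p q)
  then show ?case by (rule assms(4))
qed

context
  fixes \<kappa> :: "'k::field \<Rightarrow> 's::comm_ring_1"
  assumes \<kappa>: "unital_hom \<kappa>"
begin

lemma subst_hom: "unital_hom (subst \<kappa> f g)"
  unfolding subst_def
  by (rule lin_ext_hom[OF \<kappa>]) (auto simp: mexp_add mult_ac zero_prod_def split: prod.splits)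

lemma subst_mon: "subst \<kappa> f g (mon a b) = mexp f a * mexp g b"
  by (simp add: subst_def mon_def lin_ext_single unital_hom.zero[OF \<kappa>] unital_hom.one[OF \<kappa>])

lemma subst_const: "subst \<kappa> f g (const c) = \<kappa> c"
  by (simp add: subst_def const_def lin_ext_single unital_hom.zero[OF \<kappa>] zero_prod_def)

lemma subst_yv: "subst \<kappa> f g (yv i) = f i"
  by (simp add: yv_eq_mon subst_mon)

lemma subst_zv: "subst \<kappa> f g (zv i) = g i"
  by (simp add: zv_eq_mon subst_mon)

lemmas subst_simps = subst_const subst_yv subst_zv unital_hom.add[OF subst_hom]
  unital_hom.mult[OF subst_hom] unital_hom.zero[OF subst_hom] unital_hom.one[OF subst_hom]
  unital_hom.sum[OF subst_hom] unital_hom.power[OF subst_hom] unital_hom_diff[OF subst_hom]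

end

lemma hom_eqI:
  fixes p :: "'k::field yzpoly"
  assumes "unital_hom h" "unital_hom h'" "\<And>c. h (const c) = h' (const c)"
    "\<And>i. h (yv i) = h' (yv i)" "\<And>i. h (zv i) = h' (zv i)"
  shows "h p = h' p"
  by (induction p rule: yzpoly_induct) (simp_all add: assms unital_hom.add unital_hom.mult)

section \<open>Supports of products\<close>

lemma keys_add_subsetI:
  "Poly_Mapping.keys p \<subseteq> A \<Longrightarrow> Poly_Mapping.keys q \<subseteq> A \<Longrightarrow> Poly_Mapping.keys (p + q) \<subseteq> A"
  using keys_add[of p q] by blast

lemma keys_mult_subsetI:
  assumes "Poly_Mapping.keys p \<subseteq> A" "Poly_Mapping.keys q \<subseteq> B"
    "\<And>m n. m \<in> A \<Longrightarrow> n \<in> B \<Longrightarrow> m + n \<in> C"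
  shows "Poly_Mapping.keys (p * q) \<subseteq> C"
  using keys_mult[of p q] assms by blast

lemma keys_const_mult: "Poly_Mapping.keys (const c * p) \<subseteq> Poly_Mapping.keys p"
  by (rule keys_mult_subsetI[of _ "{0}" _ "Poly_Mapping.keys p"]) (auto simp: const_def)

lemma keys_sum_subsetI:
  assumes "\<And>i. i \<in> I \<Longrightarrow> Poly_Mapping.keys (f i) \<subseteq> A"
  shows "Poly_Mapping.keys (\<Sum>i\<in>I. f i) \<subseteq> A"
  using assms by (induction I rule: infinite_finite_induct) (simp_all add: keys_add_subsetI)

text \<open>\<open>F j k\<close> bounds the support of a product of j substituted y-variables and k
  substituted z-variables. It serves once with lower bounds on the two degrees
  (\<open>Mons d\<close>) and once with exact degrees. The conditions on \<open>f\<close> and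
  \<open>g\<close> are limited to variables occurring in \<open>p\<close>, since indices outside
  {1..d} are not controlled.\<close>

lemma keys_subst_subsetI:
  fixes p :: "'k::field yzpoly" and F :: "nat \<Rightarrow> nat \<Rightarrow> (expo \<times> expo) set"
  assumes F0: "0 \<in> F 0 0"
    and Fadd: "\<And>i j i' j' m n. m \<in> F i j \<Longrightarrow> n \<in> F i' j' \<Longrightarrow> m + n \<in> F (i + i') (j + j')"
    and f: "\<And>a b i. (a, b) \<in> Poly_Mapping.keys p \<Longrightarrow> i \<in> Poly_Mapping.keys a \<Longrightarrow> Poly_Mapping.keys (f i) \<subseteq> F 1 0"
    and g: "\<And>a b i. (a, b) \<in> Poly_Mapping.keys p \<Longrightarrow> i \<in> Poly_Mapping.keys b \<Longrightarrow> Poly_Mapping.keys (g i) \<subseteq> F 0 1"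
    and A: "\<And>a b. (a, b) \<in> Poly_Mapping.keys p \<Longrightarrow> F (expo_deg a) (expo_deg b) \<subseteq> A"
  shows "Poly_Mapping.keys (subst const f g p) \<subseteq> A"
proof -
  have mf: "(\<And>i. i \<in> Poly_Mapping.keys a \<Longrightarrow> Poly_Mapping.keys (f i) \<subseteq> F 1 0) \<Longrightarrow>
      Poly_Mapping.keys (mexp f a) \<subseteq> F (expo_deg a) 0" for a
  proof (induction a rule: expo_induct)
    case (add i a)
    have "Poly_Mapping.keys (f i * mexp f a) \<subseteq> F (1 + expo_deg a) (0 + 0)"
      using add by (intro keys_mult_subsetI[of _ "F 1 0" _ "F (expo_deg a) 0"] Fadd) (auto simp: keys_expo_add)
    then show ?case by (simp add: mexp_add)
  qed (use F0 in simp)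
  have mg: "(\<And>i. i \<in> Poly_Mapping.keys a \<Longrightarrow> Poly_Mapping.keys (g i) \<subseteq> F 0 1) \<Longrightarrow>
      Poly_Mapping.keys (mexp g a) \<subseteq> F 0 (expo_deg a)" for a
  proof (induction a rule: expo_induct)
    case (add i a)
    have "Poly_Mapping.keys (g i * mexp g a) \<subseteq> F (0 + 0) (1 + expo_deg a)"
      using add by (intro keys_mult_subsetI[of _ "F 0 1" _ "F 0 (expo_deg a)"] Fadd) (auto simp: keys_expo_add)
    then show ?case by (simp add: mexp_add)
  qed (use F0 in simp)
  have "Poly_Mapping.keys (const (Poly_Mapping.lookup p m) * (case m of (a, b) \<Rightarrow> mexp f a * mexp g b)) \<subseteq> A"
    if "m \<in> Poly_Mapping.keys p" for m
  proof -
    obtain a b where m: "m = (a, b)" by fastforce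
    have "Poly_Mapping.keys (mexp f a * mexp g b) \<subseteq> F (expo_deg a + 0) (0 + expo_deg b)"
      using that unfolding m
      by (intro keys_mult_subsetI[of _ "F (expo_deg a) 0" _ "F 0 (expo_deg b)"] mf mg f g Fadd) auto
    also have "\<dots> \<subseteq> A"
      using A[of a b] that by (simp add: m)
    finally show ?thesis
      unfolding m using keys_const_mult by force
  qed
  then show ?thesis
    unfolding subst_def lin_ext_def by (intro keys_sum_subsetI)
qed

section \<open>The algebra \<open>G\<^sub>d\<close> and its endomorphisms\<close>

lemma lin_ext_scale:
  fixes \<kappa> :: "'k::field \<Rightarrow> 's::comm_ring_1" and \<chi> :: "'m::comm_monoid_add \<Rightarrow> 's"
  assumes "unital_hom \<kappa>"
  shows "lin_ext \<kappa> \<chi> (Poly_Mapping.single 0 c * p) = \<kappa> c * lin_ext \<kappa> \<chi> p"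
proof (induction p rule: poly_mapping_single_induct)
  case (single m c')
  then show ?case
    by (simp add: mult_single lin_ext_single assms unital_hom.zero unital_hom.mult mult_ac)
qed (simp_all add: distrib_left lin_ext_add[OF assms])

lemma lookup_single_0_mult:
  "Poly_Mapping.lookup (Poly_Mapping.single 0 c * p) m = c * Poly_Mapping.lookup p m"
  by (simp add: Poly_Mapping.map.rep_eq when_def flip: mult_map_scale_conv_mult)

lemma gscale_eq: "gscale c u = (Poly_Mapping.single 0 c * fst u, const c * snd u)"
  by (simp add: gscale_def mult_map_scale_conv_mult const_def)

lemma gscale_0 [simp]: "gscale 0 u = 0" and gscale_1 [simp]: "gscale 1 u = u"
  by (simp_all add: gscale_eq zero_prod_def)

lemma gscale_zero [simp]: "gscale c 0 = 0"
  by (simp add: gscale_eq zero_prod_def)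

lemma gscale_add: "gscale c (u + v) = gscale c u + gscale c v"
  by (simp add: gscale_eq distrib_left)

lemma gscale_add_left: "gscale (c + c') u = gscale c u + gscale c' u"
  by (simp add: gscale_eq single_add const_add distrib_right)

lemma gscale_gscale: "gscale c (gscale c' u) = gscale (c * c') u"
  by (simp add: gscale_eq const_mult mult.assoc[symmetric] mult_single)

lemma gscale_minus_1: "gscale (- 1) u = - u"
  by (simp add: gscale_eq const_def single_uminus uminus_prod_def)

lemma gscale_gpoly [simp]: "gscale c (gpoly p) = gpoly (const c * p)"
  by (simp add: gscale_eq gpoly_def)

lemma gscale_sum: "gscale c (sum f A) = (\<Sum>i\<in>A. gscale c (f i))"
  by (induction A rule: infinite_finite_induct) (simp_all add: gscale_add)

lemma gpoly_0 [simp]: "gpoly 0 = 0" by (simp add: gpoly_def zero_prod_def)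
lemma gpoly_add: "gpoly (p + q) = gpoly p + gpoly q" by (simp add: gpoly_def)
lemma gpoly_diff: "gpoly (p - q) = gpoly p - gpoly q" by (simp add: gpoly_def)
lemma gpoly_sum: "gpoly (sum f A) = (\<Sum>i\<in>A. gpoly (f i))"
  by (induction A rule: infinite_finite_induct) (auto simp: gpoly_add)

text \<open>As a left factor u counts as \<open>Yof u\<close>, as a right factor as
  \<open>Zof u\<close>: only the linear part distinguishes the sides. The multiplication of G_d thus
  becomes one product of polynomials, without cases.\<close>

definition Yof :: "'k gelem \<Rightarrow> 'k::field yzpoly" where
  "Yof u = yform (fst u) + snd u"

definition Zof :: "'k gelem \<Rightarrow> 'k::field yzpoly" where
  "Zof u = zform (fst u) + snd u"

lemma yform_lin_ext: "yform = lin_ext const yv" and zform_lin_ext: "zform = lin_ext const zv"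
  by (auto simp: yform_def zform_def lin_ext_def)

lemma Yof_add: "Yof (u + v) = Yof u + Yof v" and Zof_add: "Zof (u + v) = Zof u + Zof v"
  by (simp_all add: Yof_def Zof_def yform_lin_ext zform_lin_ext lin_ext_add[OF const_hom])

lemma Yof_0 [simp]: "Yof 0 = 0" and Zof_0 [simp]: "Zof 0 = 0"
  by (simp_all add: Yof_def Zof_def yform_lin_ext zform_lin_ext)

lemma Yof_gscale: "Yof (gscale c u) = const c * Yof u" and Zof_gscale: "Zof (gscale c u) = const c * Zof u"
  by (simp_all add: Yof_def Zof_def yform_lin_ext zform_lin_ext gscale_eq distrib_left lin_ext_scale[OF const_hom])

lemma Yof_sum: "Yof (sum f A) = (\<Sum>i\<in>A. Yof (f i))" and Zof_sum: "Zof (sum f A) = (\<Sum>i\<in>A. Zof (f i))"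
  by (induction A rule: infinite_finite_induct) (simp_all add: Yof_add Zof_add)

lemma Yof_gpoly [simp]: "Yof (gpoly p) = p" and Zof_gpoly [simp]: "Zof (gpoly p) = p"
  by (simp_all add: Yof_def Zof_def yform_lin_ext zform_lin_ext gpoly_def)

lemma Yof_gx [simp]: "Yof (gx i) = yv i" and Zof_gx [simp]: "Zof (gx i) = zv i"
  by (simp_all add: Yof_def Zof_def yform_lin_ext zform_lin_ext gx_def lin_ext_single)

lemma gmult_eq: "gmult u v = gpoly (Yof u * Zof v)"
  by (simp add: gmult_def Yof_def Zof_def gpoly_def)

text \<open>Lower bounds on the degrees, rather than exact degrees, are respected by all
  endomorphisms, which may send a generator to a sum with terms of higher degree.\<close>

definition Mons :: "nat \<Rightarrow> nat \<Rightarrow> nat \<Rightarrow> (expo \<times> expo) set" where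
  "Mons d j k = {(a, b). Poly_Mapping.keys a \<subseteq> {1..d} \<and> Poly_Mapping.keys b \<subseteq> {1..d} \<and>
     j \<le> expo_deg a \<and> k \<le> expo_deg b}"

lemma Mons_add: "m \<in> Mons d i j \<Longrightarrow> n \<in> Mons d i' j' \<Longrightarrow> m + n \<in> Mons d (i + i') (j + j')"
  by (cases m; cases n) (auto simp: Mons_def keys_expo_add)

lemma Mons_mono: "i' \<le> i \<Longrightarrow> j' \<le> j \<Longrightarrow> Mons d i j \<subseteq> Mons d i' j'"
  by (auto simp: Mons_def)

lemma zero_in_Mons [simp]: "0 \<in> Mons d 0 0"
  by (simp add: Mons_def zero_prod_def)

lemma G_simps [simp]:
  "nzero (G d) = 0" "nadd (G d) = (+)" "nscale (G d) = gscale" "nmult (G d) = gmult"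
  by (simp_all add: G_def)

lemma carr_G: "(l, p) \<in> carr (G d) \<longleftrightarrow> Poly_Mapping.keys l \<subseteq> {1..d} \<and> Poly_Mapping.keys p \<subseteq> Mons d 1 1"
  by (auto simp: G_def Mons_def)

lemma carr_gpoly: "gpoly p \<in> carr (G d) \<longleftrightarrow> Poly_Mapping.keys p \<subseteq> Mons d 1 1"
  by (simp add: gpoly_def carr_G)

lemma keys_yv: "i \<in> {1..d} \<Longrightarrow> Poly_Mapping.keys (yv i) \<subseteq> Mons d 1 0"
  and keys_zv: "i \<in> {1..d} \<Longrightarrow> Poly_Mapping.keys (zv i) \<subseteq> Mons d 0 1"
  by (auto simp: yv_def zv_def Mons_def)

lemma keys_yform: "Poly_Mapping.keys l \<subseteq> {1..d} \<Longrightarrow> Poly_Mapping.keys (yform l) \<subseteq> Mons d 1 0"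
  unfolding yform_def by (intro keys_sum_subsetI order_trans[OF keys_const_mult] keys_yv) auto

lemma keys_zform: "Poly_Mapping.keys l \<subseteq> {1..d} \<Longrightarrow> Poly_Mapping.keys (zform l) \<subseteq> Mons d 0 1"
  unfolding zform_def by (intro keys_sum_subsetI order_trans[OF keys_const_mult] keys_zv) auto

lemma carrD:
  assumes "u \<in> carr (G d)"
  shows "Poly_Mapping.keys (fst u) \<subseteq> {1..d}" "Poly_Mapping.keys (snd u) \<subseteq> Mons d 1 1"
  using assms by (metis carr_G prod.collapse)+

lemma keys_Yof: "u \<in> carr (G d) \<Longrightarrow> Poly_Mapping.keys (Yof u) \<subseteq> Mons d 1 0"
  unfolding Yof_def
  by (intro keys_add_subsetI keys_yform carrD(1) order_trans[OF carrD(2) Mons_mono]) simp_all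

lemma keys_Zof: "u \<in> carr (G d) \<Longrightarrow> Poly_Mapping.keys (Zof u) \<subseteq> Mons d 0 1"
  unfolding Zof_def
  by (intro keys_add_subsetI keys_zform carrD(1) order_trans[OF carrD(2) Mons_mono]) simp_all

lemma carr_zero: "0 \<in> carr (G d)"
  by (simp add: zero_prod_def carr_G)

lemma carr_add: "u \<in> carr (G d) \<Longrightarrow> v \<in> carr (G d) \<Longrightarrow> u + v \<in> carr (G d)"
  by (cases u; cases v) (simp add: carr_G keys_add_subsetI)

lemma carr_gscale:
  assumes "u \<in> carr (G d)"
  shows "gscale c u \<in> carr (G d)"
proof -
  have "Poly_Mapping.keys (Poly_Mapping.single 0 c * fst u) \<subseteq> Poly_Mapping.keys (fst u)"
    by (rule keys_mult_subsetI[of _ "{0}" _ "Poly_Mapping.keys (fst u)"]) auto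
  moreover have "Poly_Mapping.keys (const c * snd u) \<subseteq> Poly_Mapping.keys (snd u)"
    by (rule keys_const_mult)
  ultimately show ?thesis
    using assms by (cases u) (auto simp: gscale_eq carr_G)
qed

lemma carr_gmult: "u \<in> carr (G d) \<Longrightarrow> v \<in> carr (G d) \<Longrightarrow> gmult u v \<in> carr (G d)"
  unfolding gmult_eq carr_gpoly
  using Mons_add[of _ d 1 0 _ 0 1] by (intro keys_mult_subsetI[OF keys_Yof keys_Zof]) auto

lemma carr_gx: "i \<in> {1..d} \<Longrightarrow> gx i \<in> carr (G d)"
  by (simp add: gx_def carr_G)

lemma carr_sum: "(\<And>i. i \<in> A \<Longrightarrow> f i \<in> carr (G d)) \<Longrightarrow> sum f A \<in> carr (G d)"
  by (induction A rule: infinite_finite_induct) (auto simp: carr_zero carr_add)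

lemma carr_uminus: "u \<in> carr (G d) \<Longrightarrow> - u \<in> carr (G d)"
  using carr_gscale[of u d "- 1"] by (simp add: gscale_minus_1)

lemma carr_diff: "u \<in> carr (G d) \<Longrightarrow> v \<in> carr (G d) \<Longrightarrow> u - v \<in> carr (G d)"
  using carr_add[of u d "- v"] carr_uminus[of v d] by simp

lemma gelem_decomp:
  assumes "u \<in> carr (G d)"
  shows "u = (\<Sum>i=1..d. gscale (Poly_Mapping.lookup (fst u) i) (gx i)) + gpoly (snd u)"
proof -
  have "(\<Sum>i=1..d. gscale (Poly_Mapping.lookup (fst u) i) (gx i)) =
      (\<Sum>i\<in>Poly_Mapping.keys (fst u). gscale (Poly_Mapping.lookup (fst u) i) (gx i))"
    using assms by (cases u) (intro sum.mono_neutral_right, auto simp: carr_G in_keys_iff)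
  also have "\<dots> = (\<Sum>i\<in>Poly_Mapping.keys (fst u). (Poly_Mapping.single i (Poly_Mapping.lookup (fst u) i), 0))"
    by (simp add: gscale_eq gx_def mult_single)
  also have "\<dots> = (fst u, 0)"
    by (subst poly_mapping_sum_single[of "fst u", symmetric]) (simp add: prod_eq_iff fst_sum snd_sum)
  finally show ?thesis
    by (simp add: gpoly_def)
qed

text \<open>The x_i generate G_d: a monomial of degree above 2 has y-degree or z-degree at least 2,
  so it is x_i times a shorter monomial or a shorter one times x_j; in degree 2 it is x_i
  x_j.\<close>

lemma carr_induct [consumes 1, case_names gx zero add scale mult]:
  fixes u :: "'k::field gelem"
  assumes "u \<in> carr (G d)" and gx: "\<And>i. i \<in> {1..d} \<Longrightarrow> P (gx i)"
    and zero: "P 0"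
    and add: "\<And>u v. u \<in> carr (G d) \<Longrightarrow> v \<in> carr (G d) \<Longrightarrow> P u \<Longrightarrow> P v \<Longrightarrow> P (u + v)"
    and scale: "\<And>c u. u \<in> carr (G d) \<Longrightarrow> P u \<Longrightarrow> P (gscale c u)"
    and mult: "\<And>u v. u \<in> carr (G d) \<Longrightarrow> v \<in> carr (G d) \<Longrightarrow> P u \<Longrightarrow> P v \<Longrightarrow> P (gmult u v)"
  shows "P u"
proof -
  have mon: "(a, b) \<in> Mons d 1 1 \<Longrightarrow> P (gpoly (mon a b))" for a b
  proof (induction "expo_deg a + expo_deg b" arbitrary: a b rule: less_induct)
    case less
    obtain i a' where a: "a = ex i + a'" and i: "i \<in> Poly_Mapping.keys a"
      using less(2) expo_deg_pos_split[of a] by (auto simp: Mons_def)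
    obtain j b' where b: "b = ex j + b'" and j: "j \<in> Poly_Mapping.keys b"
      using less(2) expo_deg_pos_split[of b] by (auto simp: Mons_def)
    have ij: "i \<in> {1..d}" "j \<in> {1..d}"
      using less(2) i j by (auto simp: Mons_def)
    consider "expo_deg a' = 0" "expo_deg b' = 0" | "expo_deg a' \<ge> 1" | "expo_deg b' \<ge> 1"
      by linarith
    then show ?case
    proof cases
      case 1
      then have "(gpoly (mon a b) :: 'k gelem) = gmult (gx i) (gx j)"
        by (simp add: gmult_eq a b expo_deg_eq_0_iff yv_eq_mon zv_eq_mon mon_mult)
      then show ?thesis using ij by (simp add: mult gx carr_gx)
    next
      case 2
      then have m: "(a', b) \<in> Mons d 1 1"
        using less(2) by (auto simp: Mons_def a keys_expo_add)
      have "(gpoly (mon a b) :: 'k gelem) = gmult (gx i) (gpoly (mon a' b))"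
        by (simp add: gmult_eq a yv_eq_mon mon_mult)
      moreover have "P (gpoly (mon a' b))"
        by (rule less(1)[OF _ m]) (simp add: a)
      ultimately show ?thesis using ij m by (simp add: mult gx carr_gx carr_gpoly)
    next
      case 3
      then have m: "(a, b') \<in> Mons d 1 1"
        using less(2) by (auto simp: Mons_def b keys_expo_add)
      have "(gpoly (mon a b) :: 'k gelem) = gmult (gpoly (mon a b')) (gx j)"
        by (simp add: gmult_eq b zv_eq_mon mon_mult add.commute)
      moreover have "P (gpoly (mon a b'))"
        by (rule less(1)[OF _ m]) (simp add: b)
      ultimately show ?thesis using ij m by (simp add: mult gx carr_gx carr_gpoly)
    qed
  qed
  have sum: "P (sum f A) \<and> sum f A \<in> carr (G d)"
    if "\<And>i. i \<in> A \<Longrightarrow> P (f i) \<and> f i \<in> carr (G d)" for f :: "'b \<Rightarrow> _" and A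
    using that by (induction A rule: infinite_finite_induct) (auto simp: zero add carr_zero carr_add)
  have keys: "Poly_Mapping.keys (snd u) \<subseteq> Mons d 1 1"
    using assms(1) by (cases u) (simp add: carr_G)
  have "P (\<Sum>m\<in>Poly_Mapping.keys (snd u). gscale (Poly_Mapping.lookup (snd u) m) (gpoly (mon (fst m) (snd m))))"
    using keys by (intro sum[THEN conjunct1] conjI scale carr_gscale mon) (auto simp: carr_gpoly)
  then have "P (gpoly (snd u))"
    by (simp add: sum_const_mon flip: gpoly_sum)
  moreover have "P (\<Sum>i=1..d. gscale (Poly_Mapping.lookup (fst u) i) (gx i))"
    by (intro sum[THEN conjunct1] conjI scale carr_gscale gx carr_gx) auto
  ultimately show ?thesis
    by (subst gelem_decomp[OF assms(1)], intro add)
      (use keys in \<open>auto simp: carr_gpoly intro!: carr_sum carr_gscale carr_gx\<close>)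
qed

text \<open>This makes the freeness of G_d explicit. As y_i and z_i stand for x_i as a left and as a
  right factor, an endomorphism with x_i -> \<open>u i\<close> has to send them to
  \<open>Yof (u i)\<close> and \<open>Zof (u i)\<close>.\<close>

definition ext_endo :: "nat \<Rightarrow> (nat \<Rightarrow> 'k gelem) \<Rightarrow> 'k::field gelem \<Rightarrow> 'k gelem" where
  "ext_endo d u w = (\<Sum>i=1..d. gscale (Poly_Mapping.lookup (fst w) i) (u i)) +
     gpoly (subst const (\<lambda>i. Yof (u i)) (\<lambda>i. Zof (u i)) (snd w))"

lemma ext_endo_gpoly:
  "ext_endo d u (gpoly p) = gpoly (subst const (\<lambda>i. Yof (u i)) (\<lambda>i. Zof (u i)) p)"
  by (simp add: ext_endo_def gpoly_def)

lemma ext_endo_gx: "i \<in> {1..d} \<Longrightarrow> ext_endo d u (gx i) = u i"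
  by (simp add: ext_endo_def gx_def lookup_single when_def if_distrib[of "\<lambda>c. gscale c _"]
      subst_simps[OF const_hom] cong: if_cong)

lemma is_endo_G: "is_endo (G d) \<phi> \<longleftrightarrow> \<phi> ` carr (G d) \<subseteq> carr (G d) \<and>
     (\<forall>u\<in>carr (G d). \<forall>v\<in>carr (G d). \<phi> (u + v) = \<phi> u + \<phi> v) \<and>
     (\<forall>c. \<forall>v\<in>carr (G d). \<phi> (gscale c v) = gscale c (\<phi> v)) \<and>
     (\<forall>u\<in>carr (G d). \<forall>v\<in>carr (G d). \<phi> (gmult u v) = gmult (\<phi> u) (\<phi> v))"
  by (simp add: is_endo_def)

lemma Mons_subst:
  assumes "\<And>i. i \<in> {1..d} \<Longrightarrow> u i \<in> carr (G d)" "Poly_Mapping.keys p \<subseteq> Mons d j k"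
  shows "Poly_Mapping.keys (subst const (\<lambda>i. Yof (u i)) (\<lambda>i. Zof (u i)) p) \<subseteq> Mons d j k"
proof (rule keys_subst_subsetI[where F = "Mons d"])
  fix a b assume "(a, b) \<in> Poly_Mapping.keys p"
  with assms(2) have "(a, b) \<in> Mons d j k" by auto
  then show "Mons d (expo_deg a) (expo_deg b) \<subseteq> Mons d j k"
    by (auto simp: Mons_def)
next
  fix a b i assume "(a, b) \<in> Poly_Mapping.keys p" "i \<in> Poly_Mapping.keys a"
  with assms(2) have "i \<in> {1..d}" unfolding Mons_def by blast
  then show "Poly_Mapping.keys (Yof (u i)) \<subseteq> Mons d 1 0"
    by (intro keys_Yof assms(1))
next
  fix a b i assume "(a, b) \<in> Poly_Mapping.keys p" "i \<in> Poly_Mapping.keys b"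
  with assms(2) have "i \<in> {1..d}" unfolding Mons_def by blast
  then show "Poly_Mapping.keys (Zof (u i)) \<subseteq> Mons d 0 1"
    by (intro keys_Zof assms(1))
qed (auto intro: Mons_add)

lemma ext_endo_is_endo:
  assumes u: "\<And>i. i \<in> {1..d} \<Longrightarrow> u i \<in> carr (G d)"
  shows "is_endo (G d) (ext_endo d u)"
proof -
  let ?S = "subst const (\<lambda>i. Yof (u i)) (\<lambda>i. Zof (u i))"
  have carr: "ext_endo d u w \<in> carr (G d)" if "w \<in> carr (G d)" for w
  proof -
    have "Poly_Mapping.keys (snd w) \<subseteq> Mons d 1 1"
      using that by (cases w) (simp add: carr_G)
    then show ?thesis
      unfolding ext_endo_def using u
      by (intro carr_add carr_sum carr_gscale carr_gpoly[THEN iffD2] Mons_subst) auto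
  qed
  \<comment> \<open>\<open>Yof\<close> and \<open>Zof\<close> intertwine the extension with one and
    the same substitution; multiplicativity is then that of the substitution.\<close>
  have Y: "Yof (ext_endo d u w) = ?S (Yof w)" and Z: "Zof (ext_endo d u w) = ?S (Zof w)"
    if "w \<in> carr (G d)" for w
  proof -
    have w: "w = (\<Sum>i=1..d. gscale (Poly_Mapping.lookup (fst w) i) (gx i)) + gpoly (snd w)"
      by (rule gelem_decomp[OF that])
    have "Yof w = (\<Sum>i=1..d. const (Poly_Mapping.lookup (fst w) i) * yv i) + snd w"
      by (subst w) (simp add: Yof_add Yof_sum Yof_gscale)
    then show "Yof (ext_endo d u w) = ?S (Yof w)"
      by (simp add: ext_endo_def Yof_add Yof_sum Yof_gscale subst_simps[OF const_hom])
    have "Zof w = (\<Sum>i=1..d. const (Poly_Mapping.lookup (fst w) i) * zv i) + snd w"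
      by (subst w) (simp add: Zof_add Zof_sum Zof_gscale)
    then show "Zof (ext_endo d u w) = ?S (Zof w)"
      by (simp add: ext_endo_def Zof_add Zof_sum Zof_gscale subst_simps[OF const_hom])
  qed
  have "ext_endo d u (v + w) = ext_endo d u v + ext_endo d u w" for v w
    by (simp add: ext_endo_def lookup_add gscale_add_left sum.distrib gpoly_add subst_simps[OF const_hom])
  moreover have "ext_endo d u (gscale c w) = gscale c (ext_endo d u w)" for c w
  proof -
    show ?thesis
      by (simp add: lookup_single_0_mult ext_endo_def gscale_eq[of c w] gscale_add gscale_sum gscale_gscale subst_simps[OF const_hom])
  qed
  moreover have "ext_endo d u (gmult v w) = gmult (ext_endo d u v) (ext_endo d u w)"
    if "v \<in> carr (G d)" "w \<in> carr (G d)" for v w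
    by (simp add: gmult_eq ext_endo_gpoly Y Z that subst_simps[OF const_hom])
  ultimately show ?thesis
    using carr by (auto simp: is_endo_G)
qed

lemma endo_closed: "is_endo (G d) \<phi> \<Longrightarrow> u \<in> carr (G d) \<Longrightarrow> \<phi> u \<in> carr (G d)"
  and endo_add: "is_endo (G d) \<phi> \<Longrightarrow> u \<in> carr (G d) \<Longrightarrow> v \<in> carr (G d) \<Longrightarrow> \<phi> (u + v) = \<phi> u + \<phi> v"
  and endo_gscale: "is_endo (G d) \<phi> \<Longrightarrow> u \<in> carr (G d) \<Longrightarrow> \<phi> (gscale c u) = gscale c (\<phi> u)"
  and endo_gmult: "is_endo (G d) \<phi> \<Longrightarrow> u \<in> carr (G d) \<Longrightarrow> v \<in> carr (G d) \<Longrightarrow> \<phi> (gmult u v) = gmult (\<phi> u) (\<phi> v)"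
  by (auto simp: is_endo_G)

lemma endo_zero: "is_endo (G d) \<phi> \<Longrightarrow> \<phi> 0 = 0"
  using endo_gscale[of d \<phi> 0 0] by (simp add: carr_zero)

lemma endo_diff:
  assumes "is_endo (G d) \<phi>" "u \<in> carr (G d)" "v \<in> carr (G d)"
  shows "\<phi> (u - v) = \<phi> u - \<phi> v"
proof -
  have "\<phi> (u - v + v) = \<phi> (u - v) + \<phi> v"
    by (intro endo_add[OF assms(1)] carr_diff assms)
  then show ?thesis by simp
qed

lemma endo_unique:
  assumes "is_endo (G d) \<phi>" "is_endo (G d) \<psi>" "\<And>i. i \<in> {1..d} \<Longrightarrow> \<phi> (gx i) = \<psi> (gx i)"
    "u \<in> carr (G d)"
  shows "\<phi> u = \<psi> u"
  using assms(4)
  by (induction u rule: carr_induct)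
    (simp_all add: assms endo_zero[OF assms(1)] endo_zero[OF assms(2)] endo_add[OF assms(1)] endo_add[OF assms(2)]
      endo_gscale[OF assms(1)] endo_gscale[OF assms(2)] endo_gmult[OF assms(1)] endo_gmult[OF assms(2)])

lemma endo_gpoly:
  assumes "is_endo (G d) \<phi>" "gpoly p \<in> carr (G d)"
  shows "\<phi> (gpoly p) = gpoly (subst const (\<lambda>i. Yof (\<phi> (gx i))) (\<lambda>i. Zof (\<phi> (gx i))) p)"
proof -
  have "\<phi> (gpoly p) = ext_endo d (\<lambda>i. \<phi> (gx i)) (gpoly p)"
    by (rule endo_unique[OF assms(1) ext_endo_is_endo _ assms(2)])
      (simp_all add: ext_endo_gx carr_gx endo_closed[OF assms(1)])
  then show ?thesis by (simp add: ext_endo_gpoly)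
qed

section \<open>T-ideals and factor algebras\<close>

lemma subspace_G: "is_subspace (G d) S \<longleftrightarrow> S \<subseteq> carr (G d) \<and> 0 \<in> S \<and>
    (\<forall>u\<in>S. \<forall>v\<in>S. u + v \<in> S) \<and> (\<forall>c. \<forall>v\<in>S. gscale c v \<in> S)"
  by (simp add: is_subspace_def)

lemma subspace_diff:
  assumes "is_subspace (G d) S" "u \<in> S" "v \<in> S"
  shows "u - v \<in> S"
proof -
  have "u + gscale (- 1) v \<in> S"
    using assms unfolding subspace_G by blast
  then show ?thesis by (simp add: gscale_minus_1)
qed

lemma T_ideal_G: "is_T_ideal (G d) T \<longleftrightarrow> is_subspace (G d) T \<and>
    (\<forall>u\<in>T. \<forall>v\<in>carr (G d). gmult u v \<in> T \<and> gmult v u \<in> T) \<and> (\<forall>\<phi>. is_endo (G d) \<phi> \<longrightarrow> \<phi> ` T \<subseteq> T)"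
  by (simp add: is_T_ideal_def is_ideal_def)

lemma T_ideal_carr: "is_T_ideal (G d) (carr (G d))"
  by (auto simp: T_ideal_G subspace_G carr_zero carr_add carr_gscale carr_gmult is_endo_def)

lemma T_ideal_gen_least: "is_T_ideal A T \<Longrightarrow> S \<subseteq> T \<Longrightarrow> T_ideal_gen A S \<subseteq> T"
  by (auto simp: T_ideal_gen_def)

lemma T_ideal_gen_superset: "S \<subseteq> T_ideal_gen A S"
  by (auto simp: T_ideal_gen_def)

lemma T_ideal_gen_is_T_ideal:
  assumes "is_T_ideal A T" "S \<subseteq> T"
  shows "is_T_ideal A (T_ideal_gen A S)"
proof -
  have "T_ideal_gen A S \<subseteq> T"
    by (rule T_ideal_gen_least[OF assms])
  then have "T_ideal_gen A S \<subseteq> carr A"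
    using assms by (auto simp: is_T_ideal_def is_ideal_def is_subspace_def)
  then show ?thesis
    unfolding T_ideal_gen_def is_T_ideal_def is_ideal_def is_subspace_def by blast
qed

locale T_ideal_factor =
  fixes d :: nat and I :: "'k::field gelem set"
  assumes T_ideal: "is_T_ideal (G d) I"
begin

abbreviation "A \<equiv> factor_alg (G d) I"
abbreviation "cls \<equiv> coset (G d) I"

lemma I_subspace: "is_subspace (G d) I"
  using T_ideal by (simp add: T_ideal_G)

lemma I_carr: "I \<subseteq> carr (G d)" and I_zero: "0 \<in> I"
  and I_add: "u \<in> I \<Longrightarrow> v \<in> I \<Longrightarrow> u + v \<in> I" and I_scale: "u \<in> I \<Longrightarrow> gscale c u \<in> I"
  using I_subspace by (auto simp: subspace_G)

lemma I_diff: "u \<in> I \<Longrightarrow> v \<in> I \<Longrightarrow> u - v \<in> I"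
  by (rule subspace_diff[OF I_subspace])

lemma I_mult: "u \<in> I \<Longrightarrow> v \<in> carr (G d) \<Longrightarrow> gmult u v \<in> I"
    "u \<in> I \<Longrightarrow> v \<in> carr (G d) \<Longrightarrow> gmult v u \<in> I"
  using T_ideal by (auto simp: T_ideal_G)

lemma I_endo: "is_endo (G d) \<phi> \<Longrightarrow> u \<in> I \<Longrightarrow> \<phi> u \<in> I"
  using T_ideal unfolding T_ideal_G by blast

lemma mem_cls: "v \<in> cls u \<longleftrightarrow> v - u \<in> I"
proof
  show "v - u \<in> I \<Longrightarrow> v \<in> cls u"
    by (auto simp: coset_def image_iff intro!: bexI[of _ "v - u"])
qed (auto simp: coset_def)

lemma cls_eqI: "u - v \<in> I \<Longrightarrow> cls u = cls v"
proof -
  assume uv: "u - v \<in> I"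
  have "w - u \<in> I \<longleftrightarrow> w - v \<in> I" for w
    using I_add[OF _ uv, of "w - u"] I_diff[OF _ uv, of "w - v"] by (auto simp: algebra_simps)
  then show ?thesis by (auto simp: mem_cls)
qed

lemma cls_eqD: "cls u = cls v \<Longrightarrow> u - v \<in> I"
  by (metis I_zero diff_self mem_cls)

lemma self_in_cls: "u \<in> cls u"
  by (simp add: mem_cls I_zero)

text \<open>The operations of \<open>factor_alg\<close> are unions over all representatives; once
  the class does not depend on the representative, the union collapses to it.\<close>

lemma UN_cls:
  assumes "\<And>x. x \<in> cls u \<Longrightarrow> cls (f x) = V"
  shows "(\<Union>x\<in>cls u. cls (f x)) = V"
  using assms self_in_cls by blast

lemma cls_carr: "u \<in> carr (G d) \<Longrightarrow> x \<in> cls u \<Longrightarrow> x \<in> carr (G d)"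
  using I_carr by (auto simp: coset_def intro!: carr_add)

lemma factor_carr: "carr A = cls ` carr (G d)" and factor_zero: "nzero A = cls 0"
  by (simp_all add: factor_alg_def)

lemma factor_add: "nadd A (cls u) (cls v) = cls (u + v)"
proof -
  have "(\<Union>y\<in>cls v. cls (x + y)) = cls (u + v)" if "x \<in> cls u" for x
  proof (rule UN_cls)
    fix y assume "y \<in> cls v"
    then have "(x - u) + (y - v) \<in> I"
      using that by (intro I_add) (simp_all add: mem_cls)
    then show "cls (x + y) = cls (u + v)"
      by (intro cls_eqI) (simp add: algebra_simps)
  qed
  then show ?thesis
    using self_in_cls[of u] by (auto simp: factor_alg_def)
qed

lemma factor_scale: "nscale A c (cls u) = cls (gscale c u)"
proof -
  have "cls (gscale c x) = cls (gscale c u)" if "x \<in> cls u" for x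
  proof (rule cls_eqI)
    have "gscale c x = gscale c (x - u) + gscale c u"
      by (simp flip: gscale_add)
    then show "gscale c x - gscale c u \<in> I"
      using that by (simp add: mem_cls I_scale)
  qed
  then show ?thesis
    unfolding factor_alg_def nalg.simps G_simps by (rule UN_cls)
qed

lemma factor_mult:
  assumes "u \<in> carr (G d)" "v \<in> carr (G d)"
  shows "nmult A (cls u) (cls v) = cls (gmult u v)"
proof -
  have "(\<Union>y\<in>cls v. cls (gmult x y)) = cls (gmult u v)" if x: "x \<in> cls u" for x
  proof (rule UN_cls)
    fix y assume y: "y \<in> cls v"
    have "gmult x y - gmult u v = gmult (x - u) y + gmult u (y - v)"
    proof -
      have "Yof x = Yof (x - u) + Yof u" "Zof y = Zof (y - v) + Zof v"
        by (simp_all flip: Yof_add Zof_add)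
      then show ?thesis
        by (simp add: gmult_eq gpoly_add algebra_simps)
    qed
    also have "\<dots> \<in> I"
      using x y assms cls_carr[OF assms(2) y] by (intro I_add I_mult) (simp_all add: mem_cls)
    finally show "cls (gmult x y) = cls (gmult u v)"
      by (rule cls_eqI)
  qed
  then show ?thesis
    using self_in_cls[of u] by (auto simp: factor_alg_def)
qed

lemma endo_descends:
  fixes \<phi> :: "'k gelem \<Rightarrow> 'k gelem"
  assumes \<phi>: "is_endo (G d) \<phi>"
  obtains \<psi> where "is_endo A \<psi>" "\<And>u. u \<in> carr (G d) \<Longrightarrow> \<psi> (cls u) = cls (\<phi> u)"
proof
  let ?\<psi> = "\<lambda>U. \<Union>x\<in>U. cls (\<phi> x)"
  show eq: "?\<psi> (cls u) = cls (\<phi> u)" if u: "u \<in> carr (G d)" for u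
  proof (rule UN_cls, rule cls_eqI)
    fix x assume x: "x \<in> cls u"
    have "\<phi> (x - u) \<in> I"
      using x by (intro I_endo[OF \<phi>]) (simp add: mem_cls)
    then show "\<phi> x - \<phi> u \<in> I"
      using endo_diff[OF \<phi> cls_carr[OF u x] u] by simp
  qed
  show "is_endo A ?\<psi>"
    unfolding is_endo_def factor_carr
    by (auto simp: eq factor_add factor_scale factor_mult carr_add carr_gscale carr_gmult endo_closed[OF \<phi>]
        endo_add[OF \<phi>] endo_gscale[OF \<phi>] endo_gmult[OF \<phi>] simp del: UN_iff)
qed

text \<open>Freeness again: representatives of the images of the generators define an endomorphism
  of G_d, and agreement spreads from the x_i to all they generate. Lifting is what makes the image
  of a T-ideal closed under the endomorphisms of the factor algebra.\<close>

lemma endo_lifts: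
  assumes \<psi>: "is_endo A \<psi>"
  obtains \<phi> where "is_endo (G d) \<phi>" "\<And>u. u \<in> carr (G d) \<Longrightarrow> \<psi> (cls u) = cls (\<phi> u)"
proof -
  have \<psi>_carr: "\<exists>v\<in>carr (G d). \<psi> (cls u) = cls v" if "u \<in> carr (G d)" for u
  proof -
    have "\<psi> ` carr A \<subseteq> carr A" using \<psi> by (simp add: is_endo_def)
    with that show ?thesis unfolding factor_carr by blast
  qed
  have "\<forall>i\<in>{1..d}. \<exists>u. u \<in> carr (G d) \<and> \<psi> (cls (gx i)) = cls u"
    using \<psi>_carr[OF carr_gx] by blast
  then obtain u where u: "\<And>i. i \<in> {1..d} \<Longrightarrow> u i \<in> carr (G d)"
      "\<And>i. i \<in> {1..d} \<Longrightarrow> \<psi> (cls (gx i)) = cls (u i)"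
    by metis
  let ?\<phi> = "ext_endo d u"
  have \<phi>: "is_endo (G d) ?\<phi>"
    by (rule ext_endo_is_endo[OF u(1)])
  have \<psi>_add: "\<psi> (cls (v + w)) = nadd A (\<psi> (cls v)) (\<psi> (cls w))"
    and \<psi>_scale: "\<psi> (cls (gscale c v)) = nscale A c (\<psi> (cls v))"
    and \<psi>_mult: "\<psi> (cls (gmult v w)) = nmult A (\<psi> (cls v)) (\<psi> (cls w))"
    if "v \<in> carr (G d)" "w \<in> carr (G d)" for v w c
    using \<psi> that by (simp_all add: is_endo_def factor_carr flip: factor_add factor_scale factor_mult)
  have "\<psi> (cls v) = cls (?\<phi> v)" if "v \<in> carr (G d)" for v
    using that
  proof (induction v rule: carr_induct)
    case (gx i)
    then show ?case by (simp add: u ext_endo_gx)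
  next
    case zero
    obtain w where "\<psi> (cls 0) = cls w"
      using \<psi>_carr[OF carr_zero] by blast
    then show ?case
      using \<psi>_scale[OF carr_zero carr_zero, of 0] endo_zero[OF \<phi>] by (simp add: factor_scale)
  next
    case (add v w)
    then show ?case by (simp add: \<psi>_add factor_add endo_add[OF \<phi>])
  next
    case (scale c v)
    then show ?case by (simp add: \<psi>_scale[of v v] factor_scale endo_gscale[OF \<phi>])
  next
    case (mult v w)
    then show ?case by (simp add: \<psi>_mult factor_mult endo_gmult[OF \<phi>] endo_closed[OF \<phi>])
  qed
  with \<phi> that show ?thesis by blast
qed

definition pull :: "'k gelem set set \<Rightarrow> 'k gelem set" where
  "pull M = {u \<in> carr (G d). cls u \<in> M}"

lemma I_subset_pull: "is_subspace A M \<Longrightarrow> I \<subseteq> pull M"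
proof
  fix u assume M: "is_subspace A M" and u: "u \<in> I"
  have "cls u = cls 0"
    using u by (intro cls_eqI) simp
  then show "u \<in> pull M"
    using M u I_carr by (auto simp: pull_def is_subspace_def factor_zero)
qed

lemma pull_subspace: "is_subspace A M \<Longrightarrow> is_subspace (G d) (pull M)"
  unfolding subspace_G pull_def is_subspace_def factor_zero
  by (auto simp: carr_zero carr_add carr_gscale simp flip: factor_add factor_scale)

lemma pull_T_ideal:
  assumes T: "is_T_ideal A T"
  shows "is_T_ideal (G d) (pull T)"
  unfolding T_ideal_G
proof (intro conjI allI impI)
  show "is_subspace (G d) (pull T)"
    using T by (intro pull_subspace) (simp add: is_T_ideal_def is_ideal_def)
  show "\<forall>u\<in>pull T. \<forall>v\<in>carr (G d). gmult u v \<in> pull T \<and> gmult v u \<in> pull T"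
    using T by (auto simp: pull_def carr_gmult is_T_ideal_def is_ideal_def factor_carr simp flip: factor_mult)
  fix \<phi> :: "'k gelem \<Rightarrow> 'k gelem" assume \<phi>: "is_endo (G d) \<phi>"
  obtain \<psi> where \<psi>: "is_endo A \<psi>" "\<And>u. u \<in> carr (G d) \<Longrightarrow> \<psi> (cls u) = cls (\<phi> u)"
    using endo_descends[OF \<phi>] by blast
  have "\<psi> ` T \<subseteq> T"
    using T \<psi>(1) by (simp add: is_T_ideal_def)
  then show "\<phi> ` pull T \<subseteq> pull T"
    using \<psi>(2) endo_closed[OF \<phi>] unfolding pull_def by (smt (verit) image_subset_iff mem_Collect_eq)
qed

lemma image_T_ideal:
  assumes T: "is_T_ideal (G d) T"
  shows "is_T_ideal A (cls ` T)"
proof -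
  have carr: "T \<subseteq> carr (G d)"
    using T by (simp add: T_ideal_G subspace_G)
  have "\<psi> ` cls ` T \<subseteq> cls ` T" if \<psi>: "is_endo A \<psi>" for \<psi>
  proof -
    obtain \<phi> where \<phi>: "is_endo (G d) \<phi>" "\<And>u. u \<in> carr (G d) \<Longrightarrow> \<psi> (cls u) = cls (\<phi> u)"
      using endo_lifts[OF \<psi>] by blast
    have "\<phi> ` T \<subseteq> T"
      using T \<phi>(1) by (simp add: T_ideal_G)
    moreover have "\<psi> (cls u) = cls (\<phi> u)" if "u \<in> T" for u
      using \<phi>(2) carr that by blast
    ultimately show ?thesis by blast
  qed
  moreover have "is_ideal A (cls ` T)"
    unfolding is_ideal_def is_subspace_def factor_carr factor_zero
  proof (intro conjI ballI allI)
    fix U V assume "U \<in> cls ` T" "V \<in> cls ` carr (G d)"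
    then obtain u v where "U = cls u" "V = cls v" "u \<in> T" "v \<in> carr (G d)" by blast
    then show "nmult A U V \<in> cls ` T" "nmult A V U \<in> cls ` T"
      using T carr by (auto simp: factor_mult T_ideal_G)
  next
    fix U V assume "U \<in> cls ` T" "V \<in> cls ` T"
    then obtain u v where "U = cls u" "V = cls v" "u \<in> T" "v \<in> T" by blast
    moreover have "u + v \<in> T" if "u \<in> T" "v \<in> T" for u v
      using T that unfolding T_ideal_G subspace_G by blast
    ultimately show "nadd A U V \<in> cls ` T"
      by (simp add: factor_add)
  next
    fix U c assume "U \<in> cls ` T"
    then show "nscale A c U \<in> cls ` T"
      using T by (auto simp: factor_scale T_ideal_G subspace_G)
  qed (use T in \<open>auto simp: T_ideal_G subspace_G\<close>)
  ultimately show ?thesis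
    by (simp add: is_T_ideal_def)
qed

text \<open>The inverse of an automorphism is again an endomorphism and preserves the T-ideal
  \<open>I\<close> too; so \<open>I\<close> is mapped onto itself and cosets onto full
  cosets.\<close>

lemma auto_image_cls:
  assumes \<phi>: "is_auto (G d) \<phi>" and u: "u \<in> carr (G d)"
  shows "\<phi> ` cls u = cls (\<phi> u)"
proof -
  have endo: "is_endo (G d) \<phi>" and bij: "bij_betw \<phi> (carr (G d)) (carr (G d))"
    using \<phi> by (auto simp: is_auto_def)
  define \<theta> where "\<theta> = inv_into (carr (G d)) \<phi>"
  have \<theta>: "\<theta> v \<in> carr (G d)" "\<phi> (\<theta> v) = v" if "v \<in> carr (G d)" for v
    using bij that by (auto simp: \<theta>_def bij_betw_def inv_into_into f_inv_into_f)
  have \<theta>I: "\<theta> v = w" if "\<phi> w = v" "w \<in> carr (G d)" for v w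
    using bij that by (auto simp: \<theta>_def bij_betw_def)
  have "is_endo (G d) \<theta>"
    unfolding is_endo_G
    by (auto intro!: \<theta>I simp: \<theta> carr_add carr_gscale carr_gmult endo_add[OF endo] endo_gscale[OF endo] endo_gmult[OF endo])
  then have "v \<in> \<phi> ` I" if "v \<in> I" for v
    using that \<theta>(2)[of v] I_carr I_endo[of \<theta> v] by (intro image_eqI[of _ _ "\<theta> v"]) auto
  then have "I \<subseteq> \<phi> ` I" by blast
  moreover have "\<phi> ` I \<subseteq> I"
    using I_endo[OF endo] by auto
  ultimately have "\<phi> ` I = I" by blast
  moreover have "\<phi> ` cls u = cls (\<phi> u) \<longleftrightarrow> (\<lambda>i. \<phi> u + \<phi> i) ` I = (\<lambda>i. \<phi> u + i) ` I"
  proof -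
    have "\<phi> ` cls u = (\<lambda>i. \<phi> u + \<phi> i) ` I"
      unfolding coset_def image_image using I_carr u by (intro image_cong) (auto simp: endo_add[OF endo])
    then show ?thesis by (simp add: coset_def)
  qed
  moreover have "(\<lambda>i. \<phi> u + \<phi> i) ` I = (\<lambda>i. \<phi> u + i) ` \<phi> ` I"
    by (simp add: image_image)
  ultimately show ?thesis by simp
qed

end

section \<open>Reduction of the equivalence to \<open>G\<^sub>d\<close>\<close>

definition GL_closed :: "nat \<Rightarrow> 'k::field gelem set \<Rightarrow> bool" where
  "GL_closed d M \<longleftrightarrow> is_subspace (G d) M \<and> (\<forall>\<phi>\<in>GL_autos d. \<phi> ` M \<subseteq> M)"

lemma T_ideal_GL_closed: "is_T_ideal (G d) T \<Longrightarrow> GL_closed d T"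
  by (simp add: GL_closed_def T_ideal_G GL_autos_def is_auto_def)

lemma G_comp_iff: "u \<in> G_comp d n \<longleftrightarrow> u \<in> carr (G d) \<and> (fst u \<noteq> 0 \<longrightarrow> n = 1) \<and>
    Poly_Mapping.keys (snd u) \<subseteq> {(a, b). expo_deg a + expo_deg b = n}"
  by (cases u) (auto simp: G_comp_def)

lemma G_comp_subspace: "is_subspace (G d) (G_comp d n)"
proof -
  have "u + v \<in> G_comp d n" if "u \<in> G_comp d n" "v \<in> G_comp d n" for u v
    using that keys_add_subsetI[of "snd u" _ "snd v"] unfolding G_comp_iff by (auto simp: carr_add)
  moreover have "gscale c u \<in> G_comp d n" if "u \<in> G_comp d n" for c u
  proof -
    have "Poly_Mapping.keys (snd (gscale c u)) \<subseteq> Poly_Mapping.keys (snd u)"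
      by (simp add: gscale_eq keys_const_mult)
    moreover have "fst u = 0 \<Longrightarrow> fst (gscale c u) = 0"
      by (simp add: gscale_eq)
    ultimately show ?thesis
      using that carr_gscale[of u d c] unfolding G_comp_iff by blast
  qed
  moreover have "0 \<in> G_comp d n"
    by (simp add: G_comp_iff carr_zero)
  moreover have "G_comp d n \<subseteq> carr (G d)"
    unfolding G_comp_iff[abs_def] subset_iff by blast
  ultimately show ?thesis
    unfolding subspace_G by blast
qed

text \<open>A linear change of generators replaces y_i by a form in the y's and z_i by the same form
  in the z's, which keeps even the bidegree.\<close>

lemma GL_autos_G_comp:
  assumes "\<phi> \<in> GL_autos d" "u \<in> G_comp d n"
  shows "\<phi> u \<in> G_comp d n"
proof -
  obtain A where endo: "is_endo (G d) \<phi>"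
    and A: "\<And>j. j \<in> {1..d} \<Longrightarrow> \<phi> (gx j) = (\<Sum>i=1..d. gscale (A i j) (gx i))"
    using assms(1) by (auto simp: GL_autos_def is_auto_def)
  have u: "u \<in> carr (G d)" using assms(2) by (simp add: G_comp_iff)
  let ?\<psi> = "\<lambda>i. \<phi> (gx i)"
  let ?F = "\<lambda>i j. {(a, b). expo_deg a = i \<and> expo_deg b = j}"
  have \<phi>u: "\<phi> u = ext_endo d ?\<psi> u"
    by (rule endo_unique[OF endo ext_endo_is_endo _ u]) (simp_all add: ext_endo_gx carr_gx endo_closed[OF endo])
  have "Poly_Mapping.keys (subst const (\<lambda>i. Yof (?\<psi> i)) (\<lambda>i. Zof (?\<psi> i)) (snd u))
      \<subseteq> {(a, b). expo_deg a + expo_deg b = n}"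
  proof (rule keys_subst_subsetI[where F = ?F])
    fix a b i assume ab: "(a, b) \<in> Poly_Mapping.keys (snd u)" and i: "i \<in> Poly_Mapping.keys a"
    have "i \<in> {1..d}" using carrD(2)[OF u] ab i unfolding Mons_def by blast
    then show "Poly_Mapping.keys (Yof (?\<psi> i)) \<subseteq> ?F 1 0"
      unfolding A[OF \<open>i \<in> {1..d}\<close>] Yof_sum Yof_gscale Yof_gx
      by (intro keys_sum_subsetI order_trans[OF keys_const_mult]) (simp add: yv_def)
  next
    fix a b i assume ab: "(a, b) \<in> Poly_Mapping.keys (snd u)" and i: "i \<in> Poly_Mapping.keys b"
    have "i \<in> {1..d}" using carrD(2)[OF u] ab i unfolding Mons_def by blast
    then show "Poly_Mapping.keys (Zof (?\<psi> i)) \<subseteq> ?F 0 1"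
      unfolding A[OF \<open>i \<in> {1..d}\<close>] Zof_sum Zof_gscale Zof_gx
      by (intro keys_sum_subsetI order_trans[OF keys_const_mult]) (simp add: zv_def)
  next
    fix a b assume "(a, b) \<in> Poly_Mapping.keys (snd u)"
    then have "expo_deg a + expo_deg b = n"
      using assms(2) unfolding G_comp_iff by blast
    then show "?F (expo_deg a) (expo_deg b) \<subseteq> {(a, b). expo_deg a + expo_deg b = n}"
      by auto
  qed (auto simp: zero_prod_def)
  moreover have "snd (ext_endo d ?\<psi> u) = subst const (\<lambda>i. Yof (?\<psi> i)) (\<lambda>i. Zof (?\<psi> i)) (snd u)"
    by (simp add: ext_endo_def A gpoly_def snd_sum gscale_eq) (simp add: gx_def)
  moreover have "fst u = 0 \<Longrightarrow> fst (ext_endo d ?\<psi> u) = 0"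
    by (simp add: ext_endo_def gpoly_def)
  ultimately show ?thesis
    using assms(2) endo_closed[OF endo u] unfolding G_comp_iff \<phi>u by auto
qed

text \<open>The squeeze. By \<open>lower\<close> the list consists of consequences. Conversely every
  consequence has a homogeneous representative in \<open>J\<close>, and \<open>upper\<close> places
  it in each submodule over which \<open>GL_submodule_gen\<close> intersects. Both conditions speak
  of G_d, since subspaces of the factor algebra are handled through their preimages
  \<open>pull\<close>.\<close>

lemma conseq_equivI:
  fixes f :: "'k::field gelem"
  assumes V: "is_T_ideal (G d) (V_ideal d \<beta>)"
    and f: "f \<in> G_comp d n" and S: "S \<subseteq> G_comp d (n + 1)"
    and lower: "\<And>T. is_T_ideal (G d) T \<Longrightarrow> V_ideal d \<beta> \<subseteq> T \<Longrightarrow> f \<in> T \<Longrightarrow> S \<subseteq> T"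
    and J: "is_T_ideal (G d) J" "V_ideal d \<beta> \<subseteq> J" "f \<in> J"
    and upper: "\<And>M. GL_closed d M \<Longrightarrow> V_ideal d \<beta> \<subseteq> M \<Longrightarrow> S \<subseteq> M \<Longrightarrow> J \<inter> G_comp d (n + 1) \<subseteq> M"
  shows "conseq_equiv d \<beta> n f S"
proof -
  interpret T_ideal_factor d "V_ideal d \<beta>"
    by unfold_locales (rule V)
  have carrJ: "J \<subseteq> carr (G d)" and carrS: "S \<subseteq> carr (G d)" and carrC: "G_comp d (n + 1) \<subseteq> carr (G d)"
    using J(1) S by (auto simp: T_ideal_G subspace_G G_comp_iff)
  let ?C = "consequences d \<beta> (n + 1) f" and ?T = "T_ideal_gen A {cls f}"
  have C: "?C = ?T \<inter> cls ` G_comp d (n + 1)"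
    by (simp add: consequences_def img_def GV_def)
  have T: "is_T_ideal A ?T"
    using image_T_ideal[OF J(1)] J(3) by (intro T_ideal_gen_is_T_ideal) auto
  have pullT: "is_T_ideal (G d) (pull ?T)"
    by (rule pull_T_ideal[OF T])
  have fT: "f \<in> pull ?T"
    using T_ideal_gen_superset[of "{cls f}" A] J(3) carrJ by (auto simp: pull_def)
  have VT: "V_ideal d \<beta> \<subseteq> pull ?T"
    using T by (intro I_subset_pull) (simp add: is_T_ideal_def is_ideal_def)
  \<comment> \<open>Together with \<open>CGL\<close> and \<open>SC\<close> this makes the
    consequences one of the submodules in that intersection.\<close>
  have Csub: "is_subspace A ?C"
  proof -
    have "is_subspace A ?T" using T by (simp add: is_T_ideal_def is_ideal_def)
    moreover have "is_subspace A (cls ` G_comp d (n + 1))"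
      using G_comp_subspace[of d "n + 1"] unfolding is_subspace_def[of A] factor_carr factor_zero
      by (auto simp: factor_add factor_scale subspace_G)
    ultimately show ?thesis
      unfolding C is_subspace_def by blast
  qed
  have CGL: "\<phi> ` U \<in> ?C" if \<phi>: "\<phi> \<in> GL_autos d" and U: "U \<in> ?C" for \<phi> U
  proof -
    obtain u where u: "u \<in> G_comp d (n + 1)" "U = cls u" "u \<in> pull ?T"
      using U carrC unfolding C pull_def by blast
    have "\<phi> ` U = cls (\<phi> u)"
      unfolding u(2) using \<phi> u(1) carrC by (intro auto_image_cls) (auto simp: GL_autos_def)
    moreover have "\<phi> u \<in> pull ?T"
      using T_ideal_GL_closed[OF pullT] \<phi> u(3) unfolding GL_closed_def by blast
    moreover have "\<phi> u \<in> G_comp d (n + 1)"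
      by (rule GL_autos_G_comp[OF \<phi> u(1)])
    ultimately show ?thesis by (simp add: C pull_def)
  qed
  have SC: "cls ` S \<subseteq> ?C"
    using lower[OF pullT VT fT] S unfolding C pull_def by blast
  have "?C = GL_submodule_gen d \<beta> (cls ` S)"
  proof
    show "GL_submodule_gen d \<beta> (cls ` S) \<subseteq> ?C"
      unfolding GL_submodule_gen_def GV_def using Csub CGL SC by blast
    show "?C \<subseteq> GL_submodule_gen d \<beta> (cls ` S)"
      unfolding GL_submodule_gen_def GV_def
    proof (intro subsetI InterI, elim CollectE conjE)
      fix U M assume U: "U \<in> ?C" and M: "is_subspace A M" "\<forall>\<phi>\<in>GL_autos d. \<forall>U\<in>M. \<phi> ` U \<in> M" "cls ` S \<subseteq> M"
      have "GL_closed d (pull M)"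
        unfolding GL_closed_def
      proof (intro conjI ballI subsetI)
        fix \<phi> v assume \<phi>: "\<phi> \<in> GL_autos d" and "v \<in> \<phi> ` pull M"
        then obtain u where u: "v = \<phi> u" "u \<in> carr (G d)" "cls u \<in> M"
          unfolding pull_def by blast
        moreover have "\<phi> ` cls u = cls (\<phi> u)"
          using \<phi> u by (intro auto_image_cls) (auto simp: GL_autos_def)
        moreover have "is_endo (G d) \<phi>"
          using \<phi> by (simp add: GL_autos_def is_auto_def)
        ultimately show "v \<in> pull M"
          using M(2) \<phi> endo_closed unfolding pull_def by (metis (mono_tags, lifting) mem_Collect_eq)
      qed (rule pull_subspace[OF M(1)])
      moreover have "V_ideal d \<beta> \<subseteq> pull M"
        by (rule I_subset_pull[OF M(1)])
      moreover have "S \<subseteq> pull M"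
        using M(3) carrS unfolding pull_def by blast
      ultimately have sub: "J \<inter> G_comp d (n + 1) \<subseteq> pull M"
        by (rule upper)
      obtain u where u: "u \<in> G_comp d (n + 1)" "U = cls u"
        using U unfolding C by blast
      have "?T \<subseteq> cls ` J"
        using J(3) by (intro T_ideal_gen_least image_T_ideal J(1)) auto
      then obtain v where v: "v \<in> J" "cls u = cls v"
        using U u unfolding C by blast
      \<comment> \<open>The homogeneous representative \<open>u\<close> and the representative
        \<open>v\<close> from \<open>J\<close> differ by an element of \<open>V_ideal\<close>, which
        lies in \<open>J\<close>.\<close>
      have "u = v + (u - v)" by simp
      moreover have "u - v \<in> J"
        using cls_eqD[OF v(2)] J(2) by blast
      ultimately have "u \<in> J"
        using J(1) v(1) unfolding T_ideal_G subspace_G by metis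
      then show "U \<in> M"
        using sub u unfolding pull_def by blast
    qed
  qed
  then show ?thesis
    using f by (simp add: conseq_equiv_def img_def[abs_def])
qed

section \<open>Polarization\<close>

locale yz_subspace =
  fixes P :: "'k::field_char_0 yzpoly set"
  assumes P_zero: "0 \<in> P"
    and P_add: "p \<in> P \<Longrightarrow> q \<in> P \<Longrightarrow> p + q \<in> P"
    and P_scale: "p \<in> P \<Longrightarrow> const c * p \<in> P"
begin

lemma P_uminus: "p \<in> P \<Longrightarrow> - p \<in> P"
  using P_scale[of p "- 1"] by (simp add: const_def single_uminus)

lemma P_diff: "p \<in> P \<Longrightarrow> q \<in> P \<Longrightarrow> p - q \<in> P"
  using P_add[of p "- q"] P_uminus by simp

lemma P_sum: "(\<And>i. i \<in> A \<Longrightarrow> f i \<in> P) \<Longrightarrow> sum f A \<in> P"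
  by (induction A rule: infinite_finite_induct) (simp_all add: P_zero P_add)

lemma P_scale_iff: "c \<noteq> 0 \<Longrightarrow> const c * p \<in> P \<longleftrightarrow> p \<in> P"
  using P_scale[of "const c * p" "inverse c"] P_scale[of p c] by (auto simp: const_inverse_cancel)

lemma P_of_nat_iff: "n \<noteq> 0 \<Longrightarrow> of_nat n * p \<in> P \<longleftrightarrow> p \<in> P"
  using P_scale_iff[of "of_nat n" p] by simp

lemma P_cong: "p - q \<in> P \<Longrightarrow> p \<in> P \<longleftrightarrow> q \<in> P"
  using P_add[of "p - q" q] P_diff[of p "p - q"] by auto

lemma P_diff_trans: "p - q \<in> P \<Longrightarrow> q - r \<in> P \<Longrightarrow> p - r \<in> P"
  using P_add[of "p - q" "q - r"] by simp

lemma P_diff_sym: "p - q \<in> P \<Longrightarrow> q - p \<in> P"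
  using P_uminus[of "p - q"] by simp

text \<open>The combination \<open>F(2 s) - 2\<^sup>n F(s)\<close> eliminates the coefficient of \<open>s\<^sup>n\<close>.\<close>

lemma coeffs_mem:
  assumes "\<And>s. (\<Sum>k\<le>n. const (s ^ k) * v k) \<in> P" "k \<le> n"
  shows "v k \<in> P"
  using assms
proof (induction n arbitrary: v k)
  case 0
  then show ?case using "0.prems"(1)[of 1] by simp
next
  case (Suc n)
  let ?F = "\<lambda>s. \<Sum>k\<le>Suc n. const (s ^ k) * v k"
  have low: "v k \<in> P" if "k \<le> n" for k
  proof -
    have "(\<Sum>k\<le>n. const (s ^ k) * (const (2 ^ k - 2 ^ Suc n) * v k)) \<in> P" for s
    proof -
      have "?F (2 * s) - const (2 ^ Suc n) * ?F s \<in> P"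
        by (intro P_diff P_scale Suc.prems(1))
      also have "?F (2 * s) - const (2 ^ Suc n) * ?F s =
          (\<Sum>k\<le>Suc n. const (s ^ k) * (const (2 ^ k - 2 ^ Suc n) * v k))"
        unfolding sum_distrib_left sum_subtractf[symmetric]
        by (intro sum.cong refl) (simp add: const_mult const_diff power_mult_distrib algebra_simps)
      finally show ?thesis by simp
    qed
    then have "const (2 ^ k - 2 ^ Suc n) * v k \<in> P"
      by (rule Suc.IH[OF _ that])
    moreover have "(2::'k) ^ k \<noteq> 2 ^ Suc n"
    proof
      assume "(2::'k) ^ k = 2 ^ Suc n"
      then have "of_nat (2 ^ k) = (of_nat (2 ^ Suc n) :: 'k)" by simp
      then have "(2::nat) ^ k = 2 ^ Suc n" by (subst (asm) of_nat_eq_iff)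
      then have "k = Suc n" by (subst (asm) power_inject_exp) simp_all
      with that show False by simp
    qed
    ultimately show ?thesis by (subst (asm) P_scale_iff) simp_all
  qed
  have "?F 1 - (\<Sum>k\<le>n. v k) \<in> P"
    by (intro P_diff P_sum Suc.prems(1)) (simp add: low)
  then have "v (Suc n) \<in> P" by simp
  with low Suc.prems(2) show ?case
    by (cases "k = Suc n") auto
qed

lemma poly_coeff_mem:
  assumes "\<And>s. poly Q (const s) \<in> P"
  shows "coeff Q k \<in> P"
proof (cases "k \<le> degree Q")
  case True
  show ?thesis
  proof (rule coeffs_mem[where v = "coeff Q", OF _ True])
    show "(\<Sum>k\<le>degree Q. const (s ^ k) * coeff Q k) \<in> P" for s
      using assms[of s] by (simp add: poly_altdef const_power mult.commute)
  qed
qed (simp add: coeff_eq_0 P_zero)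

end

text \<open>The substitution x_k -> x_k + s x_i with s kept as an indeterminate:
  \<open>[:yv k, yv i:]\<close> is y_k + s y_i.\<close>

definition transv :: "nat \<Rightarrow> nat \<Rightarrow> 'k::field yzpoly \<Rightarrow> 'k yzpoly poly" where
  "transv k i = subst (\<lambda>c. [:const c:]) (\<lambda>j. if j = k then [:yv k, yv i:] else [:yv j:])
     (\<lambda>j. if j = k then [:zv k, zv i:] else [:zv j:])"

text \<open>The derivation with y_k -> y_i and z_k -> z_i that kills the other variables, obtained
  as the first-order term in s. As a coefficient it lies, by \<open>poly_coeff_mem\<close>, in every
  subspace that contains the transvected polynomial for all values of s.\<close>

definition dyz :: "nat \<Rightarrow> nat \<Rightarrow> 'k::field yzpoly \<Rightarrow> 'k yzpoly" where
  "dyz k i p = coeff (transv k i p) 1"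

lemma const_poly_hom: "unital_hom (\<lambda>c. [:const c:] :: 'k::field yzpoly poly)"
  by unfold_locales (simp_all add: const_add const_mult one_pCons)

lemmas transv_simps = subst_simps[OF const_poly_hom, of "\<lambda>j. if j = k then [:yv k, yv i:] else [:yv j:]"
     "\<lambda>j. if j = k then [:zv k, zv i:] else [:zv j:]" for k i, folded transv_def]

lemma poly_transv:
  "poly (transv k i p) (const s) =
     subst const (\<lambda>j. if j = k then yv k + const s * yv i else yv j)
       (\<lambda>j. if j = k then zv k + const s * zv i else zv j) p"
proof (rule hom_eqI[where h = "\<lambda>p. poly (transv k i p) (const s)"])
  show "unital_hom (\<lambda>p. poly (transv k i p) (const s))"
    by unfold_locales (simp_all add: transv_simps)
qed (simp_all add: transv_simps subst_simps[OF const_hom] subst_hom[OF const_hom])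

lemma coeff_0_transv: "coeff (transv k i p) 0 = p"
proof (rule hom_eqI[where h = "\<lambda>p. coeff (transv k i p) 0" and h' = "\<lambda>p. p"])
  show "unital_hom (\<lambda>p. coeff (transv k i p) 0)"
    by unfold_locales (simp_all add: transv_simps coeff_mult)
qed (simp_all add: transv_simps unital_hom_def)

lemma dyz_add: "dyz k i (p + q) = dyz k i p + dyz k i q"
  by (simp add: dyz_def transv_simps)

lemma dyz_diff: "dyz k i (p - q) = dyz k i p - dyz k i q"
  by (simp add: dyz_def transv_simps)

lemma dyz_mult: "dyz k i (p * q) = dyz k i p * q + p * dyz k i q"
  by (simp add: dyz_def transv_simps coeff_mult coeff_0_transv One_nat_def)

lemma dyz_const [simp]: "dyz k i (const c) = 0" and dyz_1 [simp]: "dyz k i 1 = 0"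
  by (simp_all add: dyz_def transv_simps One_nat_def)

lemma dyz_yv: "dyz k i (yv j) = (if j = k then yv i else 0)"
  and dyz_zv: "dyz k i (zv j) = (if j = k then zv i else 0)"
  by (simp_all add: dyz_def transv_simps One_nat_def)

lemma dyz_power: "dyz k i (p ^ n) = of_nat n * p ^ (n - 1) * dyz k i p"
proof (induction n)
  case (Suc n)
  then show ?case by (cases n) (simp_all add: dyz_mult algebra_simps)
qed simp

lemma dyz_mexp: "Poly_Mapping.lookup a k = 0 \<Longrightarrow> (\<And>j. j \<noteq> k \<Longrightarrow> dyz k i (f j) = 0) \<Longrightarrow> dyz k i (mexp f a) = 0"
proof (induction a rule: expo_induct)
  case (add j a)
  then have "j \<noteq> k" "Poly_Mapping.lookup a k = 0"
    by (auto simp: lookup_add lookup_single when_def split: if_splits)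
  with add show ?case
    by (simp add: mexp_add dyz_mult)
qed simp

lemmas dyz_simps = dyz_add dyz_diff dyz_mult dyz_yv dyz_zv dyz_power

definition transv_endo :: "nat \<Rightarrow> nat \<Rightarrow> nat \<Rightarrow> 'k \<Rightarrow> 'k::field gelem \<Rightarrow> 'k gelem" where
  "transv_endo d k i s = ext_endo d (\<lambda>j. if j = k then gx k + gscale s (gx i) else gx j)"

context
  fixes d k i :: nat
  assumes ki: "k \<in> {1..d}" "i \<in> {1..d}" "i \<noteq> k"
begin

lemma transv_endo_is_endo: "is_endo (G d) (transv_endo d k i s)"
  unfolding transv_endo_def using ki
  by (intro ext_endo_is_endo) (simp add: carr_add carr_gscale carr_gx)

lemma transv_endo_gx:
  "j \<in> {1..d} \<Longrightarrow> transv_endo d k i s (gx j) = (if j = k then gx k + gscale s (gx i) else gx j)"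
  by (simp only: transv_endo_def ext_endo_gx)

lemma transv_endo_inverse:
  fixes u :: "'k::field gelem"
  assumes "u \<in> carr (G d)"
  shows "transv_endo d k i (- s) (transv_endo d k i s u) = u"
proof -
  let ?\<phi> = "transv_endo d k i :: 'k \<Rightarrow> _"
  note endo = transv_endo_is_endo
  show ?thesis
  proof (rule endo_unique[where \<phi> = "\<lambda>u. ?\<phi> (- s) (?\<phi> s u)" and \<psi> = "\<lambda>u. u", OF _ _ _ assms])
    show "is_endo (G d) (\<lambda>u. ?\<phi> (- s) (?\<phi> s u))"
      unfolding is_endo_G
      by (auto simp: endo_closed[OF endo] endo_add[OF endo] endo_gscale[OF endo] endo_gmult[OF endo]
          carr_add carr_gscale carr_gmult)
    show "is_endo (G d) (\<lambda>u. u)"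
      by (simp add: is_endo_G)
    fix j assume j: "j \<in> {1..d}"
    show "?\<phi> (- s) (?\<phi> s (gx j)) = gx j"
    proof (cases "j = k")
      case True
      have "?\<phi> (- s) (?\<phi> s (gx j)) = ?\<phi> (- s) (gx k) + gscale s (?\<phi> (- s) (gx i))"
        using True ki by (simp add: transv_endo_gx endo_add[OF endo] endo_gscale[OF endo] carr_gx carr_gscale)
      also have "\<dots> = gx k + (gscale (- s) (gx i) + gscale s (gx i))"
        using ki by (simp add: transv_endo_gx add.assoc)
      also have "\<dots> = gx j"
        using True by (simp flip: gscale_add_left)
      finally show ?thesis .
    qed (use j in \<open>simp add: transv_endo_gx\<close>)
  qed
qed

lemma transv_endo_GL: "transv_endo d k i (s :: 'k::field) \<in> GL_autos d"
proof -
  let ?\<phi> = "transv_endo d k i :: 'k \<Rightarrow> _"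
  \<comment> \<open>The elementary matrix I + s E_ik, whose columns are the images of the
    generators. As i and k differ, E_ik squares to zero, so parameters add and -s gives the
    inverse.\<close>
  let ?A = "\<lambda>s::'k. \<lambda>a b. (if a = b then 1 else 0) + (if a = i then if b = k then s else 0 else 0)"
  have mult: "(\<Sum>c=1..d. ?A s a c * ?A t c b) = ?A (s + t) a b" if "a \<in> {1..d}" "b \<in> {1..d}" for s t a b
  proof -
    have "?A s a c * ?A t c b = (if c = a then (if a = b then 1 else 0) else 0) +
        (if c = a then (if a = i then if b = k then t else 0 else 0) else 0) +
        (if c = k then (if a = i then if b = k then s else 0 else 0) else 0)" for c
      using ki by auto
    then show ?thesis
      using that ki by (simp add: sum.distrib)
  qed
  have "?A s \<in> GL d"
    unfolding GL_def using mult[of _ _ s "- s"] mult[of _ _ "- s" s]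
    by (intro CollectI exI[of _ "?A (- s)"]) simp
  moreover have "?\<phi> s (gx j) = (\<Sum>a=1..d. gscale (?A s a j) (gx a))" if "j \<in> {1..d}" for j
  proof -
    have "gscale (?A s a j) (gx a) = (if a = j then gx j else 0) + (if a = i then if j = k then gscale s (gx i) else 0 else 0)" for a
      by (simp add: gscale_add_left)
    then have "(\<Sum>a=1..d. gscale (?A s a j) (gx a)) = gx j + (if j = k then gscale s (gx i) else 0)"
      using that ki by (simp add: sum.distrib)
    then show ?thesis
      using that by (simp add: transv_endo_gx)
  qed
  moreover have "bij_betw (?\<phi> s) (carr (G d)) (carr (G d))"
    using endo_closed[OF transv_endo_is_endo] transv_endo_inverse[of _ s] transv_endo_inverse[of _ "- s"]
    by (intro bij_betw_byWitness[where f' = "?\<phi> (- s)"]) auto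
  ultimately show ?thesis
    unfolding GL_autos_def is_auto_def using transv_endo_is_endo[of s]
    by (intro CollectI conjI bexI[of _ "?A s"] ballI)
qed

end

text \<open>The infinitesimal form of stability under transvections, hence the condition that
  \<open>i\<close> and \<open>k\<close> differ.\<close>

locale D_closed = yz_subspace P for P :: "'k::field_char_0 yzpoly set" +
  fixes d :: nat
  assumes P_dyz: "\<lbrakk>p \<in> P; k \<in> {1..d}; i \<in> {1..d}; i \<noteq> k\<rbrakk> \<Longrightarrow> dyz k i p \<in> P"

definition poly_part :: "'k::field gelem set \<Rightarrow> 'k yzpoly set" where
  "poly_part M = {p. gpoly p \<in> M}"

lemma poly_part_iff: "p \<in> poly_part M \<longleftrightarrow> gpoly p \<in> M"
  by (simp add: poly_part_def)

lemma GL_closed_D_closed: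
  fixes M :: "'k::field_char_0 gelem set"
  assumes "GL_closed d M"
  shows "D_closed (poly_part M) d"
proof -
  interpret yz_subspace "poly_part M"
    using assms
    by unfold_locales (auto simp: poly_part_iff GL_closed_def subspace_G gpoly_add simp flip: gscale_gpoly)
  show ?thesis
  proof
    fix p k i assume p: "p \<in> poly_part M" and ki: "k \<in> {1..d}" "i \<in> {1..d}" "i \<noteq> k"
    have "poly (transv k i p) (const s) \<in> poly_part M" for s
    proof -
      have "(\<lambda>j. Yof (if j = k then gx k + gscale s (gx i) else gx j)) = (\<lambda>j. if j = k then yv k + const s * yv i else yv j)"
        "(\<lambda>j. Zof (if j = k then gx k + gscale s (gx i) else gx j)) = (\<lambda>j. if j = k then zv k + const s * zv i else zv j)"
        by (auto simp: Yof_add Yof_gscale Zof_add Zof_gscale)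
      then have "gpoly (poly (transv k i p) (const s)) = transv_endo d k i s (gpoly p)"
        unfolding transv_endo_def ext_endo_gpoly poly_transv by simp
      also have "\<dots> \<in> M"
        using assms transv_endo_GL[OF ki, of s] p unfolding GL_closed_def poly_part_iff by blast
      finally show ?thesis by (simp add: poly_part_iff)
    qed
    then show "dyz k i p \<in> poly_part M"
      unfolding dyz_def by (rule poly_coeff_mem)
  qed
qed

section \<open>Polynomials generated by highest weight vectors\<close>

abbreviation br :: "nat \<Rightarrow> nat \<Rightarrow> 'k::field yzpoly" where
  "br i j \<equiv> yv i * zv j - yv j * zv i"

lemma yv_mon: "yv i * mon a b = mon (ex i + a) b" and zv_mon: "zv i * mon a b = mon a (ex i + b)"
  by (simp_all add: yv_eq_mon zv_eq_mon mon_mult)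

lemma mexp_zv: "mexp zv b = mon 0 b"
  by (simp add: mon_eq_mexp)

lemma yv_power_zv_power: "yv 1 ^ j * zv 1 ^ k = mon (Poly_Mapping.single 1 j) (Poly_Mapping.single 1 k)"
  by (simp add: mon_eq_mexp)

lemma expo_split_deg:
  assumes "x \<le> expo_deg c"
  obtains a b where "c = a + b" "expo_deg a = x"
  using assms
proof (induction c arbitrary: x thesis rule: expo_induct)
  case zero
  from zero(1)[of 0 0] zero(2) show ?case by simp
next
  case (add i c)
  show ?case
  proof (cases x)
    case 0
    then show ?thesis using add(2)[of 0 "ex i + c"] by simp
  next
    case (Suc y)
    then have "y \<le> expo_deg c" using add(3) by simp
    then obtain a b where "c = a + b" "expo_deg a = y"
      using add(1)[of y] by blast
    then show ?thesis
      using add(2)[of "ex i + a" b] Suc by (simp add: add.assoc)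
  qed
qed

lemma lookup_le_expo_deg: "Poly_Mapping.lookup a i \<le> expo_deg a"
  by (induction a rule: expo_induct) (auto simp: lookup_add lookup_single when_def)

lemma expo_split_var:
  obtains n a' where "a = Poly_Mapping.single i n + a'" "Poly_Mapping.lookup a' i = (0::nat)"
proof
  show "a = Poly_Mapping.single i (Poly_Mapping.lookup a i) + (a - Poly_Mapping.single i (Poly_Mapping.lookup a i))"
    by (intro poly_mapping_eqI) (auto simp: lookup_add lookup_minus lookup_single when_def)
qed (simp add: lookup_minus)

lemma ex_add_eq_cases:
  assumes "ex i + b = ex j + b'"
  obtains "i = j" "b = b'" | r where "i \<noteq> j" "b = ex j + r" "b' = ex i + r"
proof (cases "i = j")
  case True
  with assms that show ?thesis by simp
next
  case False
  have "j \<in> Poly_Mapping.keys (ex i + b)"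
    unfolding assms by (simp add: keys_expo_add)
  with False have "j \<in> Poly_Mapping.keys b"
    by (simp add: keys_expo_add)
  then obtain r where r: "b = ex j + r" by (rule expo_split_key)
  with assms have "b' = ex i + r"
    by (metis add.left_commute add_left_imp_eq)
  with False r that show ?thesis by blast
qed

text \<open>If x_k does not occur, \<open>a - ex k\<close> is truncated, but then the factor
  \<open>Poly_Mapping.lookup a k\<close> is 0 and the formula stays true.\<close>

lemma dyz_mexp_var:
  assumes "\<And>j. dyz k i (f j) = (if j = k then f i else 0)"
  shows "dyz k i (mexp f a) = of_nat (Poly_Mapping.lookup a k) * mexp f (a - ex k + ex i)"
proof (induction a rule: expo_induct)
  case (add j a)
  have *: "f j * (of_nat (Poly_Mapping.lookup a k) * mexp f (a - ex k + ex i)) =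
      of_nat (Poly_Mapping.lookup a k) * mexp f (ex j + a - ex k + ex i)"
  proof (cases "Poly_Mapping.lookup a k = 0")
    case False
    then obtain a' where "a = ex k + a'"
      by (metis expo_split_key in_keys_iff)
    then show ?thesis by (simp add: mexp_add add.left_commute[of "ex j"] mult_ac)
  qed simp
  show ?case
    using add * by (cases "j = k") (simp_all add: mexp_add dyz_mult assms lookup_add lookup_single algebra_simps)
qed simp

lemma dyz_mon:
  "dyz k i (mon a b) = of_nat (Poly_Mapping.lookup a k) * mon (a - ex k + ex i) b +
     of_nat (Poly_Mapping.lookup b k) * mon a (b - ex k + ex i)"
  by (simp add: mon_eq_mexp dyz_mult dyz_mexp_var dyz_yv dyz_zv algebra_simps)

text \<open>\<open>Q\<close> prescribes a range of bidegrees: later y-degree 1, y-degree at least 2,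
  or any positive y-degree, always with positive z-degree.\<close>

definition deg_class :: "nat \<Rightarrow> (nat \<Rightarrow> nat \<Rightarrow> bool) \<Rightarrow> (expo \<times> expo) set" where
  "deg_class d Q = {(a, b). Poly_Mapping.keys a \<subseteq> {1..d} \<and> Poly_Mapping.keys b \<subseteq> {1..d} \<and>
     Q (expo_deg a) (expo_deg b)}"

text \<open>The image of a monomial \<open>Y\<^sup>a Z\<^sup>b\<close> in \<open>K[t\<^sub>1, \<dots>, t\<^sub>d]\<close> under \<open>y\<^sub>i, z\<^sub>i \<mapsto> t\<^sub>i\<close> is \<open>T\<^sup>a\<^sup>+\<^sup>b\<close>.\<close>

definition content_cong :: "'k::field yzpoly set \<Rightarrow> nat \<Rightarrow> nat \<Rightarrow> (nat \<Rightarrow> nat \<Rightarrow> bool) \<Rightarrow> bool" where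
  "content_cong P d N Q \<longleftrightarrow> (\<forall>a b a' b'. (a, b) \<in> deg_class d Q \<longrightarrow> (a', b') \<in> deg_class d Q \<longrightarrow>
     a + b = a' + b' \<longrightarrow> expo_deg (a + b) = N \<longrightarrow> mon a b - mon a' b' \<in> P)"

text \<open>A section of the content map, fixed by choice; under \<open>content_cong\<close> every
  other monomial of the class with the same content agrees with it modulo \<open>P\<close>.\<close>

definition rep :: "nat \<Rightarrow> (nat \<Rightarrow> nat \<Rightarrow> bool) \<Rightarrow> expo \<Rightarrow> 'k::field yzpoly" where
  "rep d Q c = (let m = SOME m. m \<in> deg_class d Q \<and> fst m + snd m = c in mon (fst m) (snd m))"

lemma rep_eq:
  assumes "Q x y" "x + y = expo_deg c" "Poly_Mapping.keys c \<subseteq> {1..d}"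
  obtains a b where "rep d Q c = mon a b" "(a, b) \<in> deg_class d Q" "a + b = c"
proof -
  obtain a b where ab: "c = a + b" "expo_deg a = x"
    using expo_split_deg[of x c] assms(2) by (metis le_add1)
  then have "\<exists>m. m \<in> deg_class d Q \<and> fst m + snd m = c"
    using assms by (intro exI[of _ "(a, b)"]) (auto simp: deg_class_def keys_expo_add)
  then have "(SOME m. m \<in> deg_class d Q \<and> fst m + snd m = c) \<in> deg_class d Q \<and>
      fst (SOME m. m \<in> deg_class d Q \<and> fst m + snd m = c) + snd (SOME m. m \<in> deg_class d Q \<and> fst m + snd m = c) = c"
    by (rule someI_ex)
  then show ?thesis
    by (intro that[of "fst (SOME m. m \<in> deg_class d Q \<and> fst m + snd m = c)"
          "snd (SOME m. m \<in> deg_class d Q \<and> fst m + snd m = c)"]) (simp_all add: rep_def Let_def)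
qed

section \<open>Spreading membership from the content x_1^N to all contents\<close>

context D_closed
begin

lemma content_congD:
  "content_cong P d N Q \<Longrightarrow> (a, b) \<in> deg_class d Q \<Longrightarrow> (a', b') \<in> deg_class d Q \<Longrightarrow>
     a + b = a' + b' \<Longrightarrow> expo_deg (a' + b') = N \<Longrightarrow> mon a b - mon a' b' \<in> P"
  unfolding content_cong_def by metis

text \<open>Replacing one x_1 by x_i, in the y-part (\<open>A\<close>) or in the z-part
  (\<open>B\<close>), always leads to content \<open>ex i + r\<close> inside the same class. All
  these monomials agree modulo \<open>P\<close>, and counted with multiplicity there are as many as
  factors x_1 in the content.\<close>

lemma dyz_mon_cong:
  assumes Q: "content_cong P d N Q" and ab: "(a, b) \<in> deg_class d Q" "a + b = ex 1 + r"
    and ab': "(a', b') \<in> deg_class d Q" "a' + b' = ex i + r" and N: "expo_deg r + 1 = N" and i: "i \<in> {1..d}"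
  shows "dyz 1 i (mon a b) - of_nat (Poly_Mapping.lookup (ex 1 + r) 1) * mon a' b' \<in> P"
proof -
  have P_of_nat: "p \<in> P \<Longrightarrow> of_nat n * p \<in> P" for p n
    using P_scale[of p "of_nat n"] by simp
  have A: "of_nat (Poly_Mapping.lookup a 1) * (mon (a - ex 1 + ex i) b - mon a' b') \<in> P"
  proof (cases "Poly_Mapping.lookup a 1 = 0")
    case False
    then obtain s where s: "a = ex 1 + s"
      by (metis expo_split_key in_keys_iff)
    then have "s + b = r"
      using ab(2) by (simp add: add.assoc)
    then have "mon (ex i + s) b - mon a' b' \<in> P"
      using ab ab' N i s
      by (intro content_congD[OF Q]) (auto simp: deg_class_def keys_expo_add add.assoc)
    then show ?thesis
      using s by (intro P_of_nat) (simp add: add.commute)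
  qed (simp add: P_zero)
  have B: "of_nat (Poly_Mapping.lookup b 1) * (mon a (b - ex 1 + ex i) - mon a' b') \<in> P"
  proof (cases "Poly_Mapping.lookup b 1 = 0")
    case False
    then obtain s where s: "b = ex 1 + s"
      by (metis expo_split_key in_keys_iff)
    then have "a + s = r"
      using ab(2) by (metis add.left_commute add_left_imp_eq)
    then have "mon a (ex i + s) - mon a' b' \<in> P"
      using ab ab' N i s
      by (intro content_congD[OF Q]) (auto simp: deg_class_def keys_expo_add add.left_commute)
    then show ?thesis
      using s by (intro P_of_nat) (simp add: add.commute)
  qed (simp add: P_zero)
  have "Poly_Mapping.lookup (ex 1 + r) 1 = Poly_Mapping.lookup a 1 + Poly_Mapping.lookup b 1"
    by (simp flip: ab(2) lookup_add)
  then show ?thesis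
    using P_add[OF A B] by (simp add: dyz_mon algebra_simps)
qed

lemma rep_step:
  assumes Q: "content_cong P d N Q" "Q x y" "x + y = N" and r: "expo_deg r + 1 = N" "Poly_Mapping.keys r \<subseteq> {1..d}"
    and i: "i \<in> {1..d}" and d: "d \<ge> 1"
  shows "dyz 1 i (rep d Q (ex 1 + r)) - of_nat (Poly_Mapping.lookup (ex 1 + r) 1) * rep d Q (ex i + r) \<in> P"
proof -
  obtain a b where ab: "rep d Q (ex 1 + r) = (mon a b :: 'k yzpoly)" "(a, b) \<in> deg_class d Q" "a + b = ex 1 + r"
    using rep_eq[of Q x y "ex 1 + r" d, where 'a = 'k] assms by (auto simp: keys_expo_add)
  obtain a' b' where ab': "rep d Q (ex i + r) = (mon a' b' :: 'k yzpoly)" "(a', b') \<in> deg_class d Q" "a' + b' = ex i + r"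
    using rep_eq[of Q x y "ex i + r" d, where 'a = 'k] assms by (auto simp: keys_expo_add)
  show ?thesis
    unfolding ab(1) ab'(1) by (rule dyz_mon_cong[OF Q(1) ab(2,3) ab'(2,3) r(1) i])
qed

text \<open>Every content is reached from x_1^N by turning factors x_1 into x_i one at a time. Each
  turn costs the multiplicity of x_1, which is positive and hence invertible in characteristic 0.
  \<open>F\<close> is abstract so as to cover single representatives and differences of two.\<close>

lemma content_fill:
  fixes F :: "expo \<Rightarrow> 'k yzpoly"
  assumes d: "d \<ge> 1" and base: "F (Poly_Mapping.single 1 N) \<in> P"
    and step: "\<And>r i. i \<in> {1..d} \<Longrightarrow> i \<noteq> 1 \<Longrightarrow> expo_deg r + 1 = N \<Longrightarrow> Poly_Mapping.keys r \<subseteq> {1..d} \<Longrightarrow>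
      dyz 1 i (F (ex 1 + r)) - of_nat (Poly_Mapping.lookup (ex 1 + r) 1) * F (ex i + r) \<in> P"
    and c: "expo_deg c = N" "Poly_Mapping.keys c \<subseteq> {1..d}"
  shows "F c \<in> P"
  using c
\<comment> \<open>The measure counts the factors other than x_1.\<close>
proof (induction "N - Poly_Mapping.lookup c 1" arbitrary: c rule: less_induct)
  case less
  show ?case
  proof (cases "Poly_Mapping.keys c \<subseteq> {1}")
    case True
    have "Poly_Mapping.single 1 (Poly_Mapping.lookup c 1) = c"
      using True by (intro poly_mapping_eqI) (auto simp: lookup_single when_def in_keys_iff)
    then show ?thesis
      using base less(2) by (metis expo_deg_single)
  next
    case False
    then obtain i where i: "i \<in> Poly_Mapping.keys c" "i \<noteq> 1" by auto
    then obtain r where r: "c = ex i + r" by (metis expo_split_key)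
    have *: "expo_deg r + 1 = N" "Poly_Mapping.keys r \<subseteq> {1..d}" "i \<in> {1..d}"
      using less(2,3) i by (auto simp: r keys_expo_add)
    have "F (ex 1 + r) \<in> P"
    proof (rule less(1))
      show "N - Poly_Mapping.lookup (ex 1 + r) 1 < N - Poly_Mapping.lookup c 1"
        using * lookup_le_expo_deg[of r 1] i(2) by (simp add: r lookup_add lookup_single)
    qed (use * d in \<open>auto simp: keys_expo_add\<close>)
    then have "dyz 1 i (F (ex 1 + r)) \<in> P"
      using i d * by (intro P_dyz) auto
    then have "of_nat (Poly_Mapping.lookup (ex 1 + r) 1) * F c \<in> P"
      using step[OF *(3) i(2) *(1,2)] by (simp add: P_cong r)
    then show ?thesis
      by (subst (asm) P_of_nat_iff) (auto simp: lookup_add)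
  qed
qed

lemma class_fill:
  assumes d: "d \<ge> 1" and Q: "content_cong P d N Q"
    and base: "(a0, b0) \<in> deg_class d Q" "a0 + b0 = Poly_Mapping.single 1 N" "mon a0 b0 \<in> P"
    and ab: "(a, b) \<in> deg_class d Q" "expo_deg a + expo_deg b = N"
  shows "mon a b \<in> P"
proof -
  have xy: "Q (expo_deg a) (expo_deg b)" and keys: "Poly_Mapping.keys (a + b) \<subseteq> {1..d}"
    using ab by (auto simp: deg_class_def keys_expo_add)
  have key1: "Poly_Mapping.keys (Poly_Mapping.single 1 N) \<subseteq> {1..d}"
    using d by simp
  have "rep d Q (a + b) \<in> P"
  proof (rule content_fill[OF d, where N = N])
    show "rep d Q (Poly_Mapping.single 1 N) \<in> P"
    proof -
      obtain a' b' where ab': "rep d Q (Poly_Mapping.single 1 N) = (mon a' b' :: 'k yzpoly)"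
          "(a', b') \<in> deg_class d Q" "a' + b' = Poly_Mapping.single 1 N"
        using rep_eq[of Q _ _ "Poly_Mapping.single 1 N" d, OF xy _ key1, where 'a = 'k] ab(2) by auto
      have "mon a' b' - mon a0 b0 \<in> P"
        using ab' base by (intro content_congD[OF Q]) simp_all
      with base(3) show ?thesis
        by (simp add: ab'(1) P_cong)
    qed
  qed (use keys ab d in \<open>auto intro!: rep_step[OF Q xy]\<close>)
  moreover obtain a' b' where ab': "rep d Q (a + b) = (mon a' b' :: 'k yzpoly)" "(a', b') \<in> deg_class d Q" "a' + b' = a + b"
    using rep_eq[of Q _ _ "a + b" d, OF xy, where 'a = 'k] keys by auto
  moreover have "mon a b - mon a' b' \<in> P"
    using ab ab' by (intro content_congD[OF Q]) simp_all
  ultimately show ?thesis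
    by (simp add: P_cong)
qed

text \<open>Representatives in both classes obey \<open>rep_step\<close> with the same multiplicity,
  hence so does their difference, and one coincidence at content x_1^N spreads to all
  contents.\<close>

lemma classes_fill:
  assumes d: "d \<ge> 1" and Q: "content_cong P d N Q" and Q': "content_cong P d N Q'"
    and base: "(a0, b0) \<in> deg_class d Q" "a0 + b0 = Poly_Mapping.single 1 N"
      "(a0', b0') \<in> deg_class d Q'" "a0' + b0' = Poly_Mapping.single 1 N" "mon a0 b0 - mon a0' b0' \<in> P"
    and ab: "(a, b) \<in> deg_class d Q" "(a', b') \<in> deg_class d Q'" "expo_deg a + expo_deg b = N" "a + b = a' + b'"
  shows "mon a b - mon a' b' \<in> P"
proof -
  have N': "expo_deg a' + expo_deg b' = N"
    using ab(3,4) by (metis expo_deg_add)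
  have xy: "Q (expo_deg a) (expo_deg b)" and xy': "Q' (expo_deg a') (expo_deg b')"
    and keys: "Poly_Mapping.keys (a + b) \<subseteq> {1..d}"
    using ab by (auto simp: deg_class_def keys_expo_add)
  have key1: "Poly_Mapping.keys (Poly_Mapping.single 1 N) \<subseteq> {1..d}"
    using d by simp
  have "rep d Q (a + b) - rep d Q' (a + b) \<in> P"
  proof (rule content_fill[OF d, where N = N and F = "\<lambda>c. rep d Q c - rep d Q' c"])
    obtain a1 b1 where 1: "rep d Q (Poly_Mapping.single 1 N) = (mon a1 b1 :: 'k yzpoly)"
        "(a1, b1) \<in> deg_class d Q" "a1 + b1 = Poly_Mapping.single 1 N"
      using rep_eq[of Q _ _ "Poly_Mapping.single 1 N" d, OF xy _ key1, where 'a = 'k] ab(3) by auto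
    obtain a2 b2 where 2: "rep d Q' (Poly_Mapping.single 1 N) = (mon a2 b2 :: 'k yzpoly)"
        "(a2, b2) \<in> deg_class d Q'" "a2 + b2 = Poly_Mapping.single 1 N"
      using rep_eq[of Q' _ _ "Poly_Mapping.single 1 N" d, OF xy' _ key1, where 'a = 'k] N' by auto
    have "mon a1 b1 - mon a0 b0 \<in> P"
      by (rule content_congD[OF Q 1(2) base(1)]) (simp_all add: 1 base)
    moreover have "mon a0' b0' - mon a2 b2 \<in> P"
      by (rule content_congD[OF Q' base(3) 2(2)]) (simp_all add: 2 base)
    ultimately show "rep d Q (Poly_Mapping.single 1 N) - rep d Q' (Poly_Mapping.single 1 N) \<in> P"
      unfolding 1(1) 2(1) using base(5) P_diff_trans by blast
  next
    fix r i assume i: "i \<in> {1..d}" "i \<noteq> 1" and r: "expo_deg r + 1 = N" "Poly_Mapping.keys r \<subseteq> {1..d}"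
    let ?n = "of_nat (Poly_Mapping.lookup (ex 1 + r) 1)"
    have "(dyz 1 i (rep d Q (ex 1 + r)) - ?n * rep d Q (ex i + r)) -
        (dyz 1 i (rep d Q' (ex 1 + r)) - ?n * rep d Q' (ex i + r)) \<in> P"
      by (intro P_diff rep_step[OF Q xy ab(3) r i(1) d] rep_step[OF Q' xy' N' r i(1) d])
    then show "dyz 1 i (rep d Q (ex 1 + r) - rep d Q' (ex 1 + r)) - ?n * (rep d Q (ex i + r) - rep d Q' (ex i + r)) \<in> P"
      by (simp add: dyz_diff algebra_simps)
  qed (use keys ab(3) in auto)
  moreover obtain a1 b1 where 1: "rep d Q (a + b) = (mon a1 b1 :: 'k yzpoly)" "(a1, b1) \<in> deg_class d Q" "a1 + b1 = a + b"
    using rep_eq[of Q _ _ "a + b" d, OF xy, where 'a = 'k] keys by auto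
  moreover obtain a2 b2 where 2: "rep d Q' (a + b) = (mon a2 b2 :: 'k yzpoly)" "(a2, b2) \<in> deg_class d Q'" "a2 + b2 = a + b"
    using rep_eq[of Q' _ _ "a + b" d, OF xy', where 'a = 'k] keys ab(3) N' by auto
  moreover have "mon a b - mon a1 b1 \<in> P"
    by (rule content_congD[OF Q ab(1) 1(2)]) (simp_all add: 1 ab(3))
  moreover have "mon a2 b2 - mon a' b' \<in> P"
    by (rule content_congD[OF Q' 2(2) ab(2)]) (simp_all add: 2 ab(4) N')
  ultimately show ?thesis
    using P_diff_trans by metis
qed

end

section \<open>The bracket y_1 z_2 - y_2 z_1 and monomials of y-degree one\<close>

context D_closed
begin

lemma bracket_var:
  assumes w: "br 1 2 * zv 1 ^ m \<in> P" and j: "j \<in> {1..d}" "j \<noteq> 1" and d: "d \<ge> 2"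
  shows "br 1 j * zv 1 ^ m \<in> P"
proof (cases "j = 2")
  case False
  have "dyz 2 j (br 1 2 * zv 1 ^ m) \<in> P"
    using w j d False by (intro P_dyz) auto
  moreover have "dyz 2 j (br 1 2 * zv 1 ^ m) = (br 1 j * zv 1 ^ m :: 'k yzpoly)"
    by (simp add: dyz_simps)
  ultimately show ?thesis by simp
qed (use w in simp)

text \<open>Each factor z_l of \<open>b\<close> arises by differentiating along x_1 -> x_l, and
  \<open>b\<close> avoids x_1 so that the derivation kills the part already built. One derivative
  yields only (a+2) U_jl - U_lj, where U_jl is the bracket of x_1 and x_j times z_l and the rest;
  the relation with j and l exchanged makes the system solvable.\<close>

lemma bracket_fill_free:
  assumes w: "br 1 2 * zv 1 ^ m \<in> P" and d: "d \<ge> 2"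
    and b: "Poly_Mapping.lookup b 1 = 0" "Poly_Mapping.keys b \<subseteq> {1..d}" "a + expo_deg b = m"
    and j: "j \<in> {1..d}" "j \<noteq> 1"
  shows "br 1 j * zv 1 ^ a * mexp zv b \<in> P"
  using b j
proof (induction b arbitrary: a j rule: expo_induct)
  case zero
  then show ?case
    using bracket_var[OF w _ _ d, of j] by simp
next
  case (add i b)
  let ?T = "mexp zv b :: 'k yzpoly"
  have i: "i \<in> {1..d}" "i \<noteq> 1" and b: "Poly_Mapping.lookup b 1 = 0" "Poly_Mapping.keys b \<subseteq> {1..d}" "Suc a + expo_deg b = m"
    using add.prems(1-3) by (auto simp: lookup_add lookup_single when_def keys_expo_add split: if_splits)
  have T: "dyz 1 l ?T = 0" for l
    using b(1) by (intro dyz_mexp) (simp_all add: dyz_zv)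
  define U where "U j l = br 1 j * zv 1 ^ a * zv l * ?T" for j l
  have rel: "of_nat (a + 2) * U j l - U l j \<in> P" if "j \<in> {1..d}" "j \<noteq> 1" "l \<in> {1..d}" "l \<noteq> 1" for j l
  proof -
    have "br 1 j * zv 1 ^ Suc a * ?T \<in> P"
      using that by (intro add.IH b) auto
    then have mem: "dyz 1 l (br 1 j * zv 1 ^ Suc a * ?T) \<in> P"
      using that d by (intro P_dyz) auto
    have "dyz 1 l (zv 1 ^ Suc a) = (of_nat (Suc a) * zv 1 ^ a * zv l :: 'k yzpoly)"
      by (simp only: dyz_power) (simp add: dyz_zv)
    then have "dyz 1 l (br 1 j * zv 1 ^ Suc a * ?T) = br l j * zv 1 ^ Suc a * ?T + of_nat (Suc a) * U j l"
      using that(2) by (simp add: dyz_mult dyz_diff dyz_yv dyz_zv T U_def algebra_simps del: power_Suc)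
    also \<comment> \<open>\<open>br l j * zv 1 = br 1 j * zv l - br 1 l * zv j\<close>\<close>
    have "br l j * zv 1 ^ Suc a * ?T = U j l - U l j"
      by (simp add: U_def algebra_simps)
    also have "U j l - U l j + of_nat (Suc a) * U j l = of_nat (a + 2) * U j l - U l j"
      by (simp add: algebra_simps)
    finally show ?thesis
      using mem by simp
  qed
  \<comment> \<open>Elimination of \<open>U i j\<close>; the determinant (a+2)^2 - 1 = (a+1)(a+3) is
    nonzero in characteristic 0.\<close>
  have "const (of_nat (a + 2)) * (of_nat (a + 2) * U j i - U i j) + (of_nat (a + 2) * U i j - U j i) \<in> P"
    using add.prems i by (intro P_add P_scale rel) auto
  also have "const (of_nat (a + 2)) * (of_nat (a + 2) * U j i - U i j) + (of_nat (a + 2) * U i j - U j i) =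
      of_nat ((a + 1) * (a + 3)) * U j i"
    unfolding const_of_nat by (simp add: algebra_simps)
  finally have "U j i \<in> P"
    by (subst (asm) P_of_nat_iff) simp_all
  then show ?case
    by (simp add: U_def mexp_add mult_ac)
qed

text \<open>Write [i,j] for \<open>br i j\<close>. If neither index is 1, a factor z_1 allows the
  reduction [i,j] z_1 = [1,j] z_i - [1,i] z_j; without such a factor, the derivation x_1 -> x_i
  turns [1,j] into [i,j] and treats the rest as constant.\<close>

lemma bracket_fill:
  assumes w: "br 1 2 * zv 1 ^ m \<in> P" and d: "d \<ge> 2"
    and b: "Poly_Mapping.keys b \<subseteq> {1..d}" "expo_deg b = m" and ij: "i \<in> {1..d}" "j \<in> {1..d}"
  shows "br i j * mon 0 b \<in> P"
proof -
  obtain n b' where b': "b = Poly_Mapping.single 1 n + b'" "Poly_Mapping.lookup b' 1 = 0"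
    by (rule expo_split_var)
  have keys: "Poly_Mapping.keys b' \<subseteq> {1..d}" and deg: "n + expo_deg b' = m"
    using b by (auto simp: b' keys_expo_add)
  have mon: "mon 0 b = (zv 1 ^ n * mexp zv b' :: 'k yzpoly)"
    by (simp add: b' mexp_add flip: mexp_zv)
  note fill = bracket_fill_free[OF w d]
  have one: "br 1 j * mon 0 b \<in> P" if "j \<in> {1..d}" for j
  proof (cases "j = 1")
    case False
    then show ?thesis
      using fill[OF b'(2) keys deg that] by (simp add: mon mult.assoc)
  qed (simp add: P_zero)
  consider "i = 1" | "j = 1" | "i \<noteq> 1" "j \<noteq> 1" "n = 0" | n' where "i \<noteq> 1" "j \<noteq> 1" "n = Suc n'"
    by (cases n) auto
  then show ?thesis
  proof cases
    case 1
    then show ?thesis using one ij by simp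
  next
    case 2
    then show ?thesis using P_uminus[OF one[OF ij(1)]] by (simp add: algebra_simps)
  next
    case 3
    have "dyz 1 i (br 1 j * mon 0 b) \<in> P"
      using one[OF ij(2)] 3 ij d by (intro P_dyz) auto
    moreover have "dyz 1 i (mexp zv b' :: 'k yzpoly) = 0"
      using b'(2) by (intro dyz_mexp) (simp_all add: dyz_zv)
    ultimately show ?thesis
      using 3 by (simp add: mon dyz_simps)
  next
    case 4
    have *: "br 1 l * zv 1 ^ n' * mexp zv (ex l' + b') \<in> P"
      if "l \<in> {1..d}" "l \<noteq> 1" "l' \<in> {1..d}" "l' \<noteq> 1" for l l'
      using that b'(2) keys deg 4 by (intro fill) (auto simp: lookup_add lookup_single keys_expo_add)
    have "br 1 j * zv 1 ^ n' * mexp zv (ex i + b') - br 1 i * zv 1 ^ n' * mexp zv (ex j + b') \<in> P"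
      using ij 4 by (intro P_diff *)
    then show ?thesis
      using 4 by (simp add: mon mexp_add algebra_simps)
  qed
qed

text \<open>Distinct monomials of y-degree 1 and equal content are y_i z_j Z^r and y_j z_i Z^r, so
  they differ by a bracket times Z^r.\<close>

lemma bracket_content_cong:
  assumes w: "br 1 2 * zv 1 ^ m \<in> P" and d: "d \<ge> 2"
  shows "content_cong P d (m + 2) (\<lambda>x y. x = 1 \<and> 1 \<le> y)"
  unfolding content_cong_def
proof (intro allI impI)
  fix a b a' b'
  assume ab: "(a, b) \<in> deg_class d (\<lambda>x y. x = 1 \<and> 1 \<le> y)" "(a', b') \<in> deg_class d (\<lambda>x y. x = 1 \<and> 1 \<le> y)"
    and eq: "a + b = a' + b'" and deg: "expo_deg (a + b) = m + 2"
  obtain i j where ij: "a = ex i" "a' = ex j"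
    using ab by (auto simp: deg_class_def elim!: expo_deg_eq_1E)
  from eq[unfolded ij] show "mon a b - mon a' b' \<in> P"
  proof (cases rule: ex_add_eq_cases)
    case 1
    then show ?thesis by (simp add: ij P_zero)
  next
    case (2 r)
    have "br i j * mon 0 r \<in> P"
      using ab deg by (intro bracket_fill[OF w d]) (auto simp: ij 2 deg_class_def keys_expo_add)
    then show ?thesis
      by (simp add: ij 2 left_diff_distrib mult.assoc yv_mon zv_mon)
  qed
qed

end

text \<open>The two relations of the identity, each with an arbitrary cofactor
  \<open>mon a b\<close>: \<open>P\<close> need not be an ideal, so the multiples have to be assumed
  as well.\<close>

locale V_closed = D_closed P d for P :: "'k::field_char_0 yzpoly set" and d :: nat +
  assumes V1: "\<lbrakk>k \<in> {1..d}; i \<in> {1..d}; j \<in> {1..d}; Poly_Mapping.keys a \<subseteq> {1..d}; Poly_Mapping.keys b \<subseteq> {1..d}\<rbrakk>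
      \<Longrightarrow> yv k * br i j * mon a b \<in> P"
    and V2: "\<lbrakk>i \<in> {1..d}; j \<in> {1..d}; k \<in> {1..d}; l \<in> {1..d};
      Poly_Mapping.keys a \<subseteq> {1..d}; Poly_Mapping.keys b \<subseteq> {1..d}\<rbrakk>
      \<Longrightarrow> yv i * yv j * zv k * (yv l - zv l) * mon a b \<in> P"
begin

text \<open>\<open>V2\<close> turns a factor y_l into z_l as long as two further y's and a z stand
  beside it, so the descent ends at y-degree 2.\<close>

lemma reduce_y_degree:
  assumes "(a, b) \<in> Mons d 2 1"
  obtains a' b' where "(a', b') \<in> Mons d 2 1" "expo_deg a' = 2" "a' + b' = a + b" "mon a b - mon a' b' \<in> P"
  using assms
proof (induction "expo_deg a" arbitrary: a b thesis rule: less_induct)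
  case less
  show ?case
  proof (cases "expo_deg a = 2")
    case True
    then show ?thesis using less(2)[of a b] less(3) by (simp add: P_zero)
  next
    case False
    have ge: "expo_deg a \<ge> 3" "expo_deg b \<ge> 1"
      using less(3) False by (auto simp: Mons_def)
    obtain l a1 where l: "a = ex l + a1" using expo_deg_pos_ex[of a] ge(1) by auto
    obtain i a2 where i: "a1 = ex i + a2" using expo_deg_pos_ex[of a1] ge(1) l by auto
    obtain j a3 where j: "a2 = ex j + a3" using expo_deg_pos_ex[of a2] ge(1) l i by auto
    obtain k b1 where k: "b = ex k + b1" using expo_deg_pos_ex[of b] ge(2) by auto
    have keys: "l \<in> {1..d}" "i \<in> {1..d}" "j \<in> {1..d}" "k \<in> {1..d}"
        "Poly_Mapping.keys a3 \<subseteq> {1..d}" "Poly_Mapping.keys b1 \<subseteq> {1..d}"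
      using less(3) unfolding l i j k by (auto simp: Mons_def keys_expo_add)
    have "yv i * yv j * zv k * (yv l - zv l) * mon a3 b1 \<in> P"
      using keys by (intro V2)
    also have "yv i * yv j * zv k * (yv l - zv l) * mon a3 b1 =
        yv l * (yv i * (yv j * (zv k * mon a3 b1))) - yv i * (yv j * (zv l * (zv k * mon a3 b1)))"
      by (simp add: algebra_simps)
    also have "\<dots> = mon a b - mon a1 (ex l + b)"
      by (simp only: yv_mon zv_mon l i j k)
    finally have step: "mon a b - mon a1 (ex l + b) \<in> P" .
    have m: "(a1, ex l + b) \<in> Mons d 2 1"
      using less(3) ge keys unfolding l by (auto simp: Mons_def keys_expo_add)
    obtain a' b' where ab': "(a', b') \<in> Mons d 2 1" "expo_deg a' = 2" "a' + b' = a1 + (ex l + b)"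
        "mon a1 (ex l + b) - mon a' b' \<in> P"
      using less(1)[OF _ _ m] by (auto simp: l)
    show ?thesis
      by (rule less(2)[OF ab'(1,2)]) (simp add: ab' l add_ac, rule P_diff_trans[OF step ab'(4)])
  qed
qed

text \<open>If x_k occurs only among the z's, \<open>V1\<close> exchanges it with one of the two
  y's, while the other y is the multiplier that \<open>V1\<close> requires.\<close>

lemma bring_to_front:
  assumes "(a, b) \<in> Mons d 2 1" "expo_deg a = 2" "k \<in> Poly_Mapping.keys (a + b)"
  obtains j b' where "(ex k + ex j, b') \<in> Mons d 2 1" "ex k + ex j + b' = a + b" "mon a b - mon (ex k + ex j) b' \<in> P"
proof (cases "k \<in> Poly_Mapping.keys a")
  case True
  then obtain a1 where a1: "a = ex k + a1" by (rule expo_split_key)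
  then have "expo_deg a1 = 1" using assms(2) by simp
  then obtain j where "a1 = ex j" by (rule expo_deg_eq_1E)
  with that[of j b] a1 assms(1) show ?thesis by (simp add: P_zero)
next
  case False
  then have "k \<in> Poly_Mapping.keys b" using assms(3) by (simp add: keys_expo_add)
  then obtain r where r: "b = ex k + r" by (rule expo_split_key)
  obtain i a1 where i: "a = ex i + a1" using expo_deg_pos_ex[of a] assms(2) by auto
  then have "expo_deg a1 = 1" using assms(2) by simp
  then obtain j where j: "a1 = ex j" by (rule expo_deg_eq_1E)
  have keys: "i \<in> {1..d}" "j \<in> {1..d}" "k \<in> {1..d}" "Poly_Mapping.keys r \<subseteq> {1..d}"
    using assms(1) unfolding i j r by (auto simp: Mons_def keys_expo_add)
  have "yv j * br i k * mon 0 r \<in> P"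
    using keys by (intro V1) auto
  also have "yv j * br i k * mon 0 r = yv i * (yv j * (zv k * mon 0 r)) - yv k * (yv j * (zv i * mon 0 r))"
    by (simp add: algebra_simps)
  also have "\<dots> = mon a b - mon (ex k + ex j) (ex i + r)"
    by (simp add: yv_mon zv_mon i j r)
  finally show ?thesis
    using keys by (intro that[of j "ex i + r"]) (auto simp: Mons_def keys_expo_add i j r add_ac)
qed

text \<open>Once both monomials have y-degree 2 and share a factor y_k, they differ by at most one
  exchange of y_j z_l for y_l z_j, which \<open>V1\<close> with multiplier y_k performs.\<close>

lemma high_content_cong: "content_cong P d N (\<lambda>x y. 2 \<le> x \<and> 1 \<le> y)"
proof -
  have class_eq: "deg_class d (\<lambda>x y. 2 \<le> x \<and> 1 \<le> y) = Mons d 2 1"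
    by (simp add: deg_class_def Mons_def)
  have two: "mon a b - mon a' b' \<in> P"
    if ab: "(a, b) \<in> Mons d 2 1" "expo_deg a = 2" "(a', b') \<in> Mons d 2 1" "expo_deg a' = 2" "a + b = a' + b'"
    for a b a' b'
  proof -
    obtain k a1 where k: "a' = ex k + a1" using expo_deg_pos_ex[of a'] ab(4) by auto
    then have "expo_deg a1 = 1" using ab(4) by simp
    then obtain l where l: "a1 = ex l" by (rule expo_deg_eq_1E)
    have "k \<in> Poly_Mapping.keys (a + b)"
      unfolding ab(5) k by (simp add: keys_expo_add)
    then obtain j b1 where j: "(ex k + ex j, b1) \<in> Mons d 2 1" "ex k + ex j + b1 = a + b"
        "mon a b - mon (ex k + ex j) b1 \<in> P"
      using bring_to_front[OF ab(1,2)] by blast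
    have "ex j + b1 = ex l + b'"
      using j(2) unfolding ab(5) k l by (simp add: add.assoc)
    then have "mon (ex k + ex j) b1 - mon a' b' \<in> P"
    proof (cases rule: ex_add_eq_cases)
      case 1
      then show ?thesis by (simp add: k l P_zero)
    next
      case (2 r)
      have "yv k * br j l * mon 0 r \<in> P"
        using j(1) ab(3) unfolding k l 2 by (intro V1) (auto simp: Mons_def keys_expo_add)
      also have "yv k * br j l * mon 0 r = yv k * (yv j * (zv l * mon 0 r)) - yv k * (yv l * (zv j * mon 0 r))"
        by (simp add: algebra_simps)
      finally show ?thesis
        by (simp add: k l 2 yv_mon zv_mon)
    qed
    with j(3) show ?thesis by (rule P_diff_trans)
  qed
  show ?thesis
    unfolding content_cong_def class_eq
  proof (intro allI impI)
    fix a b a' b' assume ab: "(a, b) \<in> Mons d 2 1" "(a', b') \<in> Mons d 2 1" "a + b = a' + b'"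
    obtain a1 b1 where 1: "(a1, b1) \<in> Mons d 2 1" "expo_deg a1 = 2" "a1 + b1 = a + b" "mon a b - mon a1 b1 \<in> P"
      using reduce_y_degree[OF ab(1)] by blast
    obtain a2 b2 where 2: "(a2, b2) \<in> Mons d 2 1" "expo_deg a2 = 2" "a2 + b2 = a' + b'" "mon a' b' - mon a2 b2 \<in> P"
      using reduce_y_degree[OF ab(2)] by blast
    have "mon a1 b1 - mon a2 b2 \<in> P"
      using 1 2 ab(3) by (intro two) simp_all
    then show "mon a b - mon a' b' \<in> P"
      using 1(4) P_diff_sym[OF 2(4)] P_diff_trans by blast
  qed
qed

lemma mem_of_monomials:
  assumes "\<And>a b. (a, b) \<in> Poly_Mapping.keys p \<Longrightarrow> mon a b \<in> P"
  shows "p \<in> P"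
proof -
  have "(\<Sum>m\<in>Poly_Mapping.keys p. const (Poly_Mapping.lookup p m) * mon (fst m) (snd m)) \<in> P"
    using assms by (intro P_sum P_scale) simp
  then show ?thesis by (simp add: sum_const_mon)
qed

lemma high_generated:
  assumes d: "d \<ge> 1" and N: "N \<ge> 3" and w: "yv 1 ^ 2 * zv 1 ^ (N - 2) \<in> P"
    and ab: "(a, b) \<in> Mons d 2 1" "expo_deg a + expo_deg b = N"
  shows "mon a b \<in> P"
proof (rule class_fill[OF d high_content_cong])
  show "mon (Poly_Mapping.single 1 2) (Poly_Mapping.single 1 (N - 2)) \<in> P"
    using w by (simp add: yv_power_zv_power)
  show "Poly_Mapping.single 1 2 + Poly_Mapping.single 1 (N - 2) = (Poly_Mapping.single 1 N :: expo)"
  proof -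
    have "2 + (N - 2) = N" using N by simp
    then show ?thesis by (metis single_add)
  qed
  show "(Poly_Mapping.single 1 2, Poly_Mapping.single 1 (N - 2)) \<in> deg_class d (\<lambda>x y. 2 \<le> x \<and> 1 \<le> y)"
    using d N by (auto simp: deg_class_def)
qed (use ab in \<open>auto simp: deg_class_def Mons_def\<close>)

lemma low_generated:
  assumes d: "d \<ge> 2" and w: "yv 1 * zv 1 ^ (m + 1) \<in> P" "br 1 2 * zv 1 ^ m \<in> P"
    and ab: "(a, b) \<in> Mons d 1 1" "expo_deg a = 1" "expo_deg a + expo_deg b = m + 2"
  shows "mon a b \<in> P"
proof (rule class_fill[OF _ bracket_content_cong[OF w(2) d]])
  show "mon (ex 1) (Poly_Mapping.single 1 (m + 1)) \<in> P"
    using w yv_power_zv_power[of 1 "m + 1", where 'a = 'k] by simp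
  show "ex 1 + Poly_Mapping.single 1 (m + 1) = Poly_Mapping.single 1 (m + 2)"
    by (simp add: numeral_2_eq_2 One_nat_def flip: single_add)
  show "(ex 1, Poly_Mapping.single 1 (m + 1)) \<in> deg_class d (\<lambda>x y. x = 1 \<and> 1 \<le> y)"
    using d by (auto simp: deg_class_def)
qed (use ab d in \<open>auto simp: deg_class_def Mons_def\<close>)

text \<open>The first generator makes low and high monomials of equal content agree modulo
  \<open>P\<close>, so every monomial is congruent to its representative. The combination of
  representatives belonging to \<open>p\<close> depends only on the image of \<open>p\<close> under
  merging and hence vanishes; what is left of \<open>p\<close> is a combination of differences in
  \<open>P\<close>.\<close>

lemma kernel_generated:
  assumes d: "d \<ge> 2" and N: "N = m + 2" "m \<ge> 1"
    and w: "yv 1 ^ 2 * zv 1 ^ m - yv 1 * zv 1 ^ (m + 1) \<in> P" "br 1 2 * zv 1 ^ m \<in> P"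
    and p: "Poly_Mapping.keys p \<subseteq> Mons d 1 1" "Poly_Mapping.keys p \<subseteq> {(a, b). expo_deg a + expo_deg b = N}"
      "subst const yv yv p = 0"
  shows "p \<in> P"
proof -
  let ?Q = "\<lambda>x y. 1 \<le> x \<and> 1 \<le> (y::nat)" and ?Q1 = "\<lambda>x y. x = 1 \<and> 1 \<le> (y::nat)" and ?Q2 = "\<lambda>x y. 2 \<le> x \<and> 1 \<le> (y::nat)"
  have cong1: "content_cong P d N ?Q1"
    unfolding N by (rule bracket_content_cong[OF w(2) d])
  have cross: "mon a b - mon a' b' \<in> P"
    if "(a, b) \<in> deg_class d ?Q2" "(a', b') \<in> deg_class d ?Q1" "expo_deg a + expo_deg b = N" "a + b = a' + b'" for a b a' b'
  proof (rule classes_fill[OF _ high_content_cong cong1 _ _ _ _ _ that])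
    show "mon (Poly_Mapping.single 1 2) (Poly_Mapping.single 1 m) - mon (ex 1) (Poly_Mapping.single 1 (m + 1)) \<in> P"
      using w(1) yv_power_zv_power[of 1 "m + 1", where 'a = 'k] by (simp add: yv_power_zv_power)
    show "Poly_Mapping.single 1 2 + Poly_Mapping.single 1 m = (Poly_Mapping.single 1 N :: expo)"
      "ex 1 + Poly_Mapping.single 1 (m + 1) = Poly_Mapping.single 1 N"
      by (simp_all add: N numeral_2_eq_2 One_nat_def flip: single_add)
  qed (use d N in \<open>auto simp: deg_class_def\<close>)
  have cong: "content_cong P d N ?Q"
    unfolding content_cong_def
  proof (intro allI impI)
    fix a b a' b' assume ab: "(a, b) \<in> deg_class d ?Q" "(a', b') \<in> deg_class d ?Q" "a + b = a' + b'" "expo_deg (a + b) = N"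
    have *: "(a, b) \<in> deg_class d ?Q1 \<or> (a, b) \<in> deg_class d ?Q2" "(a', b') \<in> deg_class d ?Q1 \<or> (a', b') \<in> deg_class d ?Q2"
      using ab by (auto simp: deg_class_def)
    have deg: "expo_deg (a' + b') = N" "expo_deg a + expo_deg b = N" "expo_deg a' + expo_deg b' = N"
      using ab(3,4) by (simp_all flip: expo_deg_add)
    show "mon a b - mon a' b' \<in> P"
      using * cross[of a b a' b'] P_diff_sym[OF cross[of a' b' a b]] ab deg
        content_congD[OF cong1, of a b a' b'] content_congD[OF high_content_cong, of a b a' b'] by auto
  qed
  define R :: "expo \<times> expo \<Rightarrow> 'k yzpoly" where "R m = rep d ?Q (fst m + snd m)" for m
  \<comment> \<open>K[t] is realised as K[y] inside the same ring: merging sends exponents (a, b) to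
    (a+b, 0), and \<open>R\<close> sees only their sum.\<close>
  have "lin_ext const R (subst const yv yv q) = lin_ext const R q" for q
  proof (induction q rule: poly_mapping_single_induct)
    case (single m c)
    obtain a b where m: "m = (a, b)" by fastforce
    have "subst const yv yv (Poly_Mapping.single m c) = const c * mon (a + b) 0"
      unfolding m single_eq_const_mon
      by (simp add: subst_simps[OF const_hom] subst_mon[OF const_hom]) (simp add: mon_eq_mexp mexp_add)
    also have "\<dots> = Poly_Mapping.single (a + b, 0) c"
      by (simp add: single_eq_const_mon)
    finally show ?case
      by (simp add: lin_ext_single m R_def)
  qed (simp_all add: subst_simps[OF const_hom] lin_ext_add[OF const_hom])
  from this[of p] have L: "lin_ext const R p = 0"
    by (simp add: p(3))
  have "(\<Sum>m\<in>Poly_Mapping.keys p. const (Poly_Mapping.lookup p m) * (mon (fst m) (snd m) - R m)) \<in> P"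
  proof (intro P_sum P_scale)
    fix m assume m: "m \<in> Poly_Mapping.keys p"
    obtain a b where ab: "m = (a, b)" by fastforce
    have *: "(a, b) \<in> deg_class d ?Q" "expo_deg a + expo_deg b = N"
      using p(1,2) m by (auto simp: ab deg_class_def Mons_def)
    then obtain a' b' where "R m = mon a' b'" "(a', b') \<in> deg_class d ?Q" "a' + b' = a + b"
      using rep_eq[of ?Q "expo_deg a" "expo_deg b" "a + b" d, where 'a = 'k]
      by (auto simp: ab R_def deg_class_def keys_expo_add)
    with * show "mon (fst m) (snd m) - R m \<in> P"
      by (simp add: ab content_congD[OF cong])
  qed
  also have "(\<Sum>m\<in>Poly_Mapping.keys p. const (Poly_Mapping.lookup p m) * (mon (fst m) (snd m) - R m)) = p - lin_ext const R p"
    by (simp add: right_diff_distrib sum_subtractf sum_const_mon lin_ext_def)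
  finally show ?thesis
    using L by simp
qed

end

section \<open>Consequences of the defining identity\<close>

text \<open>The polynomial is the identity evaluated at x_1 and x_2, hence a combination of products
  of generators.\<close>

lemma bracket_gen_carr:
  assumes "d \<ge> 2"
  shows "gpoly ((const c * yv 1 + const c' * zv 1) * br 1 2) \<in> carr (G d)"
proof -
  have 12: "1 \<in> {1..d}" "2 \<in> {1..d}" using assms by auto
  let ?u = "gmult (gx 1) (gx 2) - gmult (gx 2) (gx 1)"
  have u: "?u \<in> carr (G d)" "?u = gpoly (br 1 2)"
    using 12 by (simp_all add: carr_diff carr_gmult carr_gx) (simp add: gmult_eq gpoly_diff)
  have "gscale c (gmult (gx 1) ?u) + gscale c' (gmult ?u (gx 1)) \<in> carr (G d)"
    using 12 u(1) by (intro carr_add carr_gscale carr_gmult carr_gx)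
  also have "gscale c (gmult (gx 1) ?u) + gscale c' (gmult ?u (gx 1)) =
      gpoly ((const c * yv 1 + const c' * zv 1) * br 1 2)"
    unfolding u(2) by (simp add: gmult_eq algebra_simps flip: gpoly_add)
  finally show ?thesis .
qed

lemma V_ideal_T_ideal: "d \<ge> 2 \<Longrightarrow> is_T_ideal (G d) (V_ideal d \<beta>)"
  unfolding V_ideal_def
  by (rule T_ideal_gen_is_T_ideal[OF T_ideal_carr]) (use bracket_gen_carr in blast)

section \<open>Polarization and substitution in T-ideals containing the identity\<close>

locale T_ideal_poly =
  fixes d :: nat and T :: "'k::field_char_0 gelem set"
  assumes T: "is_T_ideal (G d) T"
begin

abbreviation "P \<equiv> poly_part T"

sublocale D_closed P d
  by (rule GL_closed_D_closed[OF T_ideal_GL_closed[OF T]])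

lemma T_mult: "u \<in> T \<Longrightarrow> v \<in> carr (G d) \<Longrightarrow> gmult u v \<in> T"
    "u \<in> T \<Longrightarrow> v \<in> carr (G d) \<Longrightarrow> gmult v u \<in> T"
  using T by (auto simp: T_ideal_G)

lemma P_yv: "p \<in> P \<Longrightarrow> i \<in> {1..d} \<Longrightarrow> yv i * p \<in> P"
  using T_mult(2)[of "gpoly p" "gx i"] by (simp add: poly_part_iff gmult_eq carr_gx)

lemma P_zv: "p \<in> P \<Longrightarrow> i \<in> {1..d} \<Longrightarrow> zv i * p \<in> P"
  using T_mult(1)[of "gpoly p" "gx i"] by (simp add: poly_part_iff gmult_eq carr_gx mult.commute)

lemma P_mon:
  assumes "p \<in> P" "Poly_Mapping.keys a \<subseteq> {1..d}" "Poly_Mapping.keys b \<subseteq> {1..d}"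
  shows "p * mon a b \<in> P"
proof -
  have "mexp zv b * p \<in> P" if "Poly_Mapping.keys b \<subseteq> {1..d}" for b
    using that
  proof (induction b rule: expo_induct)
    case (add i b)
    then have "zv i * (mexp zv b * p) \<in> P"
      by (intro P_zv) (auto simp: keys_expo_add)
    then show ?case by (simp add: mexp_add mult.assoc)
  qed (use assms in simp)
  moreover have "mexp yv a * q \<in> P" if "Poly_Mapping.keys a \<subseteq> {1..d}" "q \<in> P" for a q
    using that
  proof (induction a rule: expo_induct)
    case (add i a)
    then have "yv i * (mexp yv a * q) \<in> P"
      by (intro P_yv) (auto simp: keys_expo_add)
    then show ?case by (simp add: mexp_add mult.assoc)
  qed simp
  ultimately have "mexp yv a * (mexp zv b * p) \<in> P"
    using assms by blast
  then show ?thesis by (simp add: mon_eq_mexp mult_ac)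
qed

lemma P_subst:
  assumes "p \<in> P" "\<And>i. i \<in> {1..d} \<Longrightarrow> u i \<in> carr (G d)"
  shows "subst const (\<lambda>i. Yof (u i)) (\<lambda>i. Zof (u i)) p \<in> P"
proof -
  have "ext_endo d u (gpoly p) \<in> T"
    using T assms(1) ext_endo_is_endo[of d u, OF assms(2)] unfolding T_ideal_G poly_part_iff by blast
  then show ?thesis by (simp add: poly_part_iff ext_endo_gpoly)
qed

context
  assumes d: "d \<ge> 2" and gen: "yv 1 * br 1 2 \<in> P"
begin

lemma identity:
  assumes "u \<in> carr (G d)" "v \<in> carr (G d)"
  shows "Yof u * (Yof u * Zof v - Yof v * Zof u) \<in> P"
  using P_subst[OF gen, of "\<lambda>i. if i = 1 then u else v"] assms by (simp add: subst_simps[OF const_hom])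

text \<open>For fixed \<open>v\<close> the identity is quadratic in \<open>u\<close>; this is its
  symmetric bilinear part.\<close>

lemma identity_polarized:
  assumes "u \<in> carr (G d)" "u' \<in> carr (G d)" "v \<in> carr (G d)"
  shows "Yof u * (Yof u' * Zof v - Yof v * Zof u') + Yof u' * (Yof u * Zof v - Yof v * Zof u) \<in> P"
proof -
  let ?f = "\<lambda>u. Yof u * (Yof u * Zof v - Yof v * Zof u)"
  have "?f (u + u') - ?f u - ?f u' \<in> P"
    using assms by (intro P_diff identity carr_add)
  then show ?thesis by (simp add: Yof_add Zof_add algebra_simps)
qed

text \<open>Subtract the polarized identity with i and j exchanged. With [i,j] for
  \<open>br i j\<close>, y_i [k,j] - y_j [k,i] equals y_k [i,j], and y_k [i,j] - y_k [j,i] adds two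
  more copies: hence the factor 3.\<close>

lemma swap:
  assumes "k \<in> {1..d}" "i \<in> {1..d}" "j \<in> {1..d}"
  shows "yv k * br i j \<in> P"
proof -
  have "(yv i * br k j + yv k * br i j) - (yv j * br k i + yv k * br j i) \<in> P"
    using identity_polarized[of "gx i" "gx k" "gx j"] identity_polarized[of "gx j" "gx k" "gx i"] assms
    by (intro P_diff) (auto simp: carr_gx)
  also have "(yv i * br k j + yv k * br i j) - (yv j * br k i + yv k * br j i) = of_nat 3 * (yv k * br i j :: 'k yzpoly)"
    by (simp add: algebra_simps)
  finally show ?thesis
    by (subst (asm) P_of_nat_iff) simp_all
qed

text \<open>The product x_j x_k is the polynomial y_j z_k on either side. Put for \<open>v\<close>
  in the polarized identity it gives y_j z_k (2 y_i y_l - y_i z_l - y_l z_i), and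
  \<open>swap\<close> trades y_l z_i for y_i z_l: hence the factor 2.\<close>

lemma y_to_z:
  assumes "i \<in> {1..d}" "j \<in> {1..d}" "k \<in> {1..d}" "l \<in> {1..d}"
  shows "yv i * yv j * zv k * (yv l - zv l) \<in> P"
proof -
  let ?Q = "yv j * zv k :: 'k yzpoly"
  have Q: "gpoly ?Q \<in> carr (G d)"
    using carr_gmult[OF carr_gx[of j d] carr_gx[of k d]] assms by (simp add: gmult_eq)
  have "(yv i * (yv l * ?Q - ?Q * zv l) + yv l * (yv i * ?Q - ?Q * zv i)) - zv k * (yv j * br i l) \<in> P"
    using identity_polarized[OF carr_gx carr_gx Q, of i l] swap[of j i l] assms by (intro P_diff P_zv) simp_all
  also have "(yv i * (yv l * ?Q - ?Q * zv l) + yv l * (yv i * ?Q - ?Q * zv i)) - zv k * (yv j * br i l) =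
      of_nat 2 * (yv i * yv j * zv k * (yv l - zv l))"
    by (simp add: algebra_simps)
  finally show ?thesis
    by (subst (asm) P_of_nat_iff) simp_all
qed

end

end

text \<open>\<open>M\<close> may not be closed under multiplication by generators; the cofactors in
  \<open>V1\<close> and \<open>V2\<close> are supplied inside the T-ideal \<open>V_ideal\<close>,
  which \<open>M\<close> contains.\<close>

lemma V_closed_of_GL_closed:
  fixes M :: "'k::field_char_0 gelem set"
  assumes d: "d \<ge> 2" and \<beta>: "\<beta>1 \<noteq> 0" and M: "GL_closed d M" "V_ideal d (\<beta>1, 0) \<subseteq> M"
  shows "V_closed (poly_part M) d"
proof -
  interpret V: T_ideal_poly d "V_ideal d (\<beta>1, 0 :: 'k)"
    by unfold_locales (rule V_ideal_T_ideal[OF d])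
  interpret D_closed "poly_part M" d
    by (rule GL_closed_D_closed[OF M(1)])
  have "gpoly (const \<beta>1 * (yv 1 * br 1 2)) \<in> V_ideal d (\<beta>1, 0)"
    using T_ideal_gen_superset[of "{gpoly ((const \<beta>1 * yv 1 + const 0 * zv 1) * br 1 2)}" "G d"]
    by (simp add: V_ideal_def mult.assoc)
  then have gen: "yv 1 * br 1 2 \<in> V.P"
    using V.P_scale_iff[OF \<beta>, of "yv 1 * br 1 2"] by (simp add: poly_part_iff)
  show ?thesis
  proof
    show "yv k * br i j * mon a b \<in> poly_part M"
      if "k \<in> {1..d}" "i \<in> {1..d}" "j \<in> {1..d}" "Poly_Mapping.keys a \<subseteq> {1..d}" "Poly_Mapping.keys b \<subseteq> {1..d}" for k i j a b
      using V.P_mon[OF V.swap[OF d gen that(1-3)] that(4,5)] M(2) unfolding poly_part_iff by blast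
    show "yv i * yv j * zv k * (yv l - zv l) * mon a b \<in> poly_part M"
      if "i \<in> {1..d}" "j \<in> {1..d}" "k \<in> {1..d}" "l \<in> {1..d}"
        "Poly_Mapping.keys a \<subseteq> {1..d}" "Poly_Mapping.keys b \<subseteq> {1..d}" for i j k l a b
      using V.P_mon[OF V.y_to_z[OF d gen that(1-4)] that(5,6)] M(2) unfolding poly_part_iff by blast
  qed
qed

section \<open>Two T-ideals\<close>

lemma gelem_eq_gpoly: "fst u = 0 \<Longrightarrow> u = gpoly (snd u)"
  by (simp add: gpoly_def prod_eq_iff)

definition merge_ideal :: "nat \<Rightarrow> 'k::field gelem set" where
  "merge_ideal d = {u \<in> carr (G d). fst u = 0 \<and> subst const yv yv (snd u) = 0}"

definition high_ideal :: "nat \<Rightarrow> 'k::field gelem set" where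
  "high_ideal d = {u \<in> carr (G d). fst u = 0 \<and> Poly_Mapping.keys (snd u) \<subseteq> Mons d 2 1}"

lemma merge_Yof_Zof: "subst const yv yv (Yof u) = subst const yv yv (Zof u)"
  by (simp add: Yof_def Zof_def yform_def zform_def subst_simps[OF const_hom])

lemma merge_ideal_T_ideal: "is_T_ideal (G d) (merge_ideal d :: 'k::field gelem set)"
  unfolding T_ideal_G
proof (intro conjI allI impI ballI)
  have "gscale c u \<in> merge_ideal d" if "u \<in> merge_ideal d" for c and u :: "'k gelem"
    using that carr_gscale[of u d c] by (simp add: merge_ideal_def gscale_eq subst_simps[OF const_hom])
  moreover have "u + v \<in> merge_ideal d" if "u \<in> merge_ideal d" "v \<in> merge_ideal d" for u v :: "'k gelem"
    using that carr_add[of u d v] by (simp add: merge_ideal_def subst_simps[OF const_hom])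
  moreover have "(0 :: 'k gelem) \<in> merge_ideal d"
    by (simp add: merge_ideal_def carr_zero subst_simps[OF const_hom])
  ultimately show "is_subspace (G d) (merge_ideal d :: 'k gelem set)"
    unfolding subspace_G by (intro conjI ballI allI) (auto simp: merge_ideal_def)
next
  fix u v :: "'k gelem" assume u: "u \<in> merge_ideal d" and v: "v \<in> carr (G d)"
  have "Yof u = snd u" "Zof u = snd u"
    using u gelem_eq_gpoly[of u] Yof_gpoly[of "snd u"] Zof_gpoly[of "snd u"] by (simp_all add: merge_ideal_def)
  then show "gmult u v \<in> merge_ideal d" "gmult v u \<in> merge_ideal d"
    using u v carr_gmult[of u d v] carr_gmult[of v d u]
    by (simp_all add: merge_ideal_def gmult_eq subst_simps[OF const_hom]) (simp_all add: gpoly_def subst_simps[OF const_hom])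
next
  fix \<phi> :: "'k gelem \<Rightarrow> 'k gelem" assume \<phi>: "is_endo (G d) \<phi>"
  show "\<phi> ` merge_ideal d \<subseteq> merge_ideal d"
  proof (rule image_subsetI)
    fix u :: "'k gelem" assume u: "u \<in> merge_ideal d"
    let ?\<Phi> = "subst const (\<lambda>i. Yof (\<phi> (gx i))) (\<lambda>i. Zof (\<phi> (gx i)))"
    let ?\<psi> = "\<lambda>i. subst const yv yv (Yof (\<phi> (gx i)))"
    have gp: "u = gpoly (snd u)" and carr: "u \<in> carr (G d)" and ker: "subst const yv yv (snd u) = 0"
      using u by (auto simp: merge_ideal_def intro: gelem_eq_gpoly)
    \<comment> \<open>As \<open>Yof\<close> and \<open>Zof\<close> of an image merge to the same
      polynomial, the endomorphism descends along merging to the substitution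
      \<open>?\<psi>\<close>; so it preserves the kernel.\<close>
    have "subst const yv yv (?\<Phi> p) = subst const ?\<psi> ?\<psi> (subst const yv yv p)" for p
      by (rule hom_eqI[where h = "\<lambda>p. subst const yv yv (?\<Phi> p)" and h' = "\<lambda>p. subst const ?\<psi> ?\<psi> (subst const yv yv p)"])
        (simp_all add: unital_hom_comp subst_hom[OF const_hom] subst_simps[OF const_hom] merge_Yof_Zof)
    then have "subst const yv yv (?\<Phi> (snd u)) = 0"
      by (simp add: ker subst_simps[OF const_hom])
    moreover have "\<phi> u = gpoly (?\<Phi> (snd u))"
      using endo_gpoly[OF \<phi>, of "snd u"] gp carr by simp
    ultimately show "\<phi> u \<in> merge_ideal d"
      using endo_closed[OF \<phi> carr] by (simp add: merge_ideal_def) (simp add: gpoly_def)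
  qed
qed

text \<open>A left factor adds y-degree, a right factor never lowers it, and an endomorphism
  replaces y_i by a polynomial all of whose terms have positive y-degree.\<close>

lemma high_ideal_T_ideal: "is_T_ideal (G d) (high_ideal d :: 'k::field gelem set)"
  unfolding T_ideal_G
proof (intro conjI allI impI ballI)
  have "gscale c u \<in> high_ideal d" if "u \<in> high_ideal d" for c and u :: "'k gelem"
    using that keys_const_mult[of c "snd u"] carr_gscale[of u d c]
    by (simp add: high_ideal_def gscale_eq subset_trans)
  moreover have "u + v \<in> high_ideal d" if "u \<in> high_ideal d" "v \<in> high_ideal d" for u v :: "'k gelem"
    using that carr_add[of u d v] keys_add_subsetI[of "snd u" _ "snd v"] by (simp add: high_ideal_def)
  moreover have "(0 :: 'k gelem) \<in> high_ideal d"
    by (simp add: high_ideal_def carr_zero)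
  ultimately show "is_subspace (G d) (high_ideal d :: 'k gelem set)"
    unfolding subspace_G by (intro conjI ballI allI) (auto simp: high_ideal_def)
next
  fix u v :: "'k gelem" assume u: "u \<in> high_ideal d" and v: "v \<in> carr (G d)"
  have Yu: "Yof u = snd u" and Zu: "Zof u = snd u"
    using u gelem_eq_gpoly[of u] Yof_gpoly[of "snd u"] Zof_gpoly[of "snd u"] by (simp_all add: high_ideal_def)
  have keys: "Poly_Mapping.keys (snd u) \<subseteq> Mons d 2 1"
    using u by (simp add: high_ideal_def)
  have "Poly_Mapping.keys (snd u * Zof v) \<subseteq> Mons d (2 + 0) (1 + 1)"
    by (rule keys_mult_subsetI[OF keys keys_Zof[OF v] Mons_add])
  also have "\<dots> \<subseteq> Mons d 2 1" by (rule Mons_mono) simp_all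
  finally show "gmult u v \<in> high_ideal d"
    using u v carr_gmult[of u d v] by (simp add: high_ideal_def gmult_eq Yu) (simp add: gpoly_def)
  have "Poly_Mapping.keys (Yof v * snd u) \<subseteq> Mons d (1 + 2) (0 + 1)"
    by (rule keys_mult_subsetI[OF keys_Yof[OF v] keys Mons_add])
  also have "\<dots> \<subseteq> Mons d 2 1" by (rule Mons_mono) simp_all
  finally show "gmult v u \<in> high_ideal d"
    using u v carr_gmult[of v d u] by (simp add: high_ideal_def gmult_eq Zu) (simp add: gpoly_def)
next
  fix \<phi> :: "'k gelem \<Rightarrow> 'k gelem" assume \<phi>: "is_endo (G d) \<phi>"
  show "\<phi> ` high_ideal d \<subseteq> high_ideal d"
  proof (rule image_subsetI)
    fix u :: "'k gelem" assume u: "u \<in> high_ideal d"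
    let ?\<Phi> = "subst const (\<lambda>i. Yof (\<phi> (gx i))) (\<lambda>i. Zof (\<phi> (gx i)))"
    have gp: "u = gpoly (snd u)" and carr: "u \<in> carr (G d)" and keys: "Poly_Mapping.keys (snd u) \<subseteq> Mons d 2 1"
      using u by (auto simp: high_ideal_def intro: gelem_eq_gpoly)
    have "Poly_Mapping.keys (?\<Phi> (snd u)) \<subseteq> Mons d 2 1"
      using keys by (intro Mons_subst endo_closed[OF \<phi>] carr_gx)
    moreover have "\<phi> u = gpoly (?\<Phi> (snd u))"
      using endo_gpoly[OF \<phi>, of "snd u"] gp carr by simp
    ultimately show "\<phi> u \<in> high_ideal d"
      using endo_closed[OF \<phi> carr] by (simp add: high_ideal_def) (simp add: gpoly_def)
  qed
qed

lemma V_ideal_subset_carr: "d \<ge> 2 \<Longrightarrow> V_ideal d \<beta> \<subseteq> carr (G d)"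
  using V_ideal_T_ideal unfolding T_ideal_G subspace_G by blast

lemma V_ideal_subset_merge: "d \<ge> 2 \<Longrightarrow> V_ideal d \<beta> \<subseteq> merge_ideal d"
  unfolding V_ideal_def
  by (intro T_ideal_gen_least merge_ideal_T_ideal)
    (auto simp: merge_ideal_def bracket_gen_carr, simp_all add: gpoly_def subst_simps[OF const_hom])

text \<open>The second coefficient of the identity being 0 is decisive here: z_1 times the bracket
  would have y-degree 1.\<close>

lemma V_ideal_subset_high: 
  assumes "d \<ge> 2"
  shows "V_ideal d (\<beta>1, 0) \<subseteq> high_ideal d"
  unfolding V_ideal_def
proof (intro T_ideal_gen_least high_ideal_T_ideal)
  have "yv 1 * br 1 2 = (mon (ex 1 + ex 1) (ex 2) - mon (ex 1 + ex 2) (ex 1) :: 'a yzpoly)"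
    by (simp add: yv_eq_mon zv_eq_mon mon_mult right_diff_distrib)
  then have "Poly_Mapping.keys (yv 1 * br 1 2 :: 'a yzpoly) \<subseteq> {(ex 1 + ex 1, ex 2), (ex 1 + ex 2, ex 1)}"
    using keys_diff[of "mon (ex 1 + ex 1) (ex 2) :: 'a yzpoly" "mon (ex 1 + ex 2) (ex 1)"] by auto
  also have "\<dots> \<subseteq> Mons d 2 1"
    using assms by (auto simp: Mons_def keys_expo_add)
  finally have "Poly_Mapping.keys (const \<beta>1 * (yv 1 * br 1 2)) \<subseteq> Mons d 2 1"
    using keys_const_mult by blast
  then show "{gpoly ((const (fst (\<beta>1, 0)) * yv 1 + const (snd (\<beta>1, 0)) * zv 1) * br 1 2)} \<subseteq> high_ideal d"
    using bracket_gen_carr[OF assms, of \<beta>1 0] by (simp add: high_ideal_def gpoly_def mult.assoc)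
qed

section \<open>The list of consequences\<close>

lemma w1_eq: "w1 n j = gpoly (yv 1 ^ j * zv 1 ^ (n - j))"
  and w2_eq: "w2 n 1 0 = gpoly (br 1 2 * zv 1 ^ (n - 1))"
  by (simp_all add: w1_def w2_def)

lemma G_comp_mon:
  "(a, b) \<in> Mons d 1 1 \<Longrightarrow> expo_deg a + expo_deg b = n \<Longrightarrow> gpoly (mon a b) \<in> G_comp d n"
  by (simp add: G_comp_iff carr_gpoly) (simp add: gpoly_def)

lemma w1_G_comp: "d \<ge> 1 \<Longrightarrow> 1 \<le> j \<Longrightarrow> j < n \<Longrightarrow> w1 n j \<in> G_comp d n"
  unfolding w1_eq yv_power_zv_power by (intro G_comp_mon) (auto simp: Mons_def)

lemma w2_G_comp:
  assumes "d \<ge> 2" "n \<ge> 1"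
  shows "(w2 n 1 0 :: 'k::field gelem) \<in> G_comp d (n + 1)"
proof -
  have "zv 1 ^ (n - 1) = (mon 0 (Poly_Mapping.single 1 (n - 1)) :: 'k yzpoly)"
    using yv_power_zv_power[of 0 "n - 1", where 'a = 'k] by simp
  then have "(w2 n 1 0 :: 'k gelem) = gpoly (mon (ex 1) (ex 2 + Poly_Mapping.single 1 (n - 1))) -
      gpoly (mon (ex 2) (ex 1 + Poly_Mapping.single 1 (n - 1)))"
    by (simp add: w2_eq left_diff_distrib mult.assoc yv_mon zv_mon gpoly_diff)
  also have "\<dots> \<in> G_comp d (n + 1)"
    using assms by (intro subspace_diff[OF G_comp_subspace] G_comp_mon) (auto simp: Mons_def keys_expo_add)
  finally show ?thesis .
qed

section \<open>Upper bounds for the consequences\<close>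

context
  fixes d :: nat and \<beta>1 :: "'k::field_char_0"
  assumes d: "d \<ge> 2" and \<beta>1: "\<beta>1 \<noteq> 0"
begin

text \<open>The guard on the first generator is for N = 2, where \<open>w1 N 2\<close> would be
  y_1^2, which is not in G_d; every monomial of that degree has y-degree 1.\<close>

lemma upper_all:
  assumes M: "GL_closed d M" "V_ideal d (\<beta>1, 0) \<subseteq> M" and N: "N = m + 2"
    and w: "m \<ge> 1 \<Longrightarrow> w1 N 2 \<in> M" "w1 N 1 \<in> M" "w2 (N - 1) 1 0 \<in> M"
  shows "G_comp d N \<subseteq> M"
proof
  interpret V_closed "poly_part M" d
    by (rule V_closed_of_GL_closed[OF d \<beta>1 M])
  fix u :: "'k gelem" assume "u \<in> G_comp d N"
  then have u: "u \<in> carr (G d)" "u = gpoly (snd u)" and deg: "Poly_Mapping.keys (snd u) \<subseteq> {(a, b). expo_deg a + expo_deg b = N}"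
    using N by (auto simp: G_comp_iff intro: gelem_eq_gpoly)
  have "snd u \<in> poly_part M"
  proof (rule mem_of_monomials)
    fix a b assume "(a, b) \<in> Poly_Mapping.keys (snd u)"
    then have ab: "(a, b) \<in> Mons d 1 1" "expo_deg a + expo_deg b = N"
      using carrD(2)[OF u(1)] deg by auto
    show "mon a b \<in> poly_part M"
    proof (cases "expo_deg a = 1")
      case True
      then show ?thesis
        using w(2,3) ab d by (intro low_generated[where m = m]) (simp_all add: poly_part_iff w1_eq w2_eq N power_add mult_ac)
    next
      case False
      then have "(a, b) \<in> Mons d 2 1" "m \<ge> 1" using ab N by (auto simp: Mons_def)
      then show ?thesis
        using w(1) ab d by (intro high_generated[where N = N]) (simp_all add: poly_part_iff w1_eq N)
    qed
  qed
  then show "u \<in> M" using u(2) by (metis poly_part_iff)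
qed

lemma upper_merge:
  assumes M: "GL_closed d M" "V_ideal d (\<beta>1, 0) \<subseteq> M" and N: "N = m + 2" "m \<ge> 1"
    and w: "w1 N 2 - w1 N 1 \<in> M" "w2 (N - 1) 1 0 \<in> M"
  shows "merge_ideal d \<inter> G_comp d N \<subseteq> M"
proof
  interpret V_closed "poly_part M" d
    by (rule V_closed_of_GL_closed[OF d \<beta>1 M])
  fix u :: "'k gelem" assume u: "u \<in> merge_ideal d \<inter> G_comp d N"
  then have "u \<in> carr (G d)" "u = gpoly (snd u)"
    by (auto simp: merge_ideal_def intro: gelem_eq_gpoly)
  moreover have "snd u \<in> poly_part M"
  proof (rule kernel_generated[OF d N])
    show "yv 1 ^ 2 * zv 1 ^ m - yv 1 * zv 1 ^ (m + 1) \<in> poly_part M" "br 1 2 * zv 1 ^ m \<in> poly_part M"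
      using w by (simp_all add: poly_part_iff w1_eq w2_eq N gpoly_diff power_add mult_ac)
    show "Poly_Mapping.keys (snd u) \<subseteq> Mons d 1 1"
      by (rule carrD(2)[OF calculation(1)])
  qed (use u in \<open>auto simp: merge_ideal_def G_comp_iff\<close>)
  ultimately show "u \<in> M" by (metis poly_part_iff)
qed

lemma upper_high:
  assumes M: "GL_closed d M" "V_ideal d (\<beta>1, 0) \<subseteq> M" and N: "N \<ge> 3" and w: "w1 N 2 \<in> M"
  shows "high_ideal d \<inter> G_comp d N \<subseteq> M"
proof
  interpret V_closed "poly_part M" d
    by (rule V_closed_of_GL_closed[OF d \<beta>1 M])
  fix u :: "'k gelem" assume u: "u \<in> high_ideal d \<inter> G_comp d N"
  then have "u = gpoly (snd u)"
    by (auto simp: high_ideal_def intro: gelem_eq_gpoly)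
  moreover have "snd u \<in> poly_part M"
  proof (rule mem_of_monomials)
    fix a b assume "(a, b) \<in> Poly_Mapping.keys (snd u)"
    then have "(a, b) \<in> Mons d 2 1" "expo_deg a + expo_deg b = N"
      using u by (auto simp: high_ideal_def G_comp_iff)
    then show "mon a b \<in> poly_part M"
      using w d N by (intro high_generated[where N = N]) (simp_all add: poly_part_iff w1_eq)
  qed
  ultimately show "u \<in> M" by (metis poly_part_iff)
qed

end

section \<open>Lower bounds: the lists inside the T-ideals\<close>

locale T_ideal_V = T_ideal_poly d T for d :: nat and T :: "'k::field_char_0 gelem set" +
  fixes \<beta>1 :: 'k
  assumes d: "d \<ge> 2" and \<beta>1: "\<beta>1 \<noteq> 0" and V: "V_ideal d (\<beta>1, 0) \<subseteq> T"
begin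

sublocale V_closed P d
  by (rule V_closed_of_GL_closed[OF d \<beta>1 T_ideal_GL_closed[OF T] V])

lemma one_two: "1 \<in> {1..d}" "2 \<in> {1..d}"
  using d by auto

lemma lower_gx:
  assumes "gx 1 \<in> T"
  shows "{w1 2 1, w2 1 1 0} \<subseteq> T"
proof -
  have "gmult (gx 1) (gx 1) \<in> T" "gmult (gx 1) (gx 2) \<in> T" "gmult (gx 2) (gx 1) \<in> T"
    using assms one_two by (simp_all add: T_mult carr_gx)
  then have "yv 1 * zv 1 \<in> P" "br 1 2 \<in> P"
    by (auto intro: P_diff simp: gmult_eq poly_part_iff[symmetric])
  then show ?thesis
    by (simp add: w1_eq w2_eq poly_part_iff)
qed

lemma lower_square:
  assumes "w1 2 1 \<in> T"
  shows "{w1 3 2, w1 3 1, w2 2 1 0} \<subseteq> T"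
proof -
  have p: "yv 1 * zv 1 \<in> P" using assms by (simp add: w1_eq poly_part_iff)
  have y: "yv 1 * (yv 1 * zv 1) \<in> P" and z: "zv 1 * (yv 1 * zv 1) \<in> P" and z2: "zv 2 * (yv 1 * zv 1) \<in> P"
    using p one_two by (simp_all add: P_yv P_zv)
  have "zv 1 * dyz 1 2 (yv 1 * zv 1) \<in> P"
    using p one_two by (intro P_zv P_dyz) auto
  \<comment> \<open>The derivative is the symmetric y_2 z_1 + y_1 z_2; subtracting z_1 times it from
    2 z_2 y_1 z_1 leaves z_1 times the antisymmetric combination.\<close>
  then have "const 2 * (zv 2 * (yv 1 * zv 1)) - zv 1 * dyz 1 2 (yv 1 * zv 1) \<in> P"
    by (intro P_diff P_scale z2)
  also have "const 2 * (zv 2 * (yv 1 * zv 1)) - zv 1 * dyz 1 2 (yv 1 * zv 1) = (br 1 2 * zv 1 :: 'k yzpoly)"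
    by (simp add: dyz_simps algebra_simps)
  finally show ?thesis
    using y z by (simp add: w1_eq w2_eq power2_eq_square mult_ac poly_part_iff)
qed

lemma lower_bracket:
  assumes "n \<ge> 2" "w2 (n - 1) 1 0 \<in> T"
  shows "{w1 (n + 1) 2 - w1 (n + 1) 1, w2 n 1 0} \<subseteq> T"
proof -
  define m where "m = n - 2"
  have n: "n = m + 2" using assms(1) by (simp add: m_def)
  have p: "br 1 2 * zv 1 ^ m \<in> P"
    using assms(2) by (simp add: w2_eq n poly_part_iff)
  have "zv 1 * (br 1 2 * zv 1 ^ m) \<in> P"
    using p one_two by (intro P_zv)
  moreover have yz: "gpoly (yv 1 * zv 1) \<in> carr (G d)"
    using one_two carr_gmult[OF carr_gx[of 1 d] carr_gx[of 1 d]] by (simp add: gmult_eq)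
  \<comment> \<open>Substituting x_1 x_1 for x_2 turns the bracket into y_1^2 z_1 - y_1 z_1^2 and
    raises the degree by one.\<close>
  have "subst const (\<lambda>i. Yof (if i = 1 then gx 1 else gpoly (yv 1 * zv 1)))
      (\<lambda>i. Zof (if i = 1 then gx 1 else gpoly (yv 1 * zv 1))) (br 1 2 * zv 1 ^ m) \<in> P"
    using one_two yz by (intro P_subst[OF p]) (auto intro: carr_gx)
  then have "(yv 1 * (yv 1 * zv 1) - (yv 1 * zv 1) * zv 1) * zv 1 ^ m \<in> P"
    by (simp add: subst_simps[OF const_hom])
  ultimately show ?thesis
    by (simp add: w1_eq w2_eq n power2_eq_square algebra_simps poly_part_iff power_add flip: gpoly_diff)
qed

lemma lower_power_bracket:
  assumes n: "n \<ge> 3" and \<gamma>2: "\<gamma>2 \<noteq> 0"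
    and f: "const \<gamma>1 * (yv 1 ^ 2 * zv 1 ^ (n - 2)) + const \<gamma>2 * (yv 1 * zv 1 ^ (n - 1)) \<in> P"
  shows "br 1 2 * zv 1 ^ (n - 1) \<in> P"
proof -
  define m where "m = n - 3"
  have n': "n = m + 3" using n by (simp add: m_def)
  have nn: "n - 1 = Suc (Suc m)" "n - 2 = Suc m" by (simp_all add: n')
  let ?f = "const \<gamma>1 * (yv 1 ^ 2 * zv 1 ^ Suc m) + const \<gamma>2 * (yv 1 * zv 1 ^ Suc (Suc m)) :: 'k yzpoly"
  \<comment> \<open>With D the derivation x_1 -> x_2, the operator z_1 D - n z_2 maps y_1^j
    z_1^(n-j) to -j y_1^(j-1) z_1^(n-j) times the bracket. For j = 2 the result is cancelled by the
    last summand, which \<open>V1\<close> provides; j = 1 leaves the wanted polynomial with factor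
    -gamma_2.\<close>
  let ?g = "zv 1 * dyz 1 2 ?f - const (of_nat n) * (zv 2 * ?f) + const (2 * \<gamma>1) * (yv 1 * br 1 2 * zv 1 ^ Suc m)"
  have swap: "yv 1 * br 1 2 * zv 1 ^ Suc m \<in> P"
    using V1[of 1 1 2 0 "Poly_Mapping.single 1 (Suc m)"] one_two yv_power_zv_power[of 0 "Suc m", where 'a = 'k]
    by (simp del: power_Suc)
  have "?f \<in> P" using f by (simp only: nn)
  then have "?g \<in> P"
    using one_two by (intro P_add[OF P_diff P_scale[OF swap]] P_scale P_zv P_dyz) auto
  also have "?g = const (- \<gamma>2) * (br 1 2 * zv 1 ^ Suc (Suc m))"
  proof -
    have "dyz 1 2 (zv 1 ^ Suc k) = (of_nat (Suc k) * zv 1 ^ k * zv 2 :: 'k yzpoly)" for k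
      by (simp only: dyz_power) (simp add: dyz_zv)
    then have "dyz 1 2 ?f = const \<gamma>1 * (2 * yv 1 * yv 2 * zv 1 ^ Suc m + yv 1 ^ 2 * (of_nat (Suc m) * zv 1 ^ m * zv 2)) +
        const \<gamma>2 * (yv 2 * zv 1 ^ Suc (Suc m) + yv 1 * (of_nat (Suc (Suc m)) * zv 1 ^ Suc m * zv 2))"
      by (simp add: dyz_mult dyz_add dyz_yv power2_eq_square algebra_simps del: power_Suc of_nat_Suc)
    then show ?thesis
      unfolding const_of_nat by (simp add: n' const_mult const_uminus power2_eq_square algebra_simps)
  qed
  finally have "const (- \<gamma>2) * (br 1 2 * zv 1 ^ (n - 1)) \<in> P"
    by (simp only: nn)
  then show ?thesis
    using \<gamma>2 by (subst (asm) P_scale_iff) simp_all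
qed

text \<open>Modulo the identity y_1^3 z_1^(n-2) and y_1^2 z_1^(n-1) agree, so y_1 f reduces to
  (gamma_1 + gamma_2) w_(n+1)^(2); after that z_1 f yields gamma_2 w_(n+1)^(1). Both factors get
  inverted.\<close>

lemma lower_generic:
  assumes n: "n \<ge> 3" and \<gamma>: "(\<gamma>1 + \<gamma>2) * \<gamma>2 \<noteq> 0"
    and f: "gscale \<gamma>1 (w1 n 2) + gscale \<gamma>2 (w1 n 1) \<in> T"
  shows "{w1 (n + 1) 2, w1 (n + 1) 1, w2 n 1 0} \<subseteq> T"
proof -
  define m where "m = n - 3"
  have n': "n = m + 3" using n by (simp add: m_def)
  have nn: "n - 1 = Suc (Suc m)" "n - 2 = Suc m" "n + 1 - 2 = Suc (Suc m)" "n + 1 - 1 = Suc (Suc (Suc m))"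
    by (simp_all add: n')
  let ?f = "const \<gamma>1 * (yv 1 ^ 2 * zv 1 ^ Suc m) + const \<gamma>2 * (yv 1 * zv 1 ^ Suc (Suc m)) :: 'k yzpoly"
  have fP: "?f \<in> P"
    using f by (simp add: poly_part_iff w1_eq nn gpoly_add)
  have br: "br 1 2 * zv 1 ^ (n - 1) \<in> P"
    using fP \<gamma> by (intro lower_power_bracket[OF n, of \<gamma>2 \<gamma>1]) (auto simp only: nn power_one_right mult_zero_right)
  have "yv 1 * yv 1 * zv 1 * (yv 1 - zv 1) * mon 0 (Poly_Mapping.single 1 m) \<in> P"
    using one_two by (intro V2) auto
  then have "yv 1 * ?f - const \<gamma>1 * (yv 1 * yv 1 * zv 1 * (yv 1 - zv 1) * zv 1 ^ m) \<in> P"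
    using fP one_two yv_power_zv_power[of 0 m, where 'a = 'k] by (intro P_diff P_yv P_scale) simp_all
  also have "yv 1 * ?f - const \<gamma>1 * (yv 1 * yv 1 * zv 1 * (yv 1 - zv 1) * zv 1 ^ m) =
      const (\<gamma>1 + \<gamma>2) * (yv 1 ^ 2 * zv 1 ^ Suc (Suc m))"
    by (simp add: const_add power2_eq_square algebra_simps)
  finally have w2: "yv 1 ^ 2 * zv 1 ^ Suc (Suc m) \<in> P"
    using \<gamma> by (subst (asm) P_scale_iff) auto
  have "zv 1 * ?f - const \<gamma>1 * (yv 1 ^ 2 * zv 1 ^ Suc (Suc m)) \<in> P"
    using fP w2 one_two by (intro P_diff P_zv P_scale)
  also have "zv 1 * ?f - const \<gamma>1 * (yv 1 ^ 2 * zv 1 ^ Suc (Suc m)) = const \<gamma>2 * (yv 1 * zv 1 ^ Suc (Suc (Suc m)))"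
    by (simp add: algebra_simps)
  finally have "yv 1 * zv 1 ^ Suc (Suc (Suc m)) \<in> P"
    using \<gamma> by (subst (asm) P_scale_iff) auto
  have w: "w1 (n + 1) 2 = gpoly (yv 1 ^ 2 * zv 1 ^ Suc (Suc m))" "w1 (n + 1) 1 = gpoly (yv 1 * zv 1 ^ Suc (Suc (Suc m)))"
    by (simp_all only: w1_eq nn power_one_right)
  show ?thesis
    using w2 br \<open>yv 1 * zv 1 ^ Suc (Suc (Suc m)) \<in> P\<close> by (simp only: w w2_eq poly_part_iff insert_subset empty_subsetI)
qed

lemma lower_difference:
  assumes n: "n \<ge> 3" and f: "w1 n 2 - w1 n 1 \<in> T"
  shows "{w1 (n + 1) 2 - w1 (n + 1) 1, w2 n 1 0} \<subseteq> T"
proof -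
  define m where "m = n - 3"
  have n': "n = m + 3" using n by (simp add: m_def)
  have nn: "n - 1 = Suc (Suc m)" "n - 2 = Suc m" "n + 1 - 2 = Suc (Suc m)" "n + 1 - 1 = Suc (Suc (Suc m))"
    by (simp_all add: n')
  have fP: "yv 1 ^ 2 * zv 1 ^ Suc m - yv 1 * zv 1 ^ Suc (Suc m) \<in> P"
    using f by (simp add: poly_part_iff w1_eq nn gpoly_diff)
  have "br 1 2 * zv 1 ^ (n - 1) \<in> P"
    by (rule lower_power_bracket[OF n, of "- 1" 1]) (use fP in \<open>simp_all add: nn const_uminus\<close>)
  moreover have "zv 1 * (yv 1 ^ 2 * zv 1 ^ Suc m - yv 1 * zv 1 ^ Suc (Suc m)) \<in> P"
    using fP one_two by (intro P_zv)
  then have "yv 1 ^ 2 * zv 1 ^ Suc (Suc m) - yv 1 * zv 1 ^ Suc (Suc (Suc m)) \<in> P"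
    by (simp add: algebra_simps)
  moreover have w: "w1 (n + 1) 2 = gpoly (yv 1 ^ 2 * zv 1 ^ Suc (Suc m))" "w1 (n + 1) 1 = gpoly (yv 1 * zv 1 ^ Suc (Suc (Suc m)))"
    by (simp_all only: w1_eq nn power_one_right)
  ultimately show ?thesis
    by (simp only: w w2_eq poly_part_iff gpoly_diff[symmetric] insert_subset empty_subsetI)
qed

lemma lower_high:
  assumes n: "n \<ge> 3" and f: "w1 n 2 \<in> T"
  shows "{w1 (n + 1) 2} \<subseteq> T"
proof -
  have "zv 1 * (yv 1 ^ 2 * zv 1 ^ (n - 2)) \<in> P"
    using f one_two by (intro P_zv) (simp_all add: poly_part_iff w1_eq)
  moreover have "n + 1 - 2 = Suc (n - 2)" using n by simp
  ultimately show ?thesis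
    by (simp add: w1_eq poly_part_iff mult_ac)
qed

end

theorem theorem4p8:
  fixes d :: nat and \<beta>1 \<beta>2 :: "'k::field_char_0"
  assumes "d \<ge> 2" and "\<beta>2 = 0" and "\<beta>1 \<noteq> 0"
  shows
    "conseq_equiv d (\<beta>1, \<beta>2) 1 (gx 1) {w1 2 1, w2 1 1 0} \<and>
     conseq_equiv d (\<beta>1, \<beta>2) 2 (w1 2 1) {w1 3 2, w1 3 1, w2 2 1 0} \<and>
     conseq_equiv d (\<beta>1, \<beta>2) 2 (w2 1 1 0) {w1 3 2 - w1 3 1, w2 2 1 0} \<and>
     (\<forall>n\<ge>3. \<forall>\<gamma>1 \<gamma>2. (\<gamma>1 + \<gamma>2) * \<gamma>2 \<noteq> 0 \<longrightarrow>
        conseq_equiv d (\<beta>1, \<beta>2) n (gscale \<gamma>1 (w1 n 2) + gscale \<gamma>2 (w1 n 1))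
          {w1 (n + 1) 2, w1 (n + 1) 1, w2 n 1 0}) \<and>
     (\<forall>n\<ge>3. conseq_equiv d (\<beta>1, \<beta>2) n (w1 n 2 - w1 n 1)
          {w1 (n + 1) 2 - w1 (n + 1) 1, w2 n 1 0}) \<and>
     (\<forall>n\<ge>3. conseq_equiv d (\<beta>1, \<beta>2) n (w1 n 2) {w1 (n + 1) 2}) \<and>
     (\<forall>n\<ge>3. conseq_equiv d (\<beta>1, \<beta>2) n (w2 (n - 1) 1 0)
          {w1 (n + 1) 2 - w1 (n + 1) 1, w2 n 1 0})"
proof -
  note d = assms(1)
  have d1: "d \<ge> 1" using d by simp
  have V: "is_T_ideal (G d) (V_ideal d (\<beta>1, 0))"
    by (rule V_ideal_T_ideal[OF d])
  have loc: "T_ideal_V d T \<beta>1" if "is_T_ideal (G d) T" "V_ideal d (\<beta>1, 0) \<subseteq> T" for T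
    using that assms by unfold_locales
  note upper_all' = upper_all[OF d assms(3)] and upper_merge' = upper_merge[OF d assms(3)]
    and upper_high' = upper_high[OF d assms(3)]
  note sub = V_ideal_subset_carr[OF d] V_ideal_subset_merge[OF d] V_ideal_subset_high[OF d]
  note comp_diff = subspace_diff[OF G_comp_subspace]
  have comp_carr: "(G_comp d n :: 'k gelem set) \<subseteq> carr (G d)" for n
    using G_comp_subspace[of d n, where 'a = 'k] by (simp add: subspace_G)
  have w2_comp: "(w2 (n - 1) 1 0 :: 'k gelem) \<in> G_comp d n" if "n \<ge> 2" for n
    using w2_G_comp[OF d, of "n - 1", where 'k = 'k] that by simp
  have merge_diff: "(w1 n 2 - w1 n 1 :: 'k gelem) \<in> merge_ideal d" if "n \<ge> 3" for n
  proof -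
    have "(w1 n 2 - w1 n 1 :: 'k gelem) \<in> carr (G d)"
      using that d1 by (intro subsetD[OF comp_carr[of n]] comp_diff w1_G_comp) auto
    moreover have "yv 1 ^ 2 * yv 1 ^ (n - 2) = (yv 1 * yv 1 ^ (n - 1) :: 'k yzpoly)"
    proof -
      have "2 + (n - 2) = 1 + (n - 1)" using that by simp
      then show ?thesis by (metis power_add power_one_right)
    qed
    ultimately show ?thesis
      by (simp add: merge_ideal_def w1_eq subst_simps[OF const_hom] gpoly_def)
  qed
  have merge_w2: "(w2 (n - 1) 1 0 :: 'k gelem) \<in> merge_ideal d" if "n \<ge> 2" for n
    using subsetD[OF comp_carr w2_comp[OF that]]
    by (simp add: merge_ideal_def w2_eq subst_simps[OF const_hom] gpoly_def)
  \<comment> \<open>Separate from the scheme \<open>all\<close> below, since degree 2 has no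
    w^(2).\<close>
  have 1: "conseq_equiv d (\<beta>1, 0) 1 (gx 1) {w1 2 1, w2 1 1 0}"
  proof (rule conseq_equivI[OF V _ _ _ T_ideal_carr sub(1)])
    show "gx 1 \<in> carr (G d)" using d1 by (simp add: carr_gx)
    then show "gx 1 \<in> G_comp d 1" by (simp add: G_comp_iff gx_def)
    show "{w1 2 1, w2 1 1 0} \<subseteq> G_comp d (1 + 1)"
      using w1_G_comp[OF d1, of 1 2] w2_G_comp[OF d, of 1] by simp
    show "{w1 2 1, w2 1 1 0} \<subseteq> T" if "is_T_ideal (G d) T" "V_ideal d (\<beta>1, 0) \<subseteq> T" "gx 1 \<in> T" for T
      by (rule T_ideal_V.lower_gx[OF loc[OF that(1,2)] that(3)])
    show "carr (G d) \<inter> G_comp d (1 + 1) \<subseteq> M"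
      if "GL_closed d M" "V_ideal d (\<beta>1, 0) \<subseteq> M" "{w1 2 1, w2 1 1 0} \<subseteq> M" for M
      using upper_all'[OF that(1,2), of 2 0] that(3) by (auto simp: One_nat_def numeral_2_eq_2)
  qed
  \<comment> \<open>Scheme for (ii) and (iv): the bounding T-ideal is G_d itself, so the
    consequences fill the whole component of degree n+1.\<close>
  have all: "conseq_equiv d (\<beta>1, 0) n f {w1 (n + 1) 2, w1 (n + 1) 1, w2 n 1 0}"
    if n: "n \<ge> 2" and f: "f \<in> G_comp d n"
      and lower: "\<And>T. T_ideal_V d T \<beta>1 \<Longrightarrow> f \<in> T \<Longrightarrow> {w1 (n + 1) 2, w1 (n + 1) 1, w2 n 1 0} \<subseteq> T" for n f
  proof (rule conseq_equivI[OF V f _ _ T_ideal_carr sub(1)])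
    show "f \<in> carr (G d)" using f comp_carr by blast
    show "{w1 (n + 1) 2, w1 (n + 1) 1, w2 n 1 0} \<subseteq> G_comp d (n + 1)"
      using n w1_G_comp[OF d1, of 2 "n + 1"] w1_G_comp[OF d1, of 1 "n + 1"] w2_G_comp[OF d, of n] by simp
    show "{w1 (n + 1) 2, w1 (n + 1) 1, w2 n 1 0} \<subseteq> T"
      if "is_T_ideal (G d) T" "V_ideal d (\<beta>1, 0) \<subseteq> T" "f \<in> T" for T
      by (rule lower[OF loc[OF that(1,2)] that(3)])
    show "carr (G d) \<inter> G_comp d (n + 1) \<subseteq> M"
      if "GL_closed d M" "V_ideal d (\<beta>1, 0) \<subseteq> M" "{w1 (n + 1) 2, w1 (n + 1) 1, w2 n 1 0} \<subseteq> M" for M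
      using upper_all'[OF that(1,2), of "n + 1" "n - 1"] that(3) n by auto
  qed
  \<comment> \<open>Scheme for (iii), (v) and (vii): w^(2) - w^(1) and the bracket both vanish under
    merging, and either one generates the whole kernel in degree n+1.\<close>
  have merge: "conseq_equiv d (\<beta>1, 0) n f {w1 (n + 1) 2 - w1 (n + 1) 1, w2 n 1 0}"
    if n: "n \<ge> 2" and f: "f \<in> G_comp d n" "f \<in> merge_ideal d"
      and lower: "\<And>T. T_ideal_V d T \<beta>1 \<Longrightarrow> f \<in> T \<Longrightarrow> {w1 (n + 1) 2 - w1 (n + 1) 1, w2 n 1 0} \<subseteq> T" for n f
  proof (rule conseq_equivI[OF V f(1) _ _ merge_ideal_T_ideal sub(2) f(2)])
    show "{w1 (n + 1) 2 - w1 (n + 1) 1, w2 n 1 0} \<subseteq> G_comp d (n + 1)"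
      using n by (intro insert_subsetI comp_diff w1_G_comp w2_G_comp d d1 empty_subsetI) auto
    show "{w1 (n + 1) 2 - w1 (n + 1) 1, w2 n 1 0} \<subseteq> T"
      if "is_T_ideal (G d) T" "V_ideal d (\<beta>1, 0) \<subseteq> T" "f \<in> T" for T
      by (rule lower[OF loc[OF that(1,2)] that(3)])
    show "merge_ideal d \<inter> G_comp d (n + 1) \<subseteq> M"
      if "GL_closed d M" "V_ideal d (\<beta>1, 0) \<subseteq> M" "{w1 (n + 1) 2 - w1 (n + 1) 1, w2 n 1 0} \<subseteq> M" for M
      using upper_merge'[OF that(1,2), of "n + 1" "n - 1"] that(3) n by auto
  qed
  have num: "2 + 1 = (3::nat)" "2 - 1 = (1::nat)" by simp_all
  have 2: "conseq_equiv d (\<beta>1, 0) 2 (w1 2 1) {w1 3 2, w1 3 1, w2 2 1 0}"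
  proof (rule all[of 2 "w1 2 1", unfolded num])
    show "{w1 3 2, w1 3 1, w2 2 1 0} \<subseteq> T" if "T_ideal_V d T \<beta>1" "w1 2 1 \<in> T" for T
      using that by (rule T_ideal_V.lower_square)
  qed (simp_all add: w1_G_comp[OF d1])
  have 3: "conseq_equiv d (\<beta>1, 0) 2 (w2 1 1 0) {w1 3 2 - w1 3 1, w2 2 1 0}"
  proof (rule merge[of 2 "w2 1 1 0", unfolded num])
    show "{w1 3 2 - w1 3 1, w2 2 1 0} \<subseteq> T" if "T_ideal_V d T \<beta>1" "w2 1 1 0 \<in> T" for T
      using T_ideal_V.lower_bracket[OF that(1), of 2, unfolded num] that(2) by blast
  qed (use w2_comp[of 2, unfolded num] merge_w2[of 2, unfolded num] in simp_all)
  have 4: "conseq_equiv d (\<beta>1, 0) n (gscale \<gamma>1 (w1 n 2) + gscale \<gamma>2 (w1 n 1))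
      {w1 (n + 1) 2, w1 (n + 1) 1, w2 n 1 0}" if "n \<ge> 3" "(\<gamma>1 + \<gamma>2) * \<gamma>2 \<noteq> 0" for n \<gamma>1 \<gamma>2
  proof (rule all)
    show "gscale \<gamma>1 (w1 n 2) + gscale \<gamma>2 (w1 n 1) \<in> G_comp d n"
      using G_comp_subspace[of d n, where 'a = 'k] w1_G_comp[OF d1, of 2 n, where 'a = 'k]
        w1_G_comp[OF d1, of 1 n, where 'a = 'k] that(1) unfolding subspace_G by simp
    show "{w1 (n + 1) 2, w1 (n + 1) 1, w2 n 1 0} \<subseteq> T"
      if "T_ideal_V d T \<beta>1" "gscale \<gamma>1 (w1 n 2) + gscale \<gamma>2 (w1 n 1) \<in> T" for T
      by (rule T_ideal_V.lower_generic[OF that(1) \<open>n \<ge> 3\<close> \<open>(\<gamma>1 + \<gamma>2) * \<gamma>2 \<noteq> 0\<close> that(2)])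
  qed (use that(1) in simp)
  have 5: "conseq_equiv d (\<beta>1, 0) n (w1 n 2 - w1 n 1) {w1 (n + 1) 2 - w1 (n + 1) 1, w2 n 1 0}" if "n \<ge> 3" for n
    using that by (intro merge comp_diff w1_G_comp d1 merge_diff T_ideal_V.lower_difference) auto
  \<comment> \<open>All consequences keep y-degree at least 2, and there content alone decides, so a
    single generator suffices.\<close>
  have 6: "conseq_equiv d (\<beta>1, 0) n (w1 n 2) {w1 (n + 1) 2}" if n: "n \<ge> 3" for n
  proof (rule conseq_equivI[OF V _ _ _ high_ideal_T_ideal sub(3)])
    show comp: "(w1 n 2 :: 'k gelem) \<in> G_comp d n" "{w1 (n + 1) 2 :: 'k gelem} \<subseteq> G_comp d (n + 1)"
      using n d1 by (simp_all add: w1_G_comp)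
    show "{w1 (n + 1) 2} \<subseteq> T" if "is_T_ideal (G d) T" "V_ideal d (\<beta>1, 0) \<subseteq> T" "w1 n 2 \<in> T" for T
      by (rule T_ideal_V.lower_high[OF loc[OF that(1,2)] n that(3)])
    have "(Poly_Mapping.single 1 2, Poly_Mapping.single 1 (n - 2)) \<in> Mons d 2 1"
      using n d1 by (auto simp: Mons_def)
    then show "(w1 n 2 :: 'k gelem) \<in> high_ideal d"
      using subsetD[OF comp_carr comp(1)] by (simp add: high_ideal_def w1_eq yv_power_zv_power gpoly_def)
    show "high_ideal d \<inter> G_comp d (n + 1) \<subseteq> M"
      if "GL_closed d M" "V_ideal d (\<beta>1, 0) \<subseteq> M" "{w1 (n + 1) 2} \<subseteq> M" for M
      using upper_high'[OF that(1,2), of "n + 1"] that(3) n by auto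
  qed
  have 7: "conseq_equiv d (\<beta>1, 0) n (w2 (n - 1) 1 0) {w1 (n + 1) 2 - w1 (n + 1) 1, w2 n 1 0}" if "n \<ge> 3" for n
    using that by (intro merge w2_comp merge_w2 T_ideal_V.lower_bracket) auto
  show ?thesis
    unfolding assms(2) using 1 2 3 4 5 6 7 by blast
qed

end
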